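(* Let $k\ge 4$ and $\varepsilon>0$, let $p^*=(e/n)^{1/k}$ and $N=\binom n2$, and let $H$ be the $k$-th power of a Hamilton cycle on $[n]$ (vertex set $[n]$, edges $\{v,v+i\}$ for $v\in[n]$, $i\in[k]$, addition modulo $n$). Then for every $p=p(n)\ge(1+\varepsilon)p^*$, the uniform random graph $G(n,pN)$ contains a copy of $H$ with high probability.
   Context: $G(n,M)$ is the random graph on vertex set $[n]$ whose edge set is a uniformly random set of $M$ of the $\binom n2$ potential edges (with $M$ rounded to an integer). With high probability means with probability tending to $1$ as $n\to\infty$. *)

theory Defs
  imports "HOL-Probability.Probability" "HOL-Number_Theory.Cong"
begin

text \<open>A simple graph is a pair of a vertex set and a set of edges, each edge being a two-element set
  of vertices.\<close>

type_synonym 'a sgraph = "'a set \<times> 'a set set"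

definition pairs_of :: "'a set \<Rightarrow> 'a set set" where
  "pairs_of V = {e. e \<subseteq> V \<and> card e = 2}"

text \<open>Meaningful only for \<open>M \<le> n choose 2\<close>: otherwise there is no such graph and
  \<^const>\<open>pmf_of_set\<close> is unspecified on the empty set.\<close>

definition G_uniform :: "nat \<Rightarrow> nat \<Rightarrow> nat sgraph pmf" where
  "G_uniform n M = pmf_of_set {({1..n}, E) | E. E \<subseteq> pairs_of {1..n} \<and> card E = M}"

text \<open>Addition modulo \<open>n\<close> on the representatives \<open>1, \<dots>, n\<close>, hence the congruence in place of
  \<open>(v + i) mod n\<close>. The condition \<open>v \<noteq> w\<close> excludes loops and only matters for \<open>n \<le> k\<close>.\<close>

definition ham_cycle_power :: "nat \<Rightarrow> nat \<Rightarrow> nat sgraph" where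
  "ham_cycle_power n k =
     ({1..n}, {{v, w} | v w i. v \<in> {1..n} \<and> w \<in> {1..n} \<and> v \<noteq> w \<and> i \<in> {1..k} \<and> [w = v + i] (mod n)})"

text \<open>Copies are not required to be induced.\<close>

definition contains_copy :: "'a sgraph \<Rightarrow> 'b sgraph \<Rightarrow> bool" where
  "contains_copy G H \<longleftrightarrow>
     (\<exists>f. inj_on f (fst H) \<and> f ` fst H \<subseteq> fst G \<and> (\<forall>e \<in> snd H. f ` e \<in> snd G))"

definition p_star :: "nat \<Rightarrow> nat \<Rightarrow> real" where
  "p_star k n = (exp 1 / real n) powr (1 / real k)"

end

theory Submission
  imports Defs "HOL-Real_Asymp.Real_Asymp"
begin

text \<open>The second moment method, with copies of the graph \<open>H\<close> indexed by permutations. Let \<open>s(\<pi>)\<close> be the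
  number of edges common to \<open>H\<close> and its preimage under \<open>\<pi>\<close>, let \<open>m = k n\<close> and let \<open>g(a)\<close> be the probability
  that \<open>a\<close> given pairs are edges. Then the containment probability is at least \<open>g(m)\<^sup>2 / E g(2m - s)\<close>, and
  \<open>g(2m - s) \<le> g(2m) r\<^sup>s\<close> with \<open>r = (N - 2m)/(M - 2m)\<close>, which is about \<open>1/p\<close>. Since \<open>g(2m)/g(m)\<^sup>2\<close> is
  at most \<open>(1 + o(1)) exp(- 2k\<^sup>2(r - 1))\<close>, it suffices that \<open>E r\<^sup>s \<le> (1 + o(1)) exp(2k\<^sup>2(r - 1))\<close>.

  Isolated common edges contribute exactly this exponential. A larger component is a connected set of \<open>u\<close>
  points \<open>(x, \<pi> x)\<close> with \<open>f\<close> edges, of expected weight at most \<open>r\<^sup>f (e/n)\<^sup>u\<close>, where \<open>r\<^sup>k \<le> (1 - \<delta>) n / e\<close>.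
  There are about \<open>n\<^sup>2\<close> translates of each, but at least \<open>3k - 3\<close> of the \<open>k u\<close> possible edges are missing as
  long as \<open>k u < n\<close>, which wins for \<open>k \<ge> 4\<close>. The number of shapes is harmless: stretches without missing edges are
  rigid, and every missing edge costs a power of \<open>n\<close>. So these components contribute \<open>o(1)\<close> in total.\<close>

text \<open>The fixed number of edges is essential. At the threshold \<open>r\<close> is of order
  \<open>n powr (1 / k)\<close>, so the factor \<open>exp (2 k^2 (r - 1))\<close> of the isolated
  common edges diverges. With independent edges \<open>g (2 m)\<close> would equal
  \<open>(g m)^2\<close> and nothing would compensate it: it reflects the fluctuation of the number
  of edges. The exponent \<open>2 k^2\<close> arises both from \<open>2 k^2 n^2\<close> potential
  common edges, each of probability about \<open>n^-2\<close>, and as the limit of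
  \<open>m^2 / N\<close>. The obstacle is the entropy of large components. For \<open>u\<close>
  close to \<open>n\<close> the estimate \<open>(e / n)^u\<close> is sharp up to polynomial factors,
  so the whole surplus in \<open>p\<close> is a factor \<open>q^(3 u)\<close> with \<open>q\<close>
  just below one. Counting connected sets through bounded degrees would cost a large constant to the
  power \<open>u\<close>. Hence components are cut into runs without missing edges, which have
  almost no freedom, and an estimate of Kotecky-Preiss type is applied to runs instead of points:
  each run carries a weight tending to zero, and the cost per point can be brought as close to one
  as desired.\<close>

section \<open>Weights of connected sets\<close>

text \<open>The closure is reflexive on the whole type, so pairs outside \<open>T\<close> occur as
  well; the definitions of \<open>conn\<close>, \<open>rooted_sets\<close> and
  \<open>comp_of\<close> therefore ask for membership on their own.\<close>

definition reach :: "('a \<Rightarrow> 'a \<Rightarrow> bool) \<Rightarrow> 'a set \<Rightarrow> ('a \<times> 'a) set" where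
  "reach R T = {(a, b). a \<in> T \<and> b \<in> T \<and> R a b}\<^sup>*"

definition conn :: "('a \<Rightarrow> 'a \<Rightarrow> bool) \<Rightarrow> 'a set \<Rightarrow> bool" where
  "conn R T \<longleftrightarrow> T \<noteq> {} \<and> (\<forall>p\<in>T. \<forall>q\<in>T. (p, q) \<in> reach R T)"

text \<open>Connected sets are not closed under removal of a point, but unions of connected pieces
  that each meet a set \<open>N\<close> of candidate roots are, once the neighbours of the removed
  point join \<open>N\<close>. This makes the induction in \<open>rooted_sets_weight\<close>
  possible.\<close>

definition rooted_sets :: "('a \<Rightarrow> 'a \<Rightarrow> bool) \<Rightarrow> 'a set \<Rightarrow> 'a set \<Rightarrow> 'a set set" where
  "rooted_sets R L N = {Y. Y \<subseteq> L \<and> (\<forall>y\<in>Y. \<exists>v\<in>N \<inter> Y. (v, y) \<in> reach R Y)}"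

lemma reach_refl: "(x, x) \<in> reach R T"
  by (simp add: reach_def)

lemma reach_trans: "(x, y) \<in> reach R T \<Longrightarrow> (y, z) \<in> reach R T \<Longrightarrow> (x, z) \<in> reach R T"
  unfolding reach_def by (rule rtrancl_trans)

lemma reach_step: "x \<in> T \<Longrightarrow> y \<in> T \<Longrightarrow> R x y \<Longrightarrow> (x, y) \<in> reach R T"
  unfolding reach_def by auto

lemma reach_sym:
  assumes "\<And>a b. R a b \<Longrightarrow> R b a" "(x, y) \<in> reach R T"
  shows "(y, x) \<in> reach R T"
proof -
  have "sym {(a, b). a \<in> T \<and> b \<in> T \<and> R a b}"
    using assms(1) by (auto simp: sym_def)
  then show ?thesis
    using assms(2) unfolding reach_def by (meson symD sym_rtrancl)
qed

lemma reach_induct [consumes 1, case_names base step]: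
  assumes "(x, y) \<in> reach R T" "P x"
    "\<And>b c. (x, b) \<in> reach R T \<Longrightarrow> b \<in> T \<Longrightarrow> c \<in> T \<Longrightarrow> R b c \<Longrightarrow> P b \<Longrightarrow> P c"
  shows "P y"
  using assms(1) unfolding reach_def
proof (induction rule: rtrancl_induct)
  case base
  show ?case by (rule assms(2))
next
  case (step b c)
  then show ?case using assms(3)[of b c] by (simp add: reach_def)
qed

text \<open>Follow a path from \<open>v0\<close> to \<open>y\<close> after its last visit to
  \<open>v\<close>: what remains starts at a neighbour of \<open>v\<close>, or at \<open>v0\<close>
  if \<open>v\<close> was never visited.\<close>

lemma reach_remove_root:
  assumes "(v0, y) \<in> reach R Y" "v0 \<in> Y" "y \<noteq> v"
  shows "\<exists>w. w \<in> Y - {v} \<and> (w = v0 \<or> R v w) \<and> (w, y) \<in> reach R (Y - {v})"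
  using assms(1,3)
proof (induction rule: reach_induct)
  case base
  have "(v0, v0) \<in> reach R (Y - {v})" by (rule reach_refl)
  then show ?case using assms(2) base by blast
next
  case (step b c)
  show ?case
  proof (cases "b = v")
    case True
    have "(c, c) \<in> reach R (Y - {v})" by (rule reach_refl)
    then show ?thesis using step.hyps step.prems True by blast
  next
    case False
    then obtain w where w: "w \<in> Y - {v}" "w = v0 \<or> R v w" "(w, b) \<in> reach R (Y - {v})"
      using step.IH by blast
    have "(b, c) \<in> reach R (Y - {v})"
      by (rule reach_step) (use step False in auto)
    with w(3) have "(w, c) \<in> reach R (Y - {v})" by (rule reach_trans)
    then show ?thesis using w by blast
  qed
qed

lemma rooted_setsD:
  assumes "Y \<in> rooted_sets R L N"
  shows "Y \<subseteq> L" and "y \<in> Y \<Longrightarrow> \<exists>v. v \<in> N \<and> v \<in> Y \<and> (v, y) \<in> reach R Y"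
  using assms unfolding rooted_sets_def mem_Collect_eq by auto

lemma rooted_setsI:
  assumes "Y \<subseteq> L" "\<And>y. y \<in> Y \<Longrightarrow> \<exists>v. v \<in> N \<and> v \<in> Y \<and> (v, y) \<in> reach R Y"
  shows "Y \<in> rooted_sets R L N"
  unfolding rooted_sets_def mem_Collect_eq
proof (intro conjI ballI)
  fix y assume "y \<in> Y"
  from assms(2)[OF this] obtain v where "v \<in> N" "v \<in> Y" "(v, y) \<in> reach R Y" by (elim exE conjE)
  then show "\<exists>v\<in>N \<inter> Y. (v, y) \<in> reach R Y" by (intro bexI[of _ v] IntI)
qed (rule assms(1))

lemma rooted_sets_remove:
  assumes "Y \<in> rooted_sets R L N" "v \<in> Y"
  shows "Y - {v} \<in> rooted_sets R (L - {v}) ((N - {v}) \<union> {x \<in> L - {v}. R v x})"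
proof (rule rooted_setsI)
  note YL = rooted_setsD(1)[OF assms(1)]
  then show "Y - {v} \<subseteq> L - {v}" by (rule Diff_mono) simp
  fix y assume y: "y \<in> Y - {v}"
  then have "y \<in> Y" "y \<noteq> v" by simp_all
  from rooted_setsD(2)[OF assms(1) this(1)] obtain v0 where
    *: "v0 \<in> N" "v0 \<in> Y" "(v0, y) \<in> reach R Y" by (elim exE conjE)
  from reach_remove_root[OF *(3,2) \<open>y \<noteq> v\<close>] obtain w where
    w: "w \<in> Y - {v}" "w = v0 \<or> R v w" "(w, y) \<in> reach R (Y - {v})" by (elim exE conjE)
  have "w \<in> L" using w(1) YL by (simp add: subset_iff)
  then have "w \<in> (N - {v}) \<union> {x \<in> L - {v}. R v x}"
    using w(1,2) *(1) by (elim disjE) simp_all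
  then show "\<exists>w. w \<in> (N - {v}) \<union> {x \<in> L - {v}. R v x} \<and> w \<in> Y - {v} \<and> (w, y) \<in> reach R (Y - {v})"
    using w(1,3) by (intro exI[of _ w] conjI)
qed

lemma rooted_sets_avoid:
  assumes "Y \<in> rooted_sets R L N" "v \<notin> Y"
  shows "Y \<in> rooted_sets R (L - {v}) (N - {v})"
proof (rule rooted_setsI)
  show "Y \<subseteq> L - {v}" using rooted_setsD(1)[OF assms(1)] assms(2) by (simp add: subset_Diff_insert)
  fix y assume y: "y \<in> Y"
  from rooted_setsD(2)[OF assms(1) this] obtain v0 where
    *: "v0 \<in> N" "v0 \<in> Y" "(v0, y) \<in> reach R Y" by (elim exE conjE)
  then show "\<exists>w. w \<in> N - {v} \<and> w \<in> Y \<and> (w, y) \<in> reach R Y"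
    using assms(2) by (intro exI[of _ v0] conjI) auto
qed

lemma finite_rooted_sets: "finite L \<Longrightarrow> finite (rooted_sets R L N)"
  by (rule finite_subset[of _ "Pow L"]) (auto simp: rooted_sets_def)

lemma sum_prod_remove_le:
  fixes z :: "'a \<Rightarrow> real"
  assumes L: "finite L" and z: "\<And>x. x \<in> L \<Longrightarrow> 0 \<le> z x" and v: "v \<in> L"
    and S: "\<And>Y. Y \<in> S \<Longrightarrow> Y \<subseteq> L \<and> v \<in> Y \<and> Y - {v} \<in> D" and D: "D \<subseteq> Pow L"
  shows "(\<Sum>Y\<in>S. \<Prod>y\<in>Y. z y) \<le> z v * (\<Sum>Y\<in>D. \<Prod>y\<in>Y. z y)"
proof -
  have "(\<Sum>Y\<in>S. \<Prod>y\<in>Y. z y) = (\<Sum>Y\<in>(\<lambda>Y. Y - {v}) ` S. z v * (\<Prod>y\<in>Y. z y))"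
  proof (subst sum.reindex)
    show "inj_on (\<lambda>Y. Y - {v}) S" using S by (intro inj_onI) (metis insert_Diff)
    show "(\<Sum>Y\<in>S. \<Prod>y\<in>Y. z y) = sum ((\<lambda>Y. z v * (\<Prod>y\<in>Y. z y)) \<circ> (\<lambda>Y. Y - {v})) S"
    proof (rule sum.cong[OF refl])
      fix Y assume "Y \<in> S"
      then have Y: "Y \<subseteq> L" "v \<in> Y" using S by simp_all
      then show "(\<Prod>y\<in>Y. z y) = ((\<lambda>Y. z v * (\<Prod>y\<in>Y. z y)) \<circ> (\<lambda>Y. Y - {v})) Y"
        using prod.remove[OF finite_subset[OF Y(1) L] Y(2), of z] by simp
    qed
  qed
  also have "\<dots> \<le> (\<Sum>Y\<in>D. z v * (\<Prod>y\<in>Y. z y))"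
  proof (rule sum_mono2)
    show "finite D" by (rule finite_subset[OF D]) (use L in simp)
    show "(\<lambda>Y. Y - {v}) ` S \<subseteq> D" using S by (intro image_subsetI) simp
    show "0 \<le> z v * (\<Prod>y\<in>Y. z y)" if "Y \<in> D - (\<lambda>Y. Y - {v}) ` S" for Y
      using that D z v by (intro mult_nonneg_nonneg prod_nonneg) blast+
  qed
  finally show ?thesis by (simp add: sum_distrib_left)
qed

text \<open>A bound of Kotecky--Preiss type: reveal whether one candidate root \<open>v\<close> belongs to the set; if it
  does, its neighbours become candidate roots of the rest.\<close>

lemma rooted_sets_weight:
  fixes z a :: "'a \<Rightarrow> real"
  assumes fin: "finite L" and NL: "N \<subseteq> L"
    and z: "\<And>g. g \<in> L \<Longrightarrow> 0 \<le> z g"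
    and KP: "\<And>g. g \<in> L \<Longrightarrow> (\<Sum>h\<in>{h \<in> L. R g h}. z h * exp (a h)) \<le> a g"
  shows "(\<Sum>Y\<in>rooted_sets R L N. \<Prod>y\<in>Y. z y) \<le> exp (\<Sum>v\<in>N. z v * exp (a v))"
  using assms
proof (induction "card L" arbitrary: L N rule: less_induct)
  case less
  show ?case
  proof (cases "N = {}")
    case True
    then have "rooted_sets R L N = {{}}"
      by (auto simp: rooted_sets_def)
    then show ?thesis using True by simp
  next
    case False
    then obtain v where v: "v \<in> N" by auto
    then have vL: "v \<in> L" using less.prems by auto
    define L' where "L' = L - {v}"
    define D where "D = {x \<in> L'. R v x}"
    define t where "t h = z h * exp (a h)" for h
    have finL: "finite L'" "finite D" "finite N"
      using less.prems finite_subset by (auto simp: L'_def D_def)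
    have card: "card L' < card L"
      unfolding L'_def using vL less.prems(1) by (rule card_Diff1_less[rotated])
    have t0: "0 \<le> t h" if "h \<in> L" for h using less.prems(3)[OF that] by (simp add: t_def)
    have KP': "(\<Sum>h\<in>{h \<in> L'. R g h}. t h) \<le> a g" if "g \<in> L" for g
    proof -
      have "(\<Sum>h\<in>{h \<in> L'. R g h}. t h) \<le> (\<Sum>h\<in>{h \<in> L. R g h}. t h)"
        by (rule sum_mono2) (use less.prems(1) t0 in \<open>auto simp: L'_def\<close>)
      also have "\<dots> \<le> a g" using less.prems(4)[OF that] by (simp add: t_def)
      finally show ?thesis .
    qed
    have IH: "(\<Sum>Y\<in>rooted_sets R L' N'. \<Prod>y\<in>Y. z y) \<le> exp (\<Sum>v\<in>N'. t v)" if "N' \<subseteq> L'" for N'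
      unfolding t_def
    proof (rule less.hyps[OF card])
      show "finite L'" by (rule finL)
      show "N' \<subseteq> L'" by fact
      show "0 \<le> z g" if "g \<in> L'" for g using that less.prems(3) by (auto simp: L'_def)
      show "(\<Sum>h\<in>{h \<in> L'. R g h}. z h * exp (a h)) \<le> a g" if "g \<in> L'" for g
        using KP'[of g] that by (auto simp: L'_def t_def)
    qed
    define N' where "N' = N - {v}"
    have N'L: "N' \<subseteq> L'" "D \<subseteq> L'" using less.prems(2) by (auto simp: N'_def L'_def D_def)
    let ?S = "rooted_sets R L N" and ?P = "\<lambda>Y. \<Prod>y\<in>Y. z y"
    have finS: "finite ?S" using less.prems(1) by (rule finite_rooted_sets)
    have pos: "0 \<le> ?P Y" if "Y \<subseteq> L" for Y
      using that less.prems(3) by (intro prod_nonneg) auto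
    have "(\<Sum>Y\<in>?S. ?P Y) = (\<Sum>Y\<in>{Y\<in>?S. v \<notin> Y}. ?P Y) + (\<Sum>Y\<in>{Y\<in>?S. v \<in> Y}. ?P Y)"
      using finS by (subst sum.union_disjoint[symmetric]) (auto intro!: sum.cong)
    also have "(\<Sum>Y\<in>{Y\<in>?S. v \<notin> Y}. ?P Y) \<le> (\<Sum>Y\<in>rooted_sets R L' N'. ?P Y)"
    proof (rule sum_mono2)
      show "{Y \<in> ?S. v \<notin> Y} \<subseteq> rooted_sets R L' N'"
        unfolding L'_def N'_def by (auto intro: rooted_sets_avoid)
      show "0 \<le> ?P Y" if "Y \<in> rooted_sets R L' N' - {Y \<in> ?S. v \<notin> Y}" for Y
        using that by (intro pos) (auto simp: rooted_sets_def L'_def)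
    qed (use finL in \<open>auto intro: finite_rooted_sets\<close>)
    also have "\<dots> \<le> exp (\<Sum>v\<in>N'. t v)" by (rule IH[OF N'L(1)])
    also have "(\<Sum>Y\<in>{Y\<in>?S. v \<in> Y}. ?P Y) \<le> z v * (\<Sum>Y\<in>rooted_sets R L' (N' \<union> D). ?P Y)"
    proof (rule sum_prod_remove_le[OF less.prems(1,3) vL])
      show "Y \<subseteq> L \<and> v \<in> Y \<and> Y - {v} \<in> rooted_sets R L' (N' \<union> D)" if "Y \<in> {Y \<in> ?S. v \<in> Y}" for Y
      proof -
        have Y: "Y \<in> ?S" "v \<in> Y" using that by simp_all
        show ?thesis
          using rooted_setsD(1)[OF Y(1)] rooted_sets_remove[OF Y] Y(2) unfolding L'_def N'_def D_def by simp
      qed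
      show "rooted_sets R L' (N' \<union> D) \<subseteq> Pow L" by (auto simp: rooted_sets_def L'_def)
    qed
    also have "\<dots> \<le> z v * exp (\<Sum>v\<in>N' \<union> D. t v)"
      by (intro mult_left_mono IH) (use N'L less.prems(3)[OF vL] in auto)
    \<comment> \<open>By the hypothesis on \<open>a\<close> at \<open>v\<close>, all new candidate
      roots together cost at most \<open>exp (a v)\<close>. So containing \<open>v\<close> costs the
      factor \<open>t v\<close>, and \<open>1 + t v \<le> exp (t v)\<close> closes the
      induction.\<close>
    also have "\<dots> \<le> z v * exp ((\<Sum>v\<in>N'. t v) + a v)"
    proof (intro mult_left_mono)
      have "(\<Sum>v\<in>N' \<union> D. t v) \<le> (\<Sum>v\<in>N'. t v) + (\<Sum>v\<in>D. t v)"
      proof -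
        have "(\<Sum>v\<in>N' \<union> D. t v) + (\<Sum>v\<in>N' \<inter> D. t v) = (\<Sum>v\<in>N'. t v) + (\<Sum>v\<in>D. t v)"
          using finL by (intro sum.union_inter) (auto simp: N'_def)
        moreover have "0 \<le> (\<Sum>v\<in>N' \<inter> D. t v)"
          by (intro sum_nonneg t0) (auto simp: D_def L'_def)
        ultimately show ?thesis by linarith
      qed
      also have "(\<Sum>v\<in>D. t v) \<le> a v" unfolding D_def by (rule KP'[OF vL])
      finally show "exp (\<Sum>v\<in>N' \<union> D. t v) \<le> exp ((\<Sum>v\<in>N'. t v) + a v)" by simp
    qed (use less.prems(3)[OF vL] in auto)
    also have "exp (\<Sum>v\<in>N'. t v) + z v * exp ((\<Sum>v\<in>N'. t v) + a v) = exp (\<Sum>v\<in>N'. t v) * (1 + t v)"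
      by (simp add: t_def exp_add algebra_simps)
    also have "\<dots> \<le> exp (\<Sum>v\<in>N'. t v) * exp (t v)" by (intro mult_left_mono) auto
    also have "\<dots> = exp (\<Sum>v\<in>N. t v)"
      using sum.remove[OF finL(3) v, of t] by (simp add: N'_def add.commute flip: exp_add)
    finally show ?thesis by (simp add: t_def)
  qed
qed

text \<open>Removing \<open>g\<close> first keeps the factor \<open>z g\<close>; applying
  \<open>rooted_sets_weight\<close> directly with \<open>g\<close> as the only root would also count
  the empty set and lose this factor.\<close>

lemma conn_sets_weight:
  fixes z a :: "'a \<Rightarrow> real"
  assumes fin: "finite L" and g: "g \<in> L"
    and z: "\<And>g. g \<in> L \<Longrightarrow> 0 \<le> z g"
    and KP: "\<And>g. g \<in> L \<Longrightarrow> (\<Sum>h\<in>{h \<in> L. R g h}. z h * exp (a h)) \<le> a g"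
  shows "(\<Sum>X\<in>{X. X \<subseteq> L \<and> g \<in> X \<and> conn R X}. \<Prod>x\<in>X. z x) \<le> z g * exp (a g)"
proof -
  define L' where "L' = L - {g}"
  define D where "D = {x \<in> L'. R g x}"
  define C where "C = {X. X \<subseteq> L \<and> g \<in> X \<and> conn R X}"
  have sub: "(\<Sum>h\<in>{h \<in> L'. R f h}. z h * exp (a h)) \<le> a f" if "f \<in> L" for f
  proof -
    have "(\<Sum>h\<in>{h \<in> L'. R f h}. z h * exp (a h)) \<le> (\<Sum>h\<in>{h \<in> L. R f h}. z h * exp (a h))"
      by (rule sum_mono2) (use fin z in \<open>auto simp: L'_def\<close>)
    also have "\<dots> \<le> a f" using KP[OF that] .
    finally show ?thesis .
  qed
  have "(\<Sum>X\<in>C. \<Prod>x\<in>X. z x) \<le> z g * (\<Sum>Y\<in>rooted_sets R L' D. \<Prod>x\<in>Y. z x)"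
  proof (rule sum_prod_remove_le[OF fin z g])
    fix X assume X: "X \<in> C"
    then have "X \<in> rooted_sets R L {g}" by (auto simp: C_def conn_def rooted_sets_def)
    from rooted_sets_remove[OF this, of g] show "X \<subseteq> L \<and> g \<in> X \<and> X - {g} \<in> rooted_sets R L' D"
      using X by (simp add: C_def L'_def D_def)
  qed (auto simp: rooted_sets_def L'_def)
  also have "\<dots> \<le> z g * exp (\<Sum>v\<in>D. z v * exp (a v))"
    by (intro mult_left_mono rooted_sets_weight) (use fin z g sub in \<open>auto simp: L'_def D_def\<close>)
  also have "\<dots> \<le> z g * exp (a g)"
    by (intro mult_left_mono) (use z g sub in \<open>auto simp: D_def\<close>)
  finally show ?thesis by (simp add: C_def)
qed

section \<open>Cliques in powers of cycles\<close>

text \<open>Adjacency in the \<open>k\<close>-th power of the cycle on the residues modulo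
  \<open>n\<close>. Integers replace the vertices \<open>1..n\<close> of the theorem so that
  differences can be reduced modulo \<open>n\<close>; the shift by one is undone in
  \<open>copy_edges\<close>.\<close>

definition cadj :: "nat \<Rightarrow> nat \<Rightarrow> int \<Rightarrow> int \<Rightarrow> bool" where
  "cadj n k x y \<longleftrightarrow> x \<noteq> y \<and> ((y - x) mod int n \<le> int k \<or> (x - y) mod int n \<le> int k)"

definition verts :: "nat \<Rightarrow> int set" where
  "verts n = {0..<int n}"

lemma cadj_sym: "cadj n k x y \<Longrightarrow> cadj n k y x"
  unfolding cadj_def by auto

text \<open>The representative of \<open>w - c\<close> modulo \<open>n\<close> in \<open>{-k..<n-k}\<close>.\<close>

definition sres :: "nat \<Rightarrow> nat \<Rightarrow> int \<Rightarrow> int \<Rightarrow> int" where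
  "sres n k c w = (w - c + int k) mod int n - int k"

lemma inj_on_sres: "inj_on (sres n k c) (verts n)"
proof (rule inj_onI)
  fix x y assume xy: "x \<in> verts n" "y \<in> verts n" "sres n k c x = sres n k c y"
  then have "(x - c + int k) mod int n = (y - c + int k) mod int n" by (simp add: sres_def)
  then have "(x - c + int k - (y - c + int k)) mod int n = 0"
    by (simp add: mod_eq_dvd_iff)
  then have "int n dvd x - y" by (simp add: mod_eq_0_iff_dvd)
  moreover have "\<bar>x - y\<bar> < int n" using xy by (auto simp: verts_def)
  ultimately show "x = y" using zdvd_imp_le[of "int n" "\<bar>x - y\<bar>"] by fastforce
qed

lemma sres_cong: "n > 0 \<Longrightarrow> \<exists>q. w - c = sres n k c w + int n * q"
  unfolding sres_def
  by (rule exI[of _ "(w - c + int k) div int n"]) (smt (verit) mult_div_mod_eq)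

lemma sres_self: "k < n \<Longrightarrow> sres n k c c = 0"
  by (simp add: sres_def)

lemma sres_bounds:
  assumes "cadj n k w c" "n > 3 * k" "n > 0"
  shows "sres n k c w \<in> {- int k..int k}"
proof -
  obtain q where q: "w - c = sres n k c w + int n * q" using sres_cong[OF assms(3)] by blast
  define d where "d = sres n k c w"
  have d: "- int k \<le> d" "d < int n - int k"
    using assms by (simp_all add: d_def sres_def)
  have wc: "(w - c) mod int n = d mod int n" using q by (simp add: d_def)
  have cw: "(c - w) mod int n = (- d) mod int n"
    using q by (metis d_def minus_diff_eq mod_minus_cong mod_mult_self2)
  have "d \<le> int k"
  proof (rule ccontr)
    assume "\<not> d \<le> int k"
    then have "d mod int n = d" "(- d) mod int n = int n - d"
      using d by (auto simp: zmod_zminus1_eq_if)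
    then show False using assms(1) wc cw d \<open>\<not> d \<le> int k\<close> by (auto simp: cadj_def)
  qed
  then show ?thesis using d by (simp add: d_def)
qed

text \<open>Two representatives in \<open>{- k..k}\<close> differ by at most \<open>2 k\<close>. If
  they differed by more than \<open>k\<close>, the distance the other way round, at least
  \<open>n - 2 k\<close>, would exceed \<open>k\<close> too because \<open>n > 3 k\<close>. So no
  adjacency is created by wrapping around.\<close>

lemma sres_diff:
  assumes "cadj n k w w'" "n > 3 * k" "n > 0"
    and "sres n k c w \<in> {- int k..int k}" "sres n k c w' \<in> {- int k..int k}"
  shows "\<bar>sres n k c w - sres n k c w'\<bar> \<le> int k"
proof -
  obtain q where q: "w - c = sres n k c w + int n * q" using sres_cong[OF assms(3)] by blast
  obtain q' where q': "w' - c = sres n k c w' + int n * q'" using sres_cong[OF assms(3)] by blast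
  define d where "d = sres n k c w - sres n k c w'"
  have d: "- 2 * int k \<le> d" "d \<le> 2 * int k" using assms by (auto simp: d_def)
  have e: "w - w' = d + int n * (q - q')" using q q' by (simp add: d_def algebra_simps)
  have wc: "(w - w') mod int n = d mod int n" using e by simp
  have "w' - w = - d + int n * (q' - q)" using e by (simp add: algebra_simps)
  then have cw: "(w' - w) mod int n = (- d) mod int n" by (simp only: mod_mult_self2)
  have "\<bar>d\<bar> \<le> int k"
  proof (rule ccontr)
    assume a: "\<not> \<bar>d\<bar> \<le> int k"
    show False
    proof (cases "d > 0")
      case True
      then have "d mod int n = d" "(- d) mod int n = int n - d"
        using d assms(2) by (auto simp: zmod_zminus1_eq_if)
      then show False using assms(1,2) wc cw d a True by (auto simp: cadj_def)
    next
      case False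
      then have "(- d) mod int n = - d" using d assms(2) by simp
      moreover have "d mod int n = int n + d"
        using False d assms(2) a by (intro int_mod_pos_eq[of _ _ "-1"]) auto
      ultimately show False using assms(1,2) wc cw d a False by (auto simp: cadj_def)
    qed
  qed
  then show ?thesis by (simp add: d_def)
qed

lemma finite_verts [simp]: "finite (verts n)"
  by (simp add: verts_def)

lemma cadj_degree:
  assumes "n > 3 * k" "c \<in> verts n"
  shows "card {w \<in> verts n. cadj n k c w} \<le> 2 * k"
proof -
  have n: "n > 0" using assms by auto
  have "card {w \<in> verts n. cadj n k c w} = card (sres n k c ` {w \<in> verts n. cadj n k c w})"
    by (rule card_image[symmetric], rule inj_on_subset[OF inj_on_sres]) auto
  also have "\<dots> \<le> card ({- int k..int k} - {0})"
  proof (rule card_mono)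
    show "sres n k c ` {w \<in> verts n. cadj n k c w} \<subseteq> {- int k..int k} - {0}"
    proof (rule image_subsetI)
      fix w assume w: "w \<in> {w \<in> verts n. cadj n k c w}"
      then have "sres n k c w \<noteq> sres n k c c"
        using inj_onD[OF inj_on_sres, of n k c w c] assms by (auto simp: cadj_def)
      then show "sres n k c w \<in> {- int k..int k} - {0}"
        using sres_bounds[of n k w c] w assms n cadj_sym by (auto simp: sres_self)
    qed
  qed simp
  also have "\<dots> = 2 * k" by (subst card_Diff_singleton) auto
  finally show ?thesis .
qed

text \<open>In coordinates around one clique vertex this is a question about integer intervals. The
  clique has \<open>k\<close> distinct coordinates, so \<open>hi - lo \<ge> k - 1\<close>, and
  clique and common neighbours together lie in \<open>{hi - k..lo + k}\<close>, which has at most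
  \<open>k + 2\<close> elements; \<open>k\<close> of them are the clique.\<close>

lemma clique_common_neighbours:
  assumes n: "n > 3 * k" and k: "k \<ge> 1" and C: "C \<subseteq> verts n" "card C = k"
    and cl: "\<And>c c'. c \<in> C \<Longrightarrow> c' \<in> C \<Longrightarrow> c \<noteq> c' \<Longrightarrow> cadj n k c c'"
  shows "card {w \<in> verts n. \<forall>c\<in>C. cadj n k w c} \<le> 2"
proof -
  have n0: "n > 0" using n by simp
  have finC: "finite C" by (rule finite_subset[OF C(1)]) simp
  obtain c0 where c0: "c0 \<in> C" using C k by fastforce
  define s where "s = sres n k c0"
  define W where "W = {w \<in> verts n. \<forall>c\<in>C. cadj n k w c}"
  have finW: "finite W" by (simp add: W_def)
  have CW: "C \<inter> W = {}" by (auto simp: W_def cadj_def)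
  have inj: "inj_on s (C \<union> W)"
    unfolding s_def by (rule inj_on_subset[OF inj_on_sres]) (use C in \<open>auto simp: W_def\<close>)
  have b: "s w \<in> {- int k..int k}" if "w \<in> C \<union> W" for w
  proof (cases "w = c0")
    case True
    then show ?thesis using n by (simp add: s_def sres_self)
  next
    case False
    then have "cadj n k w c0" using that cl c0 by (auto simp: W_def)
    then show ?thesis unfolding s_def using sres_bounds n n0 by blast
  qed
  have diff: "\<bar>s w - s c\<bar> \<le> int k" if "w \<in> C \<union> W" "c \<in> C" for w c
  proof (cases "w = c")
    case False
    then have "cadj n k w c" using that cl by (auto simp: W_def)
    then show ?thesis using sres_diff[of n k w c c0] n n0 b[of w] b[of c] that
      by (simp add: s_def)
  qed simp
  define lo where "lo = Min (s ` C)"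
  define hi where "hi = Max (s ` C)"
  have lo: "lo \<in> s ` C" "\<And>c. c \<in> C \<Longrightarrow> lo \<le> s c"
    unfolding lo_def using finC c0 by (auto intro!: Min_in)
  have hi: "hi \<in> s ` C" "\<And>c. c \<in> C \<Longrightarrow> s c \<le> hi"
    unfolding hi_def using finC c0 by (auto intro!: Max_in)
  have "k = card (s ` C)"
    using C card_image[of s C] inj by (metis inj_on_Un)
  also have "\<dots> \<le> card {lo..hi}" by (rule card_mono) (use lo hi in auto)
  finally have sp: "int k \<le> hi - lo + 1" using k by auto
  have "card C + card W = card (C \<union> W)"
    using finC finW CW by (simp add: card_Un_disjoint)
  also have "\<dots> = card (s ` (C \<union> W))" using card_image[OF inj] by simp
  also have "\<dots> \<le> card {hi - int k..lo + int k}"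
  proof (rule card_mono)
    show "s ` (C \<union> W) \<subseteq> {hi - int k..lo + int k}"
    proof (rule image_subsetI)
      fix w assume w: "w \<in> C \<union> W"
      obtain c1 c2 where "c1 \<in> C" "lo = s c1" "c2 \<in> C" "hi = s c2" using lo hi by auto
      then show "s w \<in> {hi - int k..lo + int k}" using diff[OF w, of c1] diff[OF w, of c2] by auto
    qed
  qed simp
  also have "\<dots> \<le> k + 2" using sp by simp
  finally show ?thesis using C by (simp add: W_def)
qed

text \<open>Injective images of the \<open>k\<close>-th power of a path in the \<open>k\<close>-th
  power of the cycle. They occur as the rows met by a partial permutation over consecutive columns
  when no edge is missing.\<close>

definition power_path :: "nat \<Rightarrow> nat \<Rightarrow> int list \<Rightarrow> bool" where
  "power_path n k ys \<longleftrightarrow> distinct ys \<and> set ys \<subseteq> verts n \<and>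
     (\<forall>i j. i < j \<and> j < length ys \<and> j - i \<le> k \<longrightarrow> cadj n k (ys ! i) (ys ! j))"

definition power_paths :: "nat \<Rightarrow> nat \<Rightarrow> int \<Rightarrow> nat \<Rightarrow> int list set" where
  "power_paths n k y l = {ys. power_path n k ys \<and> length ys = l \<and> hd ys = y}"

lemma finite_power_paths: "finite (power_paths n k y l)"
  by (rule finite_subset[OF _ finite_lists_length_eq[of "verts n" l]])
     (auto simp: power_paths_def power_path_def)

lemma power_path_butlast: "power_path n k (ys @ [w]) \<Longrightarrow> power_path n k ys"
  unfolding power_path_def
proof (elim conjE, intro conjI allI impI)
  fix i j
  assume *: "\<forall>i j. i < j \<and> j < length (ys @ [w]) \<and> j - i \<le> k \<longrightarrow> cadj n k ((ys @ [w]) ! i) ((ys @ [w]) ! j)"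
    "i < j \<and> j < length ys \<and> j - i \<le> k"
  then have "cadj n k ((ys @ [w]) ! i) ((ys @ [w]) ! j)" by auto
  then show "cadj n k (ys ! i) (ys ! j)" using *(2) by (simp add: nth_append)
qed auto

text \<open>Rigidity: past the first \<open>k + 1\<close> entries the next one is forced, because a \<open>k\<close>-clique has at most
  two common neighbours and one of them already occurs in the list.\<close>

lemma power_path_ext_card:
  assumes n: "n > 3 * k" and k: "k \<ge> 1" and l: "length ys \<ge> 1"
  shows "card {w. power_path n k (ys @ [w])} \<le> (if length ys \<ge> k + 1 then 1 else 2 * k)"
proof -
  define l where "l = length ys"
  have l1: "l \<ge> 1" using l by (simp add: l_def)
  have adj: "cadj n k w (ys ! i)" if "power_path n k (ys @ [w])" "i < l" "l \<le> i + k" for w i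
  proof -
    have "cadj n k ((ys @ [w]) ! i) ((ys @ [w]) ! l)"
      using that unfolding power_path_def l_def by (elim conjE allE[of _ i] allE[of _ "length ys"]) auto
    then show ?thesis using that(2) by (simp add: nth_append l_def cadj_sym)
  qed
  show ?thesis
  proof (cases "\<exists>w. power_path n k (ys @ [w])")
    case False
    then show ?thesis by simp
  next
    case True
    then have v: "power_path n k ys" using power_path_butlast by blast
    then have d: "distinct ys" and sv: "set ys \<subseteq> verts n" by (auto simp: power_path_def)
    show ?thesis
    proof (cases "l \<ge> k + 1")
      case False
      have "card {w. power_path n k (ys @ [w])} \<le> card {w \<in> verts n. cadj n k (ys ! (l - 1)) w}"
        using adj[of _ "l - 1"] l1 k by (intro card_mono) (auto simp: power_path_def intro: cadj_sym)
      also have "\<dots> \<le> 2 * k"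
        by (rule cadj_degree[OF n]) (use sv l1 in \<open>auto simp: l_def\<close>)
      finally show ?thesis using False by (simp add: l_def)
    next
      case True
      define C where "C = (\<lambda>i. ys ! i) ` {l - k..<l}"
      have C1: "C \<subseteq> verts n" using sv by (auto simp: C_def l_def)
      have C2: "card C = k"
        unfolding C_def using d True
        by (subst card_image) (auto simp: inj_on_def l_def nth_eq_iff_index_eq)
      have C3: "cadj n k c c'" if cc: "c \<in> C" "c' \<in> C" "c \<noteq> c'" for c c'
      proof -
        have *: "cadj n k (ys ! i) (ys ! j)" if "i < j" "j < l" "l - k \<le> i" for i j
          using v that unfolding power_path_def l_def by auto
        obtain i j where ij: "c = ys ! i" "c' = ys ! j" "i \<in> {l - k..<l}" "j \<in> {l - k..<l}"
          using cc by (auto simp: C_def)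
        consider "i < j" | "j < i" using cc ij by fastforce
        then show ?thesis
          by cases (use ij *[of i j] *[of j i] in \<open>auto intro: cadj_sym\<close>)
      qed
      let ?W = "{w \<in> verts n. \<forall>c\<in>C. cadj n k w c}"
      let ?c = "ys ! (l - k - 1)"
      have cW: "?c \<in> ?W"
      proof -
        have "cadj n k ?c (ys ! i)" if "i \<in> {l - k..<l}" for i
          using v that True unfolding power_path_def l_def
          by (elim conjE allE[of _ "length ys - k - 1"] allE[of _ i]) auto
        moreover have "?c \<in> verts n" using sv True by (auto simp: l_def)
        ultimately show ?thesis by (auto simp: C_def)
      qed
      have "card {w. power_path n k (ys @ [w])} \<le> card (?W - {?c})"
      proof (rule card_mono)
        show "{w. power_path n k (ys @ [w])} \<subseteq> ?W - {?c}"
        proof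
          fix w assume w: "w \<in> {w. power_path n k (ys @ [w])}"
          then have "w \<in> verts n" "w \<notin> set ys" by (auto simp: power_path_def)
          then show "w \<in> ?W - {?c}" using adj w True by (auto simp: C_def l_def)
        qed
      qed simp
      also have "\<dots> = card ?W - 1" using cW by (simp add: card_Diff_singleton)
      also have "\<dots> \<le> 1" using clique_common_neighbours[OF n k C1 C2 C3] by simp
      finally show ?thesis using True by (simp add: l_def)
    qed
  qed
qed

lemma card_power_paths_Suc:
  assumes n: "n > 3 * k" and k: "k \<ge> 1" and l: "l \<ge> 1"
  shows "card (power_paths n k y (Suc l)) \<le> card (power_paths n k y l) * (if l \<ge> k + 1 then 1 else 2 * k)"
proof -
  define E where "E ys = (\<lambda>w. ys @ [w]) ` {w. power_path n k (ys @ [w])}" for ys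
  have fw: "finite {w. power_path n k (ys @ [w])}" for ys
    by (rule finite_subset[of _ "verts n"]) (auto simp: power_path_def)
  have "power_paths n k y (Suc l) \<subseteq> (\<Union>ys\<in>power_paths n k y l. E ys)"
  proof
    fix zs assume zs: "zs \<in> power_paths n k y (Suc l)"
    then obtain ys w where e: "zs = ys @ [w]" "length ys = l"
      by (auto simp: power_paths_def length_Suc_conv_rev)
    then have "ys \<in> power_paths n k y l"
      using zs l power_path_butlast by (auto simp: power_paths_def hd_append)
    then show "zs \<in> (\<Union>ys\<in>power_paths n k y l. E ys)" using e zs by (auto simp: E_def power_paths_def)
  qed
  then have "card (power_paths n k y (Suc l)) \<le> card (\<Union>ys\<in>power_paths n k y l. E ys)"
    by (intro card_mono) (auto simp: finite_power_paths E_def fw)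
  also have "\<dots> \<le> (\<Sum>ys\<in>power_paths n k y l. card (E ys))" by (rule card_UN_le[OF finite_power_paths])
  also have "\<dots> \<le> (\<Sum>ys\<in>power_paths n k y l. (if l \<ge> k + 1 then 1 else 2 * k))"
  proof (rule sum_mono)
    fix ys assume "ys \<in> power_paths n k y l"
    then have "length ys = l" by (simp add: power_paths_def)
    then show "card (E ys) \<le> (if l \<ge> k + 1 then 1 else 2 * k)"
      using power_path_ext_card[OF n k, of ys] l card_image_le[OF fw, of "\<lambda>w. ys @ [w]" ys]
      by (simp add: E_def)
  qed
  finally show ?thesis by simp
qed

text \<open>The bound is independent of \<open>l\<close>: only the first \<open>k\<close> extensions
  leave a choice, of at most \<open>2 k\<close> vertices each.\<close>

lemma card_power_paths:
  assumes n: "n > 3 * k" and k: "k \<ge> 1" and l: "l \<ge> 1"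
  shows "card (power_paths n k y l) \<le> (2 * k) ^ k"
proof -
  have "card (power_paths n k y (Suc l)) \<le> (2 * k) ^ (min l k)" for l
  proof (induction l)
    case 0
    have "power_paths n k y (Suc 0) \<subseteq> {[y]}" by (auto simp: power_paths_def length_Suc_conv)
    then have "card (power_paths n k y (Suc 0)) \<le> card {[y]}" by (intro card_mono) auto
    then show ?case by simp
  next
    case (Suc l)
    have "card (power_paths n k y (Suc (Suc l)))
        \<le> card (power_paths n k y (Suc l)) * (if Suc l \<ge> k + 1 then 1 else 2 * k)"
      by (rule card_power_paths_Suc[OF n k]) simp
    also have "\<dots> \<le> (2 * k) ^ (min l k) * (if Suc l \<ge> k + 1 then 1 else 2 * k)"
      by (rule mult_right_mono[OF Suc]) simp
    also have "\<dots> = (2 * k) ^ (min (Suc l) k)" by (auto simp: min_def not_less_eq_eq)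
    finally show ?case .
  qed
  from this[of "l - 1"] have "card (power_paths n k y l) \<le> (2 * k) ^ (min (l - 1) k)" using l by simp
  also have "\<dots> \<le> (2 * k) ^ k" by (rule power_increasing) (use k in auto)
  finally show ?thesis .
qed

section \<open>Segments of partial permutations\<close>

type_synonym pset = "(int \<times> int) set"

definition pts :: "nat \<Rightarrow> pset" where
  "pts n = verts n \<times> verts n"

text \<open>A point \<open>(x, y)\<close> stands for \<open>y\<close> being the image of
  \<open>x\<close>. On the graph of a permutation, adjacency means that the two columns and their
  two images both form edges of \<open>H\<close>, so the adjacent pairs are the common edges of the
  overview.\<close>

definition padj :: "nat \<Rightarrow> nat \<Rightarrow> int \<times> int \<Rightarrow> int \<times> int \<Rightarrow> bool" where
  "padj n k p q \<longleftrightarrow> cadj n k (fst p) (fst q) \<and> cadj n k (snd p) (snd q)"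

definition pperm :: "nat \<Rightarrow> pset \<Rightarrow> bool" where
  "pperm n T \<longleftrightarrow> T \<subseteq> pts n \<and> inj_on fst T \<and> inj_on snd T"

text \<open>A block of consecutive columns with no edge missing inside. Columns are compared as
  integers, so a segment never wraps around; only the rows are tested, since columns at distance at
  most \<open>k\<close> are adjacent anyway.\<close>

definition segment :: "nat \<Rightarrow> nat \<Rightarrow> pset \<Rightarrow> bool" where
  "segment n k g \<longleftrightarrow> g \<noteq> {} \<and> pperm n g \<and> (\<exists>a b. fst ` g = {a..b}) \<and>
     (\<forall>p\<in>g. \<forall>q\<in>g. fst p < fst q \<and> fst q \<le> fst p + int k \<longrightarrow> cadj n k (snd p) (snd q))"

lemma finite_pts [simp]: "finite (pts n)"
  by (simp add: pts_def)

lemma card_pts: "card (pts n) = n * n"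
  by (simp add: pts_def verts_def card_cartesian_product)

lemma pperm_finite: "pperm n T \<Longrightarrow> finite T"
  by (rule finite_subset[OF _ finite_pts]) (auto simp: pperm_def)

lemma pperm_subset: "pperm n T \<Longrightarrow> S \<subseteq> T \<Longrightarrow> pperm n S"
  by (auto simp: pperm_def intro: inj_on_subset)

lemma pperm_card_le: "pperm n T \<Longrightarrow> card T \<le> n"
proof -
  assume T: "pperm n T"
  then have "card T = card (fst ` T)" by (simp add: pperm_def card_image)
  also have "\<dots> \<le> card (verts n)" by (rule card_mono) (use T in \<open>auto simp: pperm_def pts_def\<close>)
  finally show ?thesis by (simp add: verts_def)
qed

lemma padj_degree:
  assumes "n > 3 * k" "p \<in> pts n"
  shows "card {q \<in> pts n. padj n k p q} \<le> (2 * k)^2"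
proof -
  have "{q \<in> pts n. padj n k p q} = {x \<in> verts n. cadj n k (fst p) x} \<times> {y \<in> verts n. cadj n k (snd p) y}"
    by (auto simp: pts_def padj_def)
  then have "card {q \<in> pts n. padj n k p q} = card {x \<in> verts n. cadj n k (fst p) x} * card {y \<in> verts n. cadj n k (snd p) y}"
    by (simp add: card_cartesian_product)
  also have "\<dots> \<le> (2 * k) * (2 * k)"
    by (intro mult_mono cadj_degree) (use assms in \<open>auto simp: pts_def\<close>)
  finally show ?thesis by (simp add: power2_eq_square)
qed

text \<open>The hypothesis on absolute differences lets \<open>c\<close> run through the columns in
  either direction, as the two halves of a segment require.\<close>

lemma power_path_segment:
  assumes g: "segment n k g" and y: "\<And>x. x \<in> fst ` g \<Longrightarrow> (x, y x) \<in> g"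
    and c: "\<And>i. i < l \<Longrightarrow> c i \<in> fst ` g"
    and d: "\<And>i j. i < j \<Longrightarrow> j < l \<Longrightarrow> \<bar>c j - c i\<bar> = int (j - i)"
  shows "power_path n k (map (\<lambda>i. y (c i)) [0..<l])"
proof -
  have inj: "inj_on snd g" "inj_on fst g" and sub: "g \<subseteq> pts n"
    using g by (auto simp: segment_def pperm_def)
  have ne: "c i \<noteq> c j" if "i < l" "j < l" "i \<noteq> j" for i j
    using d[of i j] d[of j i] that by (cases "i < j") auto
  have yi: "y (c i) \<noteq> y (c j)" if "i < l" "j < l" "i \<noteq> j" for i j
  proof
    assume eq: "y (c i) = y (c j)"
    have m: "(c i, y (c i)) \<in> g" "(c j, y (c j)) \<in> g" using y c that by blast+
    have "c i = c j" using inj_onD[OF inj(1) _ m] eq by simp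
    then show False using ne that by auto
  qed
  have adj: "cadj n k (y (c i)) (y (c j))" if "i < j" "j < l" "j - i \<le> k" for i j
  proof -
    have seg: "cadj n k (snd p) (snd q)" if "p \<in> g" "q \<in> g" "fst p < fst q" "fst q \<le> fst p + int k" for p q
      using g that unfolding segment_def by blast
    have m: "(c i, y (c i)) \<in> g" "(c j, y (c j)) \<in> g" using y c that by auto
    have "\<bar>c j - c i\<bar> = int (j - i)" using d that by auto
    moreover have "int (j - i) \<le> int k" "int (j - i) > 0" using that by simp_all
    ultimately consider "c i < c j" "c j \<le> c i + int k" | "c j < c i" "c i \<le> c j + int k"
      by linarith
    then show ?thesis
      by cases (use seg[OF m] seg[OF m(2,1)] in \<open>auto intro: cadj_sym\<close>)
  qed
  show ?thesis
    unfolding power_path_def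
  proof (intro conjI allI impI)
    show "distinct (map (\<lambda>i. y (c i)) [0..<l])"
    proof -
      have "inj_on (\<lambda>i. y (c i)) {0..<l}" by (rule inj_onI, rule ccontr) (use yi in fastforce)
      then show ?thesis by (simp add: distinct_map)
    qed
    show "set (map (\<lambda>i. y (c i)) [0..<l]) \<subseteq> verts n"
      using y c sub by (fastforce simp: pts_def)
  next
    fix i j assume "i < j \<and> j < length (map (\<lambda>i. y (c i)) [0..<l]) \<and> j - i \<le> k"
    then show "cadj n k (map (\<lambda>i. y (c i)) [0..<l] ! i) (map (\<lambda>i. y (c i)) [0..<l] ! j)"
      using adj[of i j] by simp
  qed
qed

lemma finite_segments: "finite {g. segment n k g}"
  by (rule finite_subset[of _ "Pow (pts n)"]) (auto simp: segment_def pperm_def)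

text \<open>A segment through \<open>p\<close> is coded by its halves after and before \<open>p\<close>, read away from \<open>p\<close>.\<close>

lemma card_segments_through:
  assumes n: "n > 3 * k" and k: "k \<ge> 1" and p: "p \<in> pts n"
  shows "card {g. segment n k g \<and> p \<in> g \<and> card g = l} \<le> l * ((2 * k) ^ k)^2"
proof -
  define K where "K = (2 * k) ^ k"
  define rec :: "int list \<times> int list \<Rightarrow> pset" where
    "rec = (\<lambda>(F, B). {(fst p + int i, F ! i) | i. i < length F} \<union> {(fst p - int i, B ! i) | i. i < length B})"
  \<comment> \<open>The point \<open>p\<close> is the first entry of both halves, hence the lengths
    add up to \<open>Suc l\<close>.\<close>
  define D where "D i = power_paths n k (snd p) i \<times> power_paths n k (snd p) (Suc l - i)" for i
  have "{g. segment n k g \<and> p \<in> g \<and> card g = l} \<subseteq> (\<Union>i\<in>{1..l}. rec ` D i)"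
  proof
    fix g assume "g \<in> {g. segment n k g \<and> p \<in> g \<and> card g = l}"
    then have g: "segment n k g" and pg: "p \<in> g" and cg: "card g = l" by auto
    have inj: "inj_on snd g" "inj_on fst g" and sub: "g \<subseteq> pts n"
      using g by (auto simp: segment_def pperm_def)
    obtain a b where ab: "fst ` g = {a..b}" using g by (auto simp: segment_def)
    define x where "x = fst p"
    have x: "a \<le> x" "x \<le> b" using ab pg unfolding x_def by (metis atLeastAtMost_iff imageI)+
    define y where "y t = snd (inv_into g fst t)" for t
    have yg: "(t, y t) \<in> g" if "t \<in> fst ` g" for t
      using inv_into_into[OF that] f_inv_into_f[OF that] by (metis prod.collapse y_def)
    have yq: "q = (fst q, y (fst q))" if "q \<in> g" for q
      using yg[of "fst q"] that inj_onD[OF inj(2), of q "(fst q, y (fst q))"] by auto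
    have ypx: "y x = snd p" using yq[OF pg] by (metis snd_conv x_def)
    define lf where "lf = nat (b - x + 1)"
    define lb where "lb = nat (x - a + 1)"
    define F where "F = map (\<lambda>i. y (x + int i)) [0..<lf]"
    define B where "B = map (\<lambda>i. y (x - int i)) [0..<lb]"
    have "l = card (fst ` g)" using cg inj(2) by (simp add: card_image)
    then have l: "l + 1 = lf + lb" using ab x by (simp add: lf_def lb_def)
    have vF: "power_path n k F" unfolding F_def
      by (rule power_path_segment[OF g yg]) (use x ab in \<open>auto simp: lf_def\<close>)
    have vB: "power_path n k B" unfolding B_def
      by (rule power_path_segment[OF g yg]) (use x ab in \<open>auto simp: lb_def\<close>)
    have pos: "lf \<ge> 1" "lb \<ge> 1" using x by (auto simp: lf_def lb_def)
    have hd: "hd F = snd p" "hd B = snd p"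
      using pos by (simp_all add: F_def B_def hd_map upt_conv_Cons ypx)
    have "rec (F, B) = g"
    proof
      show "rec (F, B) \<subseteq> g"
        using yg ab x by (auto simp: rec_def F_def B_def lf_def lb_def simp flip: x_def)
      show "g \<subseteq> rec (F, B)"
      proof
        fix q assume q: "q \<in> g"
        then have fq: "a \<le> fst q" "fst q \<le> b" using ab by (metis atLeastAtMost_iff imageI)+
        show "q \<in> rec (F, B)"
        proof (cases "fst q \<ge> x")
          case True
          define i where "i = nat (fst q - x)"
          have i: "fst q = x + int i" "i < lf" using True fq by (auto simp: i_def lf_def)
          then have "q = (x + int i, F ! i)" using yq[OF q] by (simp add: F_def)
          then show ?thesis using i by (auto simp: rec_def F_def x_def)
        next
          case False
          define i where "i = nat (x - fst q)"
          have i: "fst q = x - int i" "i < lb" using False fq by (auto simp: i_def lb_def)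
          then have "q = (x - int i, B ! i)" using yq[OF q] by (simp add: B_def)
          then show ?thesis using i by (auto simp: rec_def B_def x_def)
        qed
      qed
    qed
    moreover have "(F, B) \<in> D lf"
      using vF vB hd l pos by (auto simp: D_def power_paths_def F_def B_def)
    moreover have "lf \<in> {1..l}" using l pos by auto
    ultimately show "g \<in> (\<Union>i\<in>{1..l}. rec ` D i)" by blast
  qed
  moreover have finD: "finite (D i)" for i by (simp add: D_def finite_power_paths)
  ultimately have "card {g. segment n k g \<and> p \<in> g \<and> card g = l} \<le> card (\<Union>i\<in>{1..l}. rec ` D i)"
    by (intro card_mono) auto
  also have "\<dots> \<le> (\<Sum>i\<in>{1..l}. card (rec ` D i))" by (rule card_UN_le) simp
  also have "\<dots> \<le> (\<Sum>i\<in>{1..l}. K^2)"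
  proof (rule sum_mono)
    fix i assume i: "i \<in> {1..l}"
    have "card (rec ` D i) \<le> card (D i)" by (rule card_image_le[OF finD])
    also have "\<dots> = card (power_paths n k (snd p) i) * card (power_paths n k (snd p) (Suc l - i))"
      by (simp add: D_def card_cartesian_product)
    also have "\<dots> \<le> K * K"
      unfolding K_def by (intro mult_mono card_power_paths[OF n k]) (use i in auto)
    finally show "card (rec ` D i) \<le> K^2" by (simp add: power2_eq_square)
  qed
  finally show ?thesis by (simp add: K_def)
qed

lemma segments_through_weight:
  fixes w Y :: real
  assumes n: "n > 3 * k" and k: "k \<ge> 1" and p: "p \<in> pts n" and w: "0 \<le> w" and Y: "0 \<le> Y"
  shows "(\<Sum>g\<in>{g. segment n k g \<and> p \<in> g}. w * Y ^ card g)
    \<le> w * real (((2 * k) ^ k)^2) * (\<Sum>l\<le>n. real l * Y ^ l)"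
proof -
  define S where "S = {g. segment n k g \<and> p \<in> g}"
  have fin: "finite S" by (rule finite_subset[OF _ finite_segments[of n k]]) (auto simp: S_def)
  have "(\<Sum>g\<in>S. w * Y ^ card g) = (\<Sum>l\<le>n. \<Sum>g\<in>{g\<in>S. card g = l}. w * Y ^ card g)"
    by (rule sum.group[symmetric])
       (use fin in \<open>auto simp: S_def segment_def intro: pperm_card_le\<close>)
  also have "\<dots> \<le> (\<Sum>l\<le>n. w * real (((2 * k) ^ k)^2) * (real l * Y ^ l))"
  proof (rule sum_mono)
    fix l
    have "(\<Sum>g\<in>{g\<in>S. card g = l}. w * Y ^ card g) = real (card {g\<in>S. card g = l}) * (w * Y ^ l)"
      by simp
    also have "{g\<in>S. card g = l} = {g. segment n k g \<and> p \<in> g \<and> card g = l}" by (auto simp: S_def)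
    also have "real (card \<dots>) * (w * Y ^ l) \<le> real (l * ((2 * k) ^ k)^2) * (w * Y ^ l)"
      by (rule mult_right_mono, rule of_nat_mono[OF card_segments_through[OF n k p]]) (use w Y in simp)
    also have "\<dots> = w * real (((2 * k) ^ k)^2) * (real l * Y ^ l)" by simp
    finally show "(\<Sum>g\<in>{g\<in>S. card g = l}. w * Y ^ card g) \<le> w * real (((2 * k) ^ k)^2) * (real l * Y ^ l)"
      by (simp add: S_def conj_assoc)
  qed
  also have "\<dots> = w * real (((2 * k) ^ k)^2) * (\<Sum>l\<le>n. real l * Y ^ l)" by (simp add: sum_distrib_left)
  finally show ?thesis by (simp add: S_def)
qed

definition segadj :: "nat \<Rightarrow> nat \<Rightarrow> pset \<Rightarrow> pset \<Rightarrow> bool" where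
  "segadj n k g h \<longleftrightarrow> (\<exists>p\<in>g. \<exists>q\<in>h. padj n k p q)"

abbreviation seg_families :: "nat \<Rightarrow> nat \<Rightarrow> pset set set" where
  "seg_families n k \<equiv> {X. X \<subseteq> {g. segment n k g} \<and> conn (segadj n k) X}"

lemma sum_UN_le:
  fixes f :: "'b \<Rightarrow> real"
  assumes "finite I" "\<And>i. i \<in> I \<Longrightarrow> finite (A i)" "\<And>i x. i \<in> I \<Longrightarrow> x \<in> A i \<Longrightarrow> 0 \<le> f x"
    "S \<subseteq> (\<Union>i\<in>I. A i)"
  shows "sum f S \<le> (\<Sum>i\<in>I. sum f (A i))"
proof -
  have finU: "finite (\<Union>i\<in>I. A i)" using assms by blast
  have "sum f S \<le> sum f (\<Union>i\<in>I. A i)"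
    by (rule sum_mono2[OF finU assms(4)]) (use assms in blast)
  also have "\<dots> \<le> (\<Sum>i\<in>I. sum f (A i))"
    using assms(1,2,3)
  proof (induction I rule: finite_induct)
    case (insert i I)
    have "sum f (\<Union>i\<in>insert i I. A i) \<le> sum f (A i) + sum f (\<Union>i\<in>I. A i)"
    proof -
      have "sum f (A i \<union> (\<Union>i\<in>I. A i)) + sum f (A i \<inter> (\<Union>i\<in>I. A i)) = sum f (A i) + sum f (\<Union>i\<in>I. A i)"
        by (rule sum.union_inter) (use insert in auto)
      moreover have "0 \<le> sum f (A i \<inter> (\<Union>i\<in>I. A i))" by (rule sum_nonneg) (use insert.prems in auto)
      ultimately show ?thesis by simp
    qed
    then show ?case using insert by fastforce
  qed simp
  finally show ?thesis .
qed

lemma bounded_sum_mult_power: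
  fixes Y :: real assumes "0 \<le> Y" "Y < 1"
  shows "\<exists>c>0. \<forall>n. (\<Sum>l\<le>n. real l * Y ^ l) \<le> c"
proof -
  have eq: "(\<Sum>l\<le>n. real l * Y ^ l) * (1 - Y)^2 = Y - real (n + 1) * Y ^ (n + 1) + real n * Y ^ (n + 2)" for n
    by (induction n) (simp_all add: algebra_simps power2_eq_square)
  have "(\<Sum>l\<le>n. real l * Y ^ l) * (1 - Y)^2 \<le> 1" for n
  proof -
    have "real n * Y ^ (n + 2) \<le> real (n + 1) * Y ^ (n + 1)"
      by (intro mult_mono power_decreasing) (use assms in auto)
    then show ?thesis using eq[of n] assms by linarith
  qed
  then show ?thesis
    using assms by (intro exI[of _ "1 / (1 - Y)^2"]) (auto simp: pos_le_divide_eq)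
qed

text \<open>The Kotecky-Preiss condition with \<open>a g\<close> proportional to
  \<open>card g\<close>. The decay \<open>y\<close> is split into two square roots: one pays for
  \<open>exp (a g)\<close>, the other makes the sum over the segments through a point converge. The
  threshold \<open>w0\<close> is uniform in \<open>n\<close> because the number of segments of given
  length through a point is bounded independently of \<open>n\<close>.\<close>

lemma conn_segments_weight:
  assumes k: "k \<ge> 1" and y: "0 < y" "y < 1"
  shows "\<exists>w0>0. \<forall>w n. 0 \<le> w \<longrightarrow> w \<le> w0 \<longrightarrow> n > 3 * k \<longrightarrow>
     (\<Sum>X\<in>seg_families n k. \<Prod>g\<in>X. w * y ^ card g) \<le> real n ^ 2"
proof -
  define Y where "Y = sqrt y"
  define \<alpha> where "\<alpha> = - ln Y"
  have Y: "0 < Y" "Y < 1" using y by (auto simp: Y_def)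
  have \<alpha>: "\<alpha> > 0" using Y by (simp add: \<alpha>_def)
  obtain c where c: "c > 0" "\<And>n. (\<Sum>l\<le>n. real l * Y ^ l) \<le> c"
    using bounded_sum_mult_power[of Y] Y by auto
  define K where "K = real (((2 * k) ^ k)^2)"
  have K: "K > 0" using k by (simp add: K_def)
  \<comment> \<open>The bound \<open>\<alpha> / (2 k)^2\<close> gives the Kotecky-Preiss condition,
    because each point of a segment has at most \<open>(2 k)^2\<close> neighbours; the bound
    \<open>1\<close> gives a total of at most one per point, hence \<open>n^2\<close>.\<close>
  define w0 where "w0 = min 1 (\<alpha> / (2 * k)^2) / (K * c)"
  have w0: "w0 > 0" using K c \<alpha> k by (simp add: w0_def)
  have ye: "y ^ m * exp (\<alpha> * real m) = Y ^ m" for m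
  proof -
    have "exp (\<alpha> * real m) = inverse (Y ^ m)"
      using Y by (simp add: \<alpha>_def exp_minus exp_of_nat_mult mult.commute)
    moreover have "y ^ m = Y ^ m * Y ^ m" using y by (simp add: Y_def flip: power_mult_distrib)
    ultimately show ?thesis using Y by simp
  qed
  show ?thesis
  proof (intro exI[of _ w0] conjI allI impI w0)
    fix w :: real and n assume w: "0 \<le> w" "w \<le> w0" and n: "n > 3 * k"
    define \<Omega> where "\<Omega> = {g. segment n k g}"
    define z where "z g = w * y ^ card g" for g :: "pset"
    define a where "a g = \<alpha> * real (card g)" for g :: "pset"
    have fin: "finite \<Omega>" by (simp add: \<Omega>_def finite_segments)
    have \<Omega>_pts: "p \<in> pts n" if "p \<in> g" "g \<in> \<Omega>" for p g
      using that by (auto simp: \<Omega>_def segment_def pperm_def)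
    have z0: "0 \<le> z g" for g using w y by (simp add: z_def)
    have ze: "z g * exp (a g) = w * Y ^ card g" for g
      using ye[of "card g"] by (simp add: z_def a_def mult.assoc)
    have wK: "w * K * c \<le> min 1 (\<alpha> / (2 * k)^2)"
      using w(2) K c(1) by (simp add: w0_def pos_le_divide_eq mult.assoc)
    have thr: "(\<Sum>g\<in>{g\<in>\<Omega>. p \<in> g}. w * Y ^ card g) \<le> min 1 (\<alpha> / (2 * k)^2)" if "p \<in> pts n" for p
    proof -
      have "(\<Sum>g\<in>{g\<in>\<Omega>. p \<in> g}. w * Y ^ card g) \<le> w * K * (\<Sum>l\<le>n. real l * Y ^ l)"
        using segments_through_weight[OF n k that w(1), of Y] Y by (simp add: \<Omega>_def K_def)
      also have "\<dots> \<le> w * K * c" using c(2)[of n] w(1) K by (intro mult_left_mono) auto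
      finally show ?thesis using wK by simp
    qed
    have KP: "(\<Sum>h\<in>{h \<in> \<Omega>. segadj n k g h}. z h * exp (a h)) \<le> a g" if g: "g \<in> \<Omega>" for g
    proof -
      have gp: "g \<subseteq> pts n" "finite g"
        using g pperm_finite by (auto simp: \<Omega>_def segment_def pperm_def)
      have "(\<Sum>h\<in>{h \<in> \<Omega>. segadj n k g h}. w * Y ^ card h)
        \<le> (\<Sum>p\<in>g. \<Sum>h\<in>{h \<in> \<Omega>. \<exists>q\<in>h. padj n k p q}. w * Y ^ card h)"
        by (rule sum_UN_le) (use fin gp w Y in \<open>auto simp: segadj_def\<close>)
      also have "\<dots> \<le> (\<Sum>p\<in>g. \<alpha>)"
      proof (rule sum_mono)
        fix p assume p: "p \<in> g"
        have "(\<Sum>h\<in>{h \<in> \<Omega>. \<exists>q\<in>h. padj n k p q}. w * Y ^ card h)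
          \<le> (\<Sum>q\<in>{q \<in> pts n. padj n k p q}. \<Sum>h\<in>{h \<in> \<Omega>. q \<in> h}. w * Y ^ card h)"
          by (rule sum_UN_le) (use fin w Y \<Omega>_pts in auto)
        also have "\<dots> \<le> (\<Sum>q\<in>{q \<in> pts n. padj n k p q}. \<alpha> / (2 * k)^2)"
          by (rule sum_mono) (use thr in fastforce)
        also have "\<dots> = real (card {q \<in> pts n. padj n k p q}) * (\<alpha> / (2 * k)^2)" by simp
        also have "\<dots> \<le> real ((2 * k)^2) * (\<alpha> / (2 * k)^2)"
          by (rule mult_right_mono, rule of_nat_mono[OF padj_degree[OF n]]) (use p gp \<alpha> in auto)
        also have "\<dots> = \<alpha>" using k by simp
        finally show "(\<Sum>h\<in>{h \<in> \<Omega>. \<exists>q\<in>h. padj n k p q}. w * Y ^ card h) \<le> \<alpha>" .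
      qed
      also have "\<dots> = a g" by (simp add: a_def)
      finally show ?thesis by (simp add: ze)
    qed
    have "(\<Sum>X\<in>{X. X \<subseteq> \<Omega> \<and> conn (segadj n k) X}. \<Prod>g\<in>X. z g)
      \<le> (\<Sum>g\<in>\<Omega>. \<Sum>X\<in>{X. X \<subseteq> \<Omega> \<and> g \<in> X \<and> conn (segadj n k) X}. \<Prod>g\<in>X. z g)"
    proof (rule sum_UN_le[OF fin])
      show "finite {X. X \<subseteq> \<Omega> \<and> g \<in> X \<and> conn (segadj n k) X}" for g
        by (rule finite_subset[of _ "Pow \<Omega>"]) (use fin in auto)
      show "{X. X \<subseteq> \<Omega> \<and> conn (segadj n k) X} \<subseteq> (\<Union>g\<in>\<Omega>. {X. X \<subseteq> \<Omega> \<and> g \<in> X \<and> conn (segadj n k) X})"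
        by (auto simp: conn_def)
    qed (auto intro: prod_nonneg z0)
    also have "\<dots> \<le> (\<Sum>g\<in>\<Omega>. z g * exp (a g))"
      by (rule sum_mono, rule conn_sets_weight[OF fin]) (use z0 KP in auto)
    also have "\<dots> = (\<Sum>g\<in>\<Omega>. w * Y ^ card g)" by (simp add: ze)
    also have "\<dots> \<le> (\<Sum>p\<in>pts n. \<Sum>g\<in>{g\<in>\<Omega>. p \<in> g}. w * Y ^ card g)"
    proof (rule sum_UN_le)
      show "\<Omega> \<subseteq> (\<Union>p\<in>pts n. {g \<in> \<Omega>. p \<in> g})"
        by (auto simp: \<Omega>_def segment_def pperm_def subset_iff)
    qed (use fin w Y in auto)
    also have "\<dots> \<le> (\<Sum>p\<in>pts n. 1)" by (rule sum_mono) (use thr in fastforce)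
    also have "\<dots> = real n ^ 2" by (simp add: card_pts power2_eq_square)
    finally show "(\<Sum>X\<in>seg_families n k. \<Prod>g\<in>X. w * y ^ card g) \<le> real n ^ 2"
      by (simp add: \<Omega>_def z_def)
  qed
qed

section \<open>Decomposition into runs\<close>

text \<open>The last column \<open>n - 1\<close> is never good, so that runs of good points do not wrap around.\<close>

definition good :: "nat \<Rightarrow> nat \<Rightarrow> pset \<Rightarrow> int \<times> int \<Rightarrow> bool" where
  "good n k T p \<longleftrightarrow> fst p < int n - 1 \<and>
     (\<forall>i\<in>{1..int k}. \<exists>q\<in>T. fst q = (fst p + i) mod int n \<and> cadj n k (snd p) (snd q))"

definition bads :: "nat \<Rightarrow> nat \<Rightarrow> pset \<Rightarrow> pset" where
  "bads n k T = {p \<in> T. \<not> good n k T p}"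

definition run_end :: "nat \<Rightarrow> nat \<Rightarrow> pset \<Rightarrow> int \<times> int \<Rightarrow> int" where
  "run_end n k T p = Min {x \<in> fst ` bads n k T. fst p \<le> x}"

text \<open>Runs are cut directly after each bad point, so that there are as many runs as bad points
  and all other points of a run have their \<open>k\<close> forward edges.\<close>

definition run :: "nat \<Rightarrow> nat \<Rightarrow> pset \<Rightarrow> int \<times> int \<Rightarrow> pset" where
  "run n k T b = {q \<in> T. run_end n k T q = fst b}"

lemma pperm_range: "pperm n T \<Longrightarrow> p \<in> T \<Longrightarrow> 0 \<le> fst p \<and> fst p < int n"
  by (auto simp: pperm_def pts_def verts_def)

text \<open>The minimum defining \<open>run_end\<close> is over a nonempty set because the rightmost
  point of \<open>T\<close> is bad: a good point lies before the last column and has a point of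
  \<open>T\<close> in the next column, which would be further right.\<close>

lemma run_end_props:
  assumes T: "pperm n T" and p: "p \<in> T" and k: "k \<ge> 1"
  shows "run_end n k T p \<in> fst ` bads n k T" and "fst p \<le> run_end n k T p"
    and "\<And>b. b \<in> bads n k T \<Longrightarrow> fst p \<le> fst b \<Longrightarrow> run_end n k T p \<le> fst b"
proof -
  have fin: "finite T" by (rule pperm_finite[OF T])
  define m where "m = Max (fst ` T)"
  have m: "m \<in> fst ` T" "\<And>q. q \<in> T \<Longrightarrow> fst q \<le> m"
    unfolding m_def using fin p by (auto intro!: Max_in)
  then obtain q where q: "q \<in> T" "fst q = m" by auto
  have "\<not> good n k T q"
  proof
    assume g: "good n k T q"
    then have lt: "m < int n - 1" using q by (simp add: good_def)
    from g obtain q' where "q' \<in> T" "fst q' = (fst q + 1) mod int n"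
      using k unfolding good_def by (elim conjE ballE[of _ _ 1]) auto
    moreover have "(fst q + 1) mod int n = m + 1"
      using q lt pperm_range[OF T q(1)] by simp
    ultimately show False using m(2)[of q'] by simp
  qed
  then have "q \<in> bads n k T" using q by (simp add: bads_def)
  then have ne: "{x \<in> fst ` bads n k T. fst p \<le> x} \<noteq> {}" using m(2)[OF p] q by auto
  have finb: "finite {x \<in> fst ` bads n k T. fst p \<le> x}" using fin by (simp add: bads_def)
  show "run_end n k T p \<in> fst ` bads n k T" "fst p \<le> run_end n k T p"
    using Min_in[OF finb ne] by (auto simp: run_end_def)
  show "\<And>b. b \<in> bads n k T \<Longrightarrow> fst p \<le> fst b \<Longrightarrow> run_end n k T p \<le> fst b"
    unfolding run_end_def by (rule Min_le[OF finb]) auto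
qed

lemma run_end_bad:
  assumes T: "pperm n T" and b: "b \<in> bads n k T" and k: "k \<ge> 1"
  shows "run_end n k T b = fst b"
proof -
  have "b \<in> T" using b by (simp add: bads_def)
  from run_end_props[OF T this k] b show ?thesis by (meson dual_order.antisym order_refl)
qed

lemma run_end_mono_eq:
  assumes T: "pperm n T" and k: "k \<ge> 1" and p: "p \<in> T" and q: "q \<in> T"
    and "fst p \<le> fst q" "fst q \<le> run_end n k T p"
  shows "run_end n k T q = run_end n k T p"
proof (rule antisym)
  obtain b where b: "b \<in> bads n k T" "run_end n k T p = fst b" using run_end_props(1)[OF T p k] by auto
  show "run_end n k T q \<le> run_end n k T p"
    using run_end_props(3)[OF T q k b(1)] assms b by simp
  obtain c where c: "c \<in> bads n k T" "run_end n k T q = fst c" using run_end_props(1)[OF T q k] by auto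
  show "run_end n k T p \<le> run_end n k T q"
    using run_end_props(3)[OF T p k c(1)] run_end_props(2)[OF T q k] assms c by simp
qed

lemma good_if_less_run_end:
  assumes T: "pperm n T" and k: "k \<ge> 1" and p: "p \<in> T" and "fst p < run_end n k T p"
  shows "good n k T p"
proof (rule ccontr)
  assume "\<not> good n k T p"
  then have "p \<in> bads n k T" using p by (simp add: bads_def)
  from run_end_bad[OF T this k] assms(4) show False by simp
qed

lemma run_contiguous:
  assumes T: "pperm n T" and k: "k \<ge> 1" and p: "p \<in> T" and x: "fst p \<le> x" "x \<le> run_end n k T p"
  shows "\<exists>q\<in>T. fst q = x"
  using x
proof (induction x rule: int_ge_induct)
  case base
  then show ?case using p by auto
next
  case (step x)
  then obtain q where q: "q \<in> T" "fst q = x" by auto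
  have "run_end n k T q = run_end n k T p"
    by (rule run_end_mono_eq[OF T k p q(1)]) (use step q in auto)
  then have g: "good n k T q" using step q by (intro good_if_less_run_end[OF T k]) auto
  then obtain q' where "q' \<in> T" "fst q' = (fst q + 1) mod int n"
    using k unfolding good_def by (elim conjE ballE[of _ _ 1]) auto
  moreover have "(fst q + 1) mod int n = x + 1"
    using q g pperm_range[OF T q(1)] by (simp add: good_def)
  ultimately show ?case by auto
qed

lemma segment_run:
  assumes T: "pperm n T" and k: "k \<ge> 1" and b: "b \<in> bads n k T"
  shows "segment n k (run n k T b)"
  unfolding segment_def
proof (intro conjI ballI impI)
  define g where "g = run n k T b"
  have bT: "b \<in> T" using b by (simp add: bads_def)
  have bg: "b \<in> g" using run_end_bad[OF T b k] bT by (simp add: g_def run_def)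
  have gT: "g \<subseteq> T" by (auto simp: g_def run_def)
  show "run n k T b \<noteq> {}" using bg by (auto simp: g_def)
  show "pperm n (run n k T b)" using pperm_subset[OF T gT] by (simp add: g_def)
  have fin: "finite g" using pperm_finite[OF T] gT finite_subset by blast
  define a where "a = Min (fst ` g)"
  have a: "a \<in> fst ` g" "\<And>q. q \<in> g \<Longrightarrow> a \<le> fst q"
    unfolding a_def using fin bg by (auto intro!: Min_in)
  have le: "fst q \<le> fst b" if "q \<in> g" for q
    using that run_end_props(2)[OF T _ k, of q] by (auto simp: g_def run_def)
  have "fst ` g = {a..fst b}"
  proof
    show "fst ` g \<subseteq> {a..fst b}" using a le by auto
    show "{a..fst b} \<subseteq> fst ` g"
    proof
      fix x assume x: "x \<in> {a..fst b}"
      obtain p where p: "p \<in> g" "fst p = a" using a(1) by auto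
      then have pT: "p \<in> T" and re: "run_end n k T p = fst b" by (auto simp: g_def run_def)
      obtain q where q: "q \<in> T" "fst q = x"
        using run_contiguous[OF T k pT, of x] x p re by auto
      have "run_end n k T q = fst b"
        using run_end_mono_eq[OF T k pT q(1)] x p q re by auto
      then show "x \<in> fst ` g" using q by (auto simp: g_def run_def)
    qed
  qed
  then show "\<exists>a b'. fst ` run n k T b = {a..b'}" by (auto simp: g_def)
  fix p q assume pq: "p \<in> run n k T b" "q \<in> run n k T b" "fst p < fst q \<and> fst q \<le> fst p + int k"
  then have pqT: "p \<in> T" "q \<in> T" using gT by (auto simp: g_def)
  \<comment> \<open>A point followed by another one of its run is not the bad end of the run, hence
    it is good and its forward edges are all present.\<close>
  have "fst p < run_end n k T p" using pq le[of q] by (auto simp: g_def run_def)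
  then have "good n k T p" by (rule good_if_less_run_end[OF T k pqT(1)])
  moreover have "fst q - fst p \<in> {1..int k}" using pq by auto
  ultimately obtain q' where q': "q' \<in> T" "fst q' = (fst p + (fst q - fst p)) mod int n" "cadj n k (snd p) (snd q')"
    unfolding good_def by blast
  then have "fst q' = fst q" using pperm_range[OF T pqT(2)] by simp
  then have "q' = q" using T q' pqT by (auto simp: pperm_def dest: inj_onD)
  then show "cadj n k (snd p) (snd q)" using q' by simp
qed

lemma runs_partition:
  assumes T: "pperm n T" and k: "k \<ge> 1"
  shows "inj_on (run n k T) (bads n k T)" and "(\<Union>b\<in>bads n k T. run n k T b) = T"
    and "\<And>b c. b \<in> bads n k T \<Longrightarrow> c \<in> bads n k T \<Longrightarrow> b \<noteq> c \<Longrightarrow> run n k T b \<inter> run n k T c = {}"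
proof -
  have inj: "b = c" if "b \<in> bads n k T" "c \<in> bads n k T" "fst b = fst c" for b c
    using that T by (auto simp: bads_def pperm_def dest: inj_onD)
  show disj: "run n k T b \<inter> run n k T c = {}" if "b \<in> bads n k T" "c \<in> bads n k T" "b \<noteq> c" for b c
    using inj[OF that(1,2)] that by (auto simp: run_def)
  show "inj_on (run n k T) (bads n k T)"
  proof (rule inj_onI)
    fix b c assume bc: "b \<in> bads n k T" "c \<in> bads n k T" "run n k T b = run n k T c"
    have "b \<in> run n k T b" using run_end_bad[OF T bc(1) k] bc(1) by (simp add: run_def bads_def)
    then show "b = c" using disj[OF bc(1,2)] bc(3) by auto
  qed
  show "(\<Union>b\<in>bads n k T. run n k T b) = T"
  proof
    show "(\<Union>b\<in>bads n k T. run n k T b) \<subseteq> T" by (auto simp: run_def)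
    show "T \<subseteq> (\<Union>b\<in>bads n k T. run n k T b)"
      using run_end_props(1)[OF T _ k] by (fastforce simp: run_def)
  qed
qed

text \<open>A path of points projects to a path of runs, since \<open>segadj\<close> holds between
  the runs of any two adjacent points, equal or not.\<close>

lemma conn_runs:
  assumes T: "pperm n T" and k: "k \<ge> 1" and c: "conn (padj n k) T"
  shows "conn (segadj n k) (run n k T ` bads n k T)"
proof -
  define X where "X = run n k T ` bads n k T"
  have UX: "\<Union>X = T" using runs_partition(2)[OF T k] by (simp add: X_def)
  have disj: "g = h" if "g \<in> X" "h \<in> X" "p \<in> g" "p \<in> h" for g h p
    using that runs_partition(3)[OF T k] by (fastforce simp: X_def)
  have *: "\<forall>h\<in>X. q \<in> h \<longrightarrow> (g, h) \<in> reach (segadj n k) X"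
    if g: "g \<in> X" "p \<in> g" and pq: "(p, q) \<in> reach (padj n k) T" for p q g
    using pq
  proof (induction rule: reach_induct)
    case base
    show ?case
    proof (intro ballI impI)
      fix h assume "h \<in> X" "p \<in> h"
      then have "g = h" using disj g by blast
      then show "(g, h) \<in> reach (segadj n k) X" by (simp add: reach_refl)
    qed
  next
    case (step b c)
    then obtain f where f: "f \<in> X" "b \<in> f" using UX by auto
    show ?case
    proof (intro ballI impI)
      fix h assume h: "h \<in> X" "c \<in> h"
      have "(g, f) \<in> reach (segadj n k) X" using step.IH f by simp
      moreover have "segadj n k f h" unfolding segadj_def using f h step.hyps by blast
      then have "(f, h) \<in> reach (segadj n k) X" by (intro reach_step f h)
      ultimately show "(g, h) \<in> reach (segadj n k) X" by (rule reach_trans)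
    qed
  qed
  have "X \<noteq> {}" using c UX by (auto simp: conn_def)
  moreover have "(g, h) \<in> reach (segadj n k) X" if gh: "g \<in> X" "h \<in> X" for g h
  proof -
    have "g \<noteq> {}" "h \<noteq> {}" using gh segment_run[OF T k] by (auto simp: X_def segment_def)
    then obtain p q where pq: "p \<in> g" "q \<in> h" by auto
    then have "(p, q) \<in> reach (padj n k) T" using c gh UX by (auto simp: conn_def)
    from *[OF gh(1) pq(1) this] show ?thesis using gh pq by auto
  qed
  ultimately show ?thesis by (simp add: conn_def X_def)
qed

lemma runs_card:
  assumes T: "pperm n T" and k: "k \<ge> 1"
  shows "(\<Sum>g\<in>run n k T ` bads n k T. card g) = card T" "card (run n k T ` bads n k T) = card (bads n k T)"
proof -
  have fin: "finite T" by (rule pperm_finite[OF T])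
  have "card T = card (\<Union>b\<in>bads n k T. run n k T b)" using runs_partition(2)[OF T k] by simp
  also have "\<dots> = (\<Sum>b\<in>bads n k T. card (run n k T b))"
    by (rule card_UN_disjoint) (use fin runs_partition(3)[OF T k] in \<open>auto simp: bads_def run_def\<close>)
  also have "\<dots> = (\<Sum>g\<in>run n k T ` bads n k T. card g)"
    by (subst sum.reindex[OF runs_partition(1)[OF T k]]) simp
  finally show "(\<Sum>g\<in>run n k T ` bads n k T. card g) = card T" by simp
  show "card (run n k T ` bads n k T) = card (bads n k T)"
    by (rule card_image[OF runs_partition(1)[OF T k]])
qed

text \<open>Named after lattice animals; these are the possible components of a common
  graph.\<close>

definition animals :: "nat \<Rightarrow> nat \<Rightarrow> nat \<Rightarrow> pset set" where
  "animals n k u = {T. pperm n T \<and> conn (padj n k) T \<and> card T = u}"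

lemma finite_animals: "finite (animals n k u)"
  by (rule finite_subset[of _ "Pow (pts n)"]) (auto simp: animals_def pperm_def)

text \<open>A set is the union of its runs, so \<open>T\<close> is determined by a connected family
  of segments. Each run contributes \<open>w\<close>, which makes one factor per bad point, and each
  point contributes \<open>y\<close>. The number of shapes thus costs only \<open>n^2 / y^u\<close>
  with \<open>y\<close> as close to one as desired, provided that bad points carry a small
  weight.\<close>

lemma animals_weight:
  assumes k: "k \<ge> 1" and y: "0 < y" "y < 1"
  shows "\<exists>w0>0. \<forall>w n u. 0 \<le> w \<longrightarrow> w \<le> w0 \<longrightarrow> n > 3 * k \<longrightarrow>
     (\<Sum>T\<in>animals n k u. w ^ card (bads n k T)) * y ^ u \<le> real n ^ 2"
proof -
  obtain w0 where w0: "w0 > 0" "\<And>w n. 0 \<le> w \<Longrightarrow> w \<le> w0 \<Longrightarrow> n > 3 * k \<Longrightarrow>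
     (\<Sum>X\<in>seg_families n k. \<Prod>g\<in>X. w * y ^ card g) \<le> real n ^ 2"
    using conn_segments_weight[OF assms] by blast
  show ?thesis
  proof (intro exI[of _ w0] conjI allI impI w0(1))
    fix w n u assume w: "0 \<le> w" "w \<le> w0" and n: "n > 3 * k"
    define X where "X T = run n k T ` bads n k T" for T
    have "(\<Sum>T\<in>animals n k u. w ^ card (bads n k T)) * y ^ u
       = (\<Sum>T\<in>animals n k u. \<Prod>g\<in>X T. w * y ^ card g)"
      unfolding sum_distrib_right
    proof (rule sum.cong[OF refl])
      fix T assume "T \<in> animals n k u"
      then have T: "pperm n T" "card T = u" by (auto simp: animals_def)
      have "(\<Prod>g\<in>X T. w * y ^ card g) = w ^ card (X T) * y ^ (\<Sum>g\<in>X T. card g)"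
        by (simp add: prod.distrib power_sum)
      then show "w ^ card (bads n k T) * y ^ u = (\<Prod>g\<in>X T. w * y ^ card g)"
        using runs_card[OF T(1) k] T(2) by (simp add: X_def)
    qed
    also have "\<dots> = (\<Sum>X\<in>X ` animals n k u. \<Prod>g\<in>X. w * y ^ card g)"
    proof (subst sum.reindex)
      show "inj_on X (animals n k u)"
      proof (rule inj_onI)
        fix S T assume "S \<in> animals n k u" "T \<in> animals n k u" "X S = X T"
        moreover have "\<Union>(X T) = T" if "T \<in> animals n k u" for T
          unfolding X_def by (rule runs_partition(2)[OF _ k]) (use that in \<open>simp add: animals_def\<close>)
        ultimately show "S = T" by metis
      qed
    qed simp
    also have "\<dots> \<le> (\<Sum>X\<in>seg_families n k. \<Prod>g\<in>X. w * y ^ card g)"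
    proof (rule sum_mono2)
      show "finite (seg_families n k)"
        by (rule finite_subset[of _ "Pow {g. segment n k g}"])
           (use finite_segments[of n k] in \<open>simp_all add: subset_iff\<close>)
      show "X ` animals n k u \<subseteq> seg_families n k"
      proof (rule image_subsetI)
        fix T assume "T \<in> animals n k u"
        then have T: "pperm n T" "conn (padj n k) T" by (simp_all add: animals_def)
        have "X T \<subseteq> {g. segment n k g}"
          unfolding X_def using segment_run[OF T(1) k] by blast
        then show "X T \<in> seg_families n k"
          using conn_runs[OF T(1) k T(2)] by (simp add: X_def)
      qed
      show "0 \<le> (\<Prod>g\<in>X. w * y ^ card g)" for X :: "pset set"
        by (rule prod_nonneg) (use w y in simp)
    qed
    also have "\<dots> \<le> real n ^ 2" by (rule w0(2)[OF w n])
    finally show "(\<Sum>T\<in>animals n k u. w ^ card (bads n k T)) * y ^ u \<le> real n ^ 2" .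
  qed
qed

section \<open>Missing edges\<close>

definition edges :: "nat \<Rightarrow> nat \<Rightarrow> pset \<Rightarrow> pset set" where
  "edges n k T = {{p, q} | p q. p \<in> T \<and> q \<in> T \<and> padj n k p q}"

text \<open>Edges are directed along increasing columns, cyclically. A point of a partial
  permutation has at most \<open>k\<close> forward neighbours, so missing edges can be counted point
  by point.\<close>

definition fwd_nbrs :: "nat \<Rightarrow> nat \<Rightarrow> pset \<Rightarrow> int \<times> int \<Rightarrow> pset" where
  "fwd_nbrs n k T p = {q \<in> T. \<exists>i\<in>{1..int k}. fst q = (fst p + i) mod int n \<and> cadj n k (snd p) (snd q)}"

lemma fwd_nbrs_if_padj:
  assumes T: "T \<subseteq> pts n" and p: "p \<in> T" and q: "q \<in> T" and a: "padj n k p q"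
    and le: "(fst q - fst p) mod int n \<le> int k"
  shows "q \<in> fwd_nbrs n k T p"
proof -
  define i where "i = (fst q - fst p) mod int n"
  have rq: "0 \<le> fst q" "fst q < int n" "0 \<le> fst p" "fst p < int n"
    using T p q by (auto simp: pts_def verts_def)
  have e: "(fst p + i) mod int n = fst q" using rq by (simp add: i_def mod_simps)
  have "i \<noteq> 0"
  proof
    assume "i = 0"
    then have "fst p = fst q" using e rq by simp
    then show False using a by (simp add: padj_def cadj_def)
  qed
  moreover have "0 \<le> i" using rq by (simp add: i_def)
  ultimately have "i \<in> {1..int k}" using le by (simp add: i_def)
  then show ?thesis using q a e[symmetric] unfolding fwd_nbrs_def padj_def by blast
qed

text \<open>Only an inequality, since for \<open>n \<le> 2 k\<close> an edge may be forward from
  both of its ends.\<close>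

lemma card_edges_le:
  assumes T: "T \<subseteq> pts n"
  shows "card (edges n k T) \<le> (\<Sum>p\<in>T. card (fwd_nbrs n k T p))"
proof -
  have fin: "finite T" by (rule finite_subset[OF T]) simp
  then have finf: "finite (fwd_nbrs n k T p)" for p by (simp add: fwd_nbrs_def)
  have "edges n k T \<subseteq> (\<Union>p\<in>T. (\<lambda>q. {p, q}) ` fwd_nbrs n k T p)"
  proof
    fix e assume "e \<in> edges n k T"
    then obtain p q where e: "e = {p, q}" "p \<in> T" "q \<in> T" "padj n k p q" by (auto simp: edges_def)
    then have "padj n k q p" by (auto simp: padj_def cadj_sym)
    moreover have "(fst q - fst p) mod int n \<le> int k \<or> (fst p - fst q) mod int n \<le> int k"
      using e(4) by (simp add: padj_def cadj_def)
    ultimately have "q \<in> fwd_nbrs n k T p \<or> p \<in> fwd_nbrs n k T q"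
      using fwd_nbrs_if_padj[OF T] e by blast
    then show "e \<in> (\<Union>p\<in>T. (\<lambda>q. {p, q}) ` fwd_nbrs n k T p)"
      using e by (auto simp: insert_commute)
  qed
  then have "card (edges n k T) \<le> card (\<Union>p\<in>T. (\<lambda>q. {p, q}) ` fwd_nbrs n k T p)"
    by (intro card_mono) (auto simp: fin finf)
  also have "\<dots> \<le> (\<Sum>p\<in>T. card ((\<lambda>q. {p, q}) ` fwd_nbrs n k T p))" by (rule card_UN_le[OF fin])
  also have "\<dots> \<le> (\<Sum>p\<in>T. card (fwd_nbrs n k T p))" by (intro sum_mono card_image_le finf)
  finally show ?thesis .
qed

lemma card_fwd_nbrs_le:
  assumes T: "pperm n T"
  shows "card (fwd_nbrs n k T p) \<le> k" and "card (fwd_nbrs n k T p) = k \<Longrightarrow> fst p < int n - 1 \<Longrightarrow> good n k T p"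
proof -
  define I where "I = {i \<in> {1..int k}. \<exists>q\<in>T. fst q = (fst p + i) mod int n \<and> cadj n k (snd p) (snd q)}"
  have finI: "finite I" by (rule finite_subset[of _ "{1..int k}"]) (auto simp: I_def)
  have "inj_on fst (fwd_nbrs n k T p)"
    using T by (auto simp: pperm_def fwd_nbrs_def intro: inj_on_subset)
  then have "card (fwd_nbrs n k T p) = card (fst ` fwd_nbrs n k T p)" by (simp add: card_image)
  also have "\<dots> \<le> card ((\<lambda>i. (fst p + i) mod int n) ` I)"
    by (rule card_mono) (use finI in \<open>auto simp: fwd_nbrs_def I_def\<close>)
  also have "\<dots> \<le> card I" by (rule card_image_le[OF finI])
  finally have 1: "card (fwd_nbrs n k T p) \<le> card I" .
  have 2: "card I \<le> card {1..int k}" by (rule card_mono) (auto simp: I_def)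
  show "card (fwd_nbrs n k T p) \<le> k" using 1 2 by simp
  assume "card (fwd_nbrs n k T p) = k" "fst p < int n - 1"
  then have "card I = card {1..int k}" using 1 2 by simp
  then have "I = {1..int k}" by (intro card_subset_eq) (auto simp: I_def)
  then show "good n k T p" using \<open>fst p < int n - 1\<close> by (auto simp: good_def I_def)
qed

text \<open>A bad point outside the last column lacks a forward neighbour. The summand
  \<open>1\<close> accounts for the at most one point in the last column, which is bad by
  convention.\<close>

lemma card_edges_bads:
  assumes T: "pperm n T"
  shows "card (edges n k T) + card (bads n k T) \<le> k * card T + 1"
proof -
  have fin: "finite T" by (rule pperm_finite[OF T])
  define D where "D = {p \<in> T. card (fwd_nbrs n k T p) < k}"
  define L where "L = {p \<in> T. fst p = int n - 1}"
  have L: "card L \<le> 1"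
  proof (rule card_le_Suc0_iff_eq[THEN iffD2, simplified One_nat_def[symmetric]])
    show "finite L" using fin by (simp add: L_def)
    have "inj_on fst T" using T by (simp add: pperm_def)
    then show "\<forall>x\<in>L. \<forall>y\<in>L. x = y" unfolding L_def by (metis (mono_tags, lifting) inj_onD mem_Collect_eq)
  qed
  have "bads n k T \<subseteq> D \<union> L"
  proof
    fix p assume p: "p \<in> bads n k T"
    then have pT: "p \<in> T" and b: "\<not> good n k T p" by (auto simp: bads_def)
    show "p \<in> D \<union> L"
    proof (cases "fst p = int n - 1")
      case False
      then have "fst p < int n - 1" using pperm_range[OF T pT] by simp
      then have "card (fwd_nbrs n k T p) \<noteq> k" using card_fwd_nbrs_le(2)[OF T] b by blast
      then have "card (fwd_nbrs n k T p) < k" using card_fwd_nbrs_le(1)[OF T, of k p] by linarith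
      then show ?thesis using pT by (simp add: D_def)
    qed (use pT in \<open>simp add: L_def\<close>)
  qed
  then have "card (bads n k T) \<le> card (D \<union> L)" by (intro card_mono) (auto simp: D_def L_def fin)
  also have "\<dots> \<le> card D + card L" by (rule card_Un_le)
  finally have b: "card (bads n k T) \<le> card D + 1" using L by simp
  have cD: "card D = (\<Sum>p\<in>T. if p \<in> D then 1 else 0)"
    using fin by (simp add: sum.If_cases D_def Int_def)
  have "card (edges n k T) + card D \<le> (\<Sum>p\<in>T. card (fwd_nbrs n k T p)) + card D"
    using card_edges_le[of T n k] T by (simp add: pperm_def)
  also have "\<dots> = (\<Sum>p\<in>T. card (fwd_nbrs n k T p) + (if p \<in> D then 1 else 0))"
    by (simp add: sum.distrib cD)
  also have "\<dots> \<le> (\<Sum>p\<in>T. k)"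
    by (rule sum_mono) (use card_fwd_nbrs_le(1)[OF T] in \<open>auto simp: D_def\<close>)
  finally show ?thesis using b by (simp add: mult.commute)
qed

text \<open>Each \<open>s\<close> in \<open>S\<close> spoils only the \<open>k\<close> starting
  points \<open>s - i\<close>, which makes fewer than \<open>n\<close> in total.\<close>

lemma exists_gap:
  assumes "finite S" "k * card S < n"
  shows "\<exists>x0. \<forall>i\<in>{1..int k}. (x0 + i) mod int n \<notin> S"
proof -
  define B where "B s = (\<lambda>i. (s - i) mod int n) ` {1..int k}" for s
  have "card (\<Union>s\<in>S. B s) \<le> (\<Sum>s\<in>S. card (B s))" by (rule card_UN_le[OF assms(1)])
  also have "\<dots> \<le> (\<Sum>s\<in>S. k)"
  proof (rule sum_mono)
    fix s show "card (B s) \<le> k" unfolding B_def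
      using card_image_le[of "{1..int k}" "\<lambda>i. (s - i) mod int n"] by simp
  qed
  also have "\<dots> < card (verts n)" using assms(2) by (simp add: verts_def mult.commute)
  finally have "\<not> verts n \<subseteq> (\<Union>s\<in>S. B s)"
    using assms(1) by (metis B_def card_mono finite_UN finite_atLeastAtMost_int finite_imageI not_le)
  then obtain x0 where x0: "x0 \<in> verts n" "\<And>s. s \<in> S \<Longrightarrow> x0 \<notin> B s" by auto
  have "(x0 + i) mod int n \<notin> S" if i: "i \<in> {1..int k}" for i
  proof
    assume "(x0 + i) mod int n \<in> S"
    from x0(2)[OF this] have "x0 \<noteq> ((x0 + i) mod int n - i) mod int n" using i by (auto simp: B_def)
    moreover have "((x0 + i) mod int n - i) mod int n = x0"
      using x0(1) by (simp add: mod_simps verts_def)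
    ultimately show False by simp
  qed
  then show ?thesis by blast
qed

text \<open>Fewer than \<open>n/k\<close> columns miss \<open>k\<close> cyclically consecutive ones; ordered from this gap on, the
  last three points have at most \<open>0\<close>, \<open>1\<close> and \<open>2\<close> forward neighbours.\<close>

lemma card_edges_gap:
  assumes T: "pperm n T" and k: "k \<ge> 2" and c3: "card T \<ge> 3" and gap: "k * card T < n"
  shows "card (edges n k T) + (3 * k - 3) \<le> k * card T"
proof -
  have fin: "finite T" by (rule pperm_finite[OF T])
  have n: "int n > 0" using gap by simp
  have "card (fst ` T) = card T" using T by (simp add: pperm_def card_image)
  then have "\<exists>x0. \<forall>i\<in>{1..int k}. (x0 + i) mod int n \<notin> fst ` T"
    by (intro exists_gap) (use fin gap in auto)
  then obtain x0 where x0: "\<And>i. i \<in> {1..int k} \<Longrightarrow> (x0 + i) mod int n \<notin> fst ` T"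
    by blast
  \<comment> \<open>Position counted from the gap: the empty columns are the positions
    \<open>0..k-1\<close>, so every point of \<open>T\<close> has \<open>g p \<ge> k\<close>. A
    forward edge that wrapped around would have to end among these positions; hence forward edges
    increase \<open>g\<close>.\<close>
  define g where "g p = (fst p - x0 - 1) mod int n" for p :: "int \<times> int"
  have gk: "g p \<ge> int k" if "p \<in> T" for p
  proof (rule ccontr)
    assume "\<not> ?thesis"
    then have "g p + 1 \<in> {1..int k}" using n by (auto simp: g_def)
    from x0[OF this] have "(x0 + (g p + 1)) mod int n \<noteq> fst p" using that by auto
    moreover have "(x0 + (g p + 1)) mod int n = (x0 + (fst p - x0 - 1 + 1)) mod int n"
      unfolding g_def by (metis mod_add_left_eq mod_add_right_eq)
    ultimately show False using pperm_range[OF T that] by simp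
  qed
  have gn: "0 \<le> g p" "g p < int n" for p using n by (simp_all add: g_def)
  have up: "g p < g q" if pT: "p \<in> T" and q: "q \<in> fwd_nbrs n k T p" for p q
  proof -
    obtain i where i: "i \<in> {1..int k}" "fst q = (fst p + i) mod int n" and qT: "q \<in> T"
      using q by (auto simp: fwd_nbrs_def)
    have "g q = (fst p + i - x0 - 1) mod int n"
      unfolding g_def i(2) diff_diff_eq by (rule mod_diff_left_eq)
    also have "\<dots> = (g p + i) mod int n" by (simp add: g_def mod_simps algebra_simps)
    finally have gq: "g q = (g p + i) mod int n" .
    show ?thesis
    proof (cases "g p + i < int n")
      case True
      then show ?thesis using gq i gn[of p] by simp
    next
      case False
      have "k \<le> k * card T" using c3 by (cases "card T") auto
      then have "int k \<le> int n" using gap by linarith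
      then have "g q = g p + i - int n"
        using gq False i gn[of p] by (intro int_mod_pos_eq[of _ _ 1, THEN trans[OF gq]]) auto
      then have "g q < int k" using i gn[of p] by auto
      then show ?thesis using gk[OF qT] by simp
    qed
  qed
  have ex_max: "\<exists>p\<in>A. \<forall>q\<in>A. g q \<le> g p" if "finite A" "A \<noteq> {}" for A
  proof -
    have "Max (g ` A) \<in> g ` A" using that by (intro Max_in) auto
    then obtain p where "p \<in> A" "g p = Max (g ` A)" by auto
    then show ?thesis using that by (metis Max_ge finite_imageI imageI)
  qed
  obtain p1 where p1: "p1 \<in> T" "\<And>q. q \<in> T \<Longrightarrow> g q \<le> g p1"
    using ex_max[OF fin] c3 by fastforce
  have c1: "card (T - {p1}) = card T - 1" using p1 fin by simp
  then have "T - {p1} \<noteq> {}" using c3 by force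
  then obtain p2 where p2: "p2 \<in> T - {p1}" "\<And>q. q \<in> T - {p1} \<Longrightarrow> g q \<le> g p2"
    using ex_max[of "T - {p1}"] fin by blast
  have c2: "card (T - {p1} - {p2}) = card T - 2" using p2 fin c1 by simp
  then have "T - {p1} - {p2} \<noteq> {}" using c3 by force
  then obtain p3 where p3: "p3 \<in> T - {p1} - {p2}" "\<And>q. q \<in> T - {p1} - {p2} \<Longrightarrow> g q \<le> g p3"
    using ex_max[of "T - {p1} - {p2}"] fin by blast
  have sub: "fwd_nbrs n k T p \<subseteq> T" for p by (auto simp: fwd_nbrs_def)
  have "fwd_nbrs n k T p1 = {}" using up[OF p1(1)] p1(2) sub[of p1] by fastforce
  then have f1: "card (fwd_nbrs n k T p1) = 0" by simp
  have "fwd_nbrs n k T p2 \<subseteq> {p1}" using up[of p2] p2 sub[of p2] by fastforce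
  then have "card (fwd_nbrs n k T p2) \<le> card {p1}" by (intro card_mono) auto
  then have f2: "card (fwd_nbrs n k T p2) \<le> 1" by simp
  have "fwd_nbrs n k T p3 \<subseteq> {p1, p2}" using up[of p3] p3 sub[of p3] by fastforce
  then have "card (fwd_nbrs n k T p3) \<le> card {p1, p2}" by (intro card_mono) auto
  also have "\<dots> \<le> 2" by (simp add: card_insert_if)
  finally have f3: "card (fwd_nbrs n k T p3) \<le> 2" .
  define f where "f p = card (fwd_nbrs n k T p)" for p
  have "(\<Sum>p\<in>T. f p) = f p1 + (f p2 + (f p3 + (\<Sum>p\<in>T - {p1} - {p2} - {p3}. f p)))"
    using sum.remove[OF fin p1(1), of f] sum.remove[of "T - {p1}" p2 f] sum.remove[of "T - {p1} - {p2}" p3 f]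
      p2 p3 fin by simp
  also have "\<dots> \<le> 0 + (1 + (2 + (\<Sum>p\<in>T - {p1} - {p2} - {p3}. k)))"
    by (intro add_mono sum_mono) (use f1 f2 f3 card_fwd_nbrs_le(1)[OF T] in \<open>auto simp: f_def\<close>)
  also have "(\<Sum>p\<in>T - {p1} - {p2} - {p3}. k) = k * (card T - 3)"
    using p3 c2 fin by (simp add: mult.commute)
  finally have "card (edges n k T) \<le> 3 + k * (card T - 3)"
    using card_edges_le[of T n k] T by (simp add: f_def pperm_def)
  moreover have "k * (card T - 3) + 3 * k = k * card T"
    using c3 by (metis add.commute distrib_left le_add_diff_inverse mult.commute)
  ultimately show ?thesis using k by simp
qed

section \<open>Expansion of the overlap moment\<close>

definition graph_of :: "nat \<Rightarrow> (int \<Rightarrow> int) \<Rightarrow> pset" where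
  "graph_of n \<pi> = (\<lambda>x. (x, \<pi> x)) ` verts n"

abbreviation perms :: "nat \<Rightarrow> (int \<Rightarrow> int) set" where
  "perms n \<equiv> {\<pi>. \<pi> permutes verts n}"

abbreviation extensions :: "nat \<Rightarrow> pset \<Rightarrow> (int \<Rightarrow> int) set" where
  "extensions n S \<equiv> {\<pi>. \<pi> permutes verts n \<and> S \<subseteq> graph_of n \<pi>}"

definition comp_of :: "nat \<Rightarrow> nat \<Rightarrow> pset \<Rightarrow> int \<times> int \<Rightarrow> pset" where
  "comp_of n k T t = {q \<in> T. (t, q) \<in> reach (padj n k) T}"

text \<open>A component with fewer than three points is a single point or an isolated edge; by
  \<open>core_big\<close> the rest of a common graph belongs here.\<close>

definition big_comps :: "nat \<Rightarrow> nat \<Rightarrow> nat \<Rightarrow> pset set" where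
  "big_comps n k v = {T. pperm n T \<and> card T = v \<and> (\<forall>t\<in>T. card (comp_of n k T t) \<ge> 3)}"

lemma finite_big_comps: "finite (big_comps n k v)"
  by (rule finite_subset[of _ "Pow (pts n)"]) (auto simp: big_comps_def pperm_def)

lemma padj_sym: "padj n k p q \<Longrightarrow> padj n k q p"
  by (auto simp: padj_def cadj_sym)

lemma pperm_graph_of: "\<pi> permutes verts n \<Longrightarrow> pperm n (graph_of n \<pi>)"
  unfolding pperm_def graph_of_def pts_def
  by (auto simp: inj_on_def permutes_in_image dest: permutes_inj injD)

lemma finite_edges: "finite T \<Longrightarrow> finite (edges n k T)"
  by (rule finite_subset[of _ "Pow T"]) (auto simp: edges_def)

lemma edges_mono: "S \<subseteq> T \<Longrightarrow> edges n k S \<subseteq> edges n k T"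
  unfolding edges_def by blast

lemma card_edge: "e \<in> edges n k T \<Longrightarrow> card e = 2"
  by (auto simp: edges_def padj_def cadj_def card_insert_if)

lemma finite_edge: "e \<in> edges n k T \<Longrightarrow> finite e"
  by (auto simp: edges_def)

text \<open>The constant matters, since \<open>2 k^2\<close> reappears in the exponent for the
  isolated edges. Counting forward edges only, each point has \<open>k\<close> columns ahead and at
  most \<open>2 k\<close> adjacent rows.\<close>

lemma card_edges_pts:
  assumes n: "n > 3 * k"
  shows "card (edges n k (pts n)) \<le> 2 * k^2 * n^2"
proof -
  have "card (edges n k (pts n)) \<le> (\<Sum>p\<in>pts n. card (fwd_nbrs n k (pts n) p))" by (rule card_edges_le) simp
  also have "\<dots> \<le> (\<Sum>p\<in>pts n. 2 * k^2)"
  proof (rule sum_mono)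
    fix p assume p: "p \<in> pts n"
    let ?X = "(\<lambda>i. (fst p + i) mod int n) ` {1..int k}" and ?Y = "{y \<in> verts n. cadj n k (snd p) y}"
    have "card (fwd_nbrs n k (pts n) p) \<le> card (?X \<times> ?Y)"
      by (rule card_mono) (auto simp: fwd_nbrs_def pts_def)
    also have "\<dots> = card ?X * card ?Y" by (rule card_cartesian_product)
    also have "\<dots> \<le> k * (2 * k)"
    proof (rule mult_mono)
      show "card ?X \<le> k" using card_image_le[of "{1..int k}" "\<lambda>i. (fst p + i) mod int n"] by simp
      show "card ?Y \<le> 2 * k" by (rule cadj_degree[OF n]) (use p in \<open>auto simp: pts_def\<close>)
    qed auto
    finally show "card (fwd_nbrs n k (pts n) p) \<le> 2 * k^2" by (simp add: power2_eq_square)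
  qed
  also have "\<dots> = 2 * k^2 * n^2" by (simp add: card_pts power2_eq_square)
  finally show ?thesis .
qed

text \<open>Relative to one extension \<open>\<sigma>\<close>, the permutation
  \<open>\<pi> \<circ> inv \<sigma>\<close> fixes every row of \<open>S\<close> and permutes the
  remaining ones.\<close>

lemma card_permutations_extending:
  assumes S: "pperm n S"
  shows "card (extensions n S) \<le> fact (n - card S)"
proof (cases "\<exists>\<sigma>. \<sigma> permutes verts n \<and> S \<subseteq> graph_of n \<sigma>")
  case False
  then have "extensions n S = {}" by blast
  then show ?thesis by (simp only: card.empty)
next
  case True
  then obtain \<sigma> where \<sigma>: "\<sigma> permutes verts n" "S \<subseteq> graph_of n \<sigma>" by blast
  define A where "A = verts n - snd ` S"
  have finA: "finite A" by (simp add: A_def)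
  have sub: "snd ` S \<subseteq> verts n" using S by (auto simp: pperm_def pts_def)
  have "card A = card (verts n) - card (snd ` S)"
    unfolding A_def by (rule card_Diff_subset[OF _ sub]) (use pperm_finite[OF S] in simp)
  moreover have "card (snd ` S) = card S" by (rule card_image) (use S in \<open>simp add: pperm_def\<close>)
  ultimately have cA: "card A = n - card S" by (simp add: verts_def)
  have val: "\<pi> (fst p) = snd p" if "S \<subseteq> graph_of n \<pi>" "p \<in> S" for \<pi> p
  proof -
    have "p \<in> graph_of n \<pi>" using that by blast
    then show ?thesis by (auto simp: graph_of_def)
  qed
  define h where "h \<pi> = \<pi> \<circ> inv \<sigma>" for \<pi> :: "int \<Rightarrow> int"
  have inj: "inj \<sigma>" using permutes_inj[OF \<sigma>(1)] .
  have inv1: "inv \<sigma> (\<sigma> x) = x" for x by (rule inv_f_f[OF inj])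
  have "card (extensions n S) \<le> card {p. p permutes A}"
  proof (rule card_inj_on_le[of h])
    show "inj_on h (extensions n S)"
    proof (rule inj_onI)
      fix \<pi> \<tau> assume eq: "h \<pi> = h \<tau>"
      show "\<pi> = \<tau>"
      proof
        fix x show "\<pi> x = \<tau> x" using fun_cong[OF eq, of "\<sigma> x"] by (simp add: h_def inv1)
      qed
    qed
    show "h ` extensions n S \<subseteq> {p. p permutes A}"
    proof (rule image_subsetI)
      fix \<pi> assume "\<pi> \<in> extensions n S"
      then have \<pi>: "\<pi> permutes verts n" "S \<subseteq> graph_of n \<pi>" by simp_all
      have 1: "h \<pi> permutes verts n"
        unfolding h_def by (rule permutes_compose[OF permutes_inv[OF \<sigma>(1)] \<pi>(1)])
      have 2: "h \<pi> y = y" if yA: "y \<in> verts n - A" for y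
      proof -
        obtain p where p: "p \<in> S" "y = snd p" using yA unfolding A_def by blast
        have "inv \<sigma> (snd p) = fst p" using inv1[of "fst p"] val[OF \<sigma>(2) p(1)] by simp
        then show ?thesis using val[OF \<pi>(2) p(1)] p(2) by (simp add: h_def)
      qed
      have "h \<pi> permutes A" by (rule permutes_superset[OF 1]) (rule 2)
      then show "h \<pi> \<in> {p. p permutes A}" by simp
    qed
    show "finite {p. p permutes A}" by (rule finite_permutations[OF finA])
  qed
  also have "\<dots> = fact (n - card S)" by (rule card_permutations[OF cA finA])
  finally show ?thesis .
qed

section \<open>Expansion over the isolated common edges\<close>

lemma sum_Pow_power:
  fixes \<rho> :: real assumes "finite M"
  shows "(\<Sum>F\<in>Pow M. \<rho> ^ card F) = (1 + \<rho>) ^ card M"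
  using prod_add[OF assms, of "\<lambda>_. \<rho>" "\<lambda>_. 1"] by (simp add: add.commute)

text \<open>The isolated edges of the common graph are expanded through \<open>r = 1 + (r - 1)\<close>; everything
  else in the common graph lies in components with at least three points.\<close>

definition isolated :: "nat \<Rightarrow> nat \<Rightarrow> pset \<Rightarrow> pset set" where
  "isolated n k G = {e \<in> edges n k G. \<forall>e'\<in>edges n k G. e' \<inter> e \<noteq> {} \<longrightarrow> e' = e}"

definition core :: "nat \<Rightarrow> nat \<Rightarrow> pset \<Rightarrow> pset" where
  "core n k G = \<Union>(edges n k G - isolated n k G)"

lemma edges_subset: "e \<in> edges n k T \<Longrightarrow> e \<subseteq> T"
  by (auto simp: edges_def)

lemma core_subset: "core n k G \<subseteq> G"
  unfolding core_def using edges_subset by blast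

text \<open>No isolated edge meets the core, so taking all edges induced on the core does not bring
  one back.\<close>

lemma edges_core: "edges n k (core n k G) = edges n k G - isolated n k G"
proof
  show "edges n k (core n k G) \<subseteq> edges n k G - isolated n k G"
  proof
    fix e assume e: "e \<in> edges n k (core n k G)"
    then have eG: "e \<in> edges n k G" using edges_mono[OF core_subset] by blast
    have "e \<noteq> {}" using card_edge[OF e] by auto
    then obtain p where p: "p \<in> e" by auto
    then have "p \<in> core n k G" using edges_subset[OF e] by blast
    then obtain e' where e': "e' \<in> edges n k G - isolated n k G" "p \<in> e'"
      unfolding core_def by blast
    have "e \<notin> isolated n k G"
    proof
      assume i: "e \<in> isolated n k G"
      have "e' \<in> edges n k G" "e' \<inter> e \<noteq> {}" using e' p by auto
      then have "e' = e" using i unfolding isolated_def by blast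
      then show False using e' i by simp
    qed
    then show "e \<in> edges n k G - isolated n k G" using eG by simp
  qed
  show "edges n k G - isolated n k G \<subseteq> edges n k (core n k G)"
  proof
    fix e assume e: "e \<in> edges n k G - isolated n k G"
    then obtain p q where pq: "e = {p, q}" "padj n k p q" unfolding edges_def by blast
    then have "p \<in> core n k G" "q \<in> core n k G" using e unfolding core_def by blast+
    then show "e \<in> edges n k (core n k G)" using pq unfolding edges_def by blast
  qed
qed

lemma comp_of_ge_edges:
  assumes e: "e \<in> edges n k T" and e': "e' \<in> edges n k T" and i: "e \<inter> e' \<noteq> {}" and t: "t \<in> e"
  shows "e \<union> e' \<subseteq> comp_of n k T t"
proof -
  have edge_reach: "(a, b) \<in> reach (padj n k) T" if fE: "f \<in> edges n k T" and abf: "a \<in> f" "b \<in> f" for f a b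
  proof (cases "a = b")
    case False
    obtain p q where f: "f = {p, q}" "p \<in> T" "q \<in> T" "padj n k p q"
      using fE unfolding edges_def by blast
    then have "(a = p \<and> b = q) \<or> (a = q \<and> b = p)" using abf False by blast
    then have "a \<in> T" "b \<in> T" "padj n k a b" using f padj_sym by blast+
    then show ?thesis by (rule reach_step)
  qed (simp add: reach_refl)
  obtain x where x: "x \<in> e" "x \<in> e'" using i by auto
  have "(t, b) \<in> reach (padj n k) T" if "b \<in> e \<union> e'" for b
    using that edge_reach[OF e t] reach_trans[OF edge_reach[OF e t x(1)] edge_reach[OF e' x(2)]] by blast
  then show ?thesis using edges_subset[OF e] edges_subset[OF e'] by (auto simp: comp_of_def)
qed

text \<open>A non-isolated edge meets another edge, which is then non-isolated as well; their union
  has at least three points and lies in one component of the core.\<close>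

lemma core_big:
  assumes G: "pperm n G"
  shows "core n k G \<in> big_comps n k (card (core n k G))"
proof -
  let ?U = "core n k G"
  have pU: "pperm n ?U" by (rule pperm_subset[OF G core_subset])
  have "card (comp_of n k ?U t) \<ge> 3" if tU: "t \<in> ?U" for t
  proof -
    obtain e where e: "e \<in> edges n k G" "e \<notin> isolated n k G" "t \<in> e" using tU unfolding core_def by blast
    then obtain e' where e': "e' \<in> edges n k G" "e' \<inter> e \<noteq> {}" "e' \<noteq> e"
      unfolding isolated_def by blast
    have "e' \<notin> isolated n k G"
    proof
      assume "e' \<in> isolated n k G"
      then have "e = e'" using e(1) e'(2) unfolding isolated_def by blast
      then show False using e'(3) by simp
    qed
    then have m: "e \<in> edges n k ?U" "e' \<in> edges n k ?U" using e e' by (auto simp: edges_core)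
    have "e \<union> e' \<subseteq> comp_of n k ?U t" by (rule comp_of_ge_edges[OF m _ e(3)]) (use e' in auto)
    moreover have fin: "finite (comp_of n k ?U t)" using pperm_finite[OF pU] by (simp add: comp_of_def)
    ultimately have le: "card (e \<union> e') \<le> card (comp_of n k ?U t)" by (rule card_mono[rotated])
    have ce: "card e = 2" "card e' = 2" "finite e" "finite e'"
      using card_edge[OF e(1)] card_edge[OF e'(1)] finite_edge[OF e(1)] finite_edge[OF e'(1)] by simp_all
    have "\<not> e' \<subseteq> e"
    proof
      assume "e' \<subseteq> e"
      from card_subset_eq[OF ce(3) this] show False using ce(1,2) e'(3) by simp
    qed
    then have "e \<subset> e \<union> e'" by blast
    moreover have "finite (e \<union> e')" using ce by simp
    ultimately have "card e < card (e \<union> e')" by (rule psubset_card_mono[rotated])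
    then show ?thesis using le ce(1) by linarith
  qed
  then show ?thesis using pU by (simp add: big_comps_def)
qed

lemma card_core_isolated:
  assumes G: "finite G" and F: "F \<subseteq> isolated n k G"
  shows "card (core n k G \<union> \<Union>F) = card (core n k G) + 2 * card F" "\<Union>F \<subseteq> G" "F \<subseteq> edges n k G"
proof -
  show FE: "F \<subseteq> edges n k G" using F by (auto simp: isolated_def)
  then show FG: "\<Union>F \<subseteq> G" using edges_subset by blast
  have finF: "finite F" by (rule finite_subset[OF FE finite_edges[OF G]])
  have fin: "finite (core n k G)" "finite (\<Union>F)"
    by (rule finite_subset[OF core_subset G]) (rule finite_subset[OF FG G])
  have "core n k G \<inter> \<Union>F = {}"
  proof (rule ccontr)
    assume "core n k G \<inter> \<Union>F \<noteq> {}"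
    then obtain p f e where p: "p \<in> f" "f \<in> F" "p \<in> e" "e \<in> edges n k G - isolated n k G"
      unfolding core_def by blast
    then have "e \<inter> f \<noteq> {}" "e \<in> edges n k G" "f \<in> isolated n k G" using F by blast+
    then have "e = f" unfolding isolated_def by blast
    then show False using p F by blast
  qed
  moreover have "card (\<Union>F) = (\<Sum>f\<in>F. card f)"
  proof (rule card_Union_disjoint)
    show "disjoint F"
    proof (rule disjointI)
      fix a b assume "a \<in> F" "b \<in> F" "a \<noteq> b"
      then show "a \<inter> b = {}" using F FE unfolding isolated_def by blast
    qed
    show "finite A" if "A \<in> F" for A using FE that finite_edge by blast
  qed
  moreover have "(\<Sum>f\<in>F. card f) = 2 * card F" 
  proof -
    have "(\<Sum>f\<in>F. card f) = (\<Sum>f\<in>F. 2)" by (rule sum.cong[OF refl]) (use FE card_edge in blast)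
    then show ?thesis by simp
  qed
  ultimately show "card (core n k G \<union> \<Union>F) = card (core n k G) + 2 * card F"
    using fin by (simp add: card_Un_disjoint)
qed

lemma sum_subsets_by_card:
  fixes f :: "nat \<Rightarrow> real"
  assumes "finite A" "real (card A) \<le> a" "\<And>j. 0 \<le> f j" and that: "finite J"
  shows "(\<Sum>F\<in>{F. F \<subseteq> A \<and> card F \<in> J}. f (card F)) \<le> (\<Sum>j\<in>J. a ^ j / fact j * f j)"
proof -
  have "(\<Sum>F\<in>{F. F \<subseteq> A \<and> card F \<in> J}. f (card F))
      = (\<Sum>j\<in>J. \<Sum>F\<in>{F \<in> {F. F \<subseteq> A \<and> card F \<in> J}. card F = j}. f (card F))"
    by (rule sum.group[symmetric]) (use assms that in auto)
  also have "\<dots> \<le> (\<Sum>j\<in>J. a ^ j / fact j * f j)"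
  proof (rule sum_mono)
    fix j assume j: "j \<in> J"
    have "(\<Sum>F\<in>{F \<in> {F. F \<subseteq> A \<and> card F \<in> J}. card F = j}. f (card F))
      = (\<Sum>F\<in>{F. F \<subseteq> A \<and> card F = j}. f j)"
      by (rule sum.cong) (use j in auto)
    also have "\<dots> = real (card A choose j) * f j" using n_subsets[OF assms(1), of j] by simp
    also have "\<dots> \<le> a ^ j / fact j * f j"
    proof (rule mult_right_mono[OF _ assms(3)])
      have "real ((card A choose j) * fact j) \<le> real (card A ^ j)"
        by (rule of_nat_mono) (metis binomial_fact_pow)
      also have "\<dots> \<le> a ^ j" using assms(2) by (simp add: power_mono)
      finally show "real (card A choose j) \<le> a ^ j / fact j" by (simp add: field_simps)
    qed
    finally show "(\<Sum>F\<in>{F \<in> {F. F \<subseteq> A \<and> card F \<in> J}. card F = j}. f (card F)) \<le> a ^ j / fact j * f j" .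
  qed
  finally show ?thesis .
qed

text \<open>The power of \<open>r\<close> for the isolated edges is a sum over their subsets
  \<open>F\<close>. A core \<open>T\<close> with \<open>v\<close> points and a set \<open>F\<close>
  of \<open>j\<close> isolated edges prescribe \<open>v + 2 j\<close> values of the permutation, so
  at most \<open>fact (n - (v + 2 j))\<close> permutations share them. Afterwards \<open>T\<close>
  and \<open>F\<close> are summed independently, over all of \<open>big_comps\<close> and over all
  sets of \<open>j\<close> edges on the full point set.\<close>

lemma sum_permutations_le:
  fixes r :: real
  assumes n: "n > 3 * k" and r: "r \<ge> 1"
  shows "(\<Sum>\<pi>\<in>perms n. r ^ card (edges n k (graph_of n \<pi>)))
    \<le> (\<Sum>v\<le>n. (\<Sum>T\<in>big_comps n k v. r ^ card (edges n k T)) *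
        (\<Sum>j\<in>{j. v + 2 * j \<le> n}. (2 * real k ^ 2 * real n ^ 2) ^ j / fact j * ((r - 1) ^ j * fact (n - (v + 2 * j)))))"
proof -
  define \<rho> where "\<rho> = r - 1"
  have \<rho>: "\<rho> \<ge> 0" using r by (simp add: \<rho>_def)
  define c where "c v j = (2 * real k ^ 2 * real n ^ 2) ^ j / fact j * (\<rho> ^ j * fact (n - (v + 2 * j)))" for v j
  define P where "P = perms n"
  have finP: "finite P" unfolding P_def by (rule finite_permutations) simp
  define A where "A = edges n k (pts n)"
  have finA: "finite A" by (simp add: A_def finite_edges)
  define G where "G = graph_of n"
  have pG: "pperm n (G \<pi>)" "finite (G \<pi>)" if "\<pi> \<in> P" for \<pi>
    using pperm_graph_of[of \<pi> n] that pperm_finite by (auto simp: P_def G_def)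
  define I where "I \<pi> = isolated n k (G \<pi>)" for \<pi>
  define U where "U \<pi> = core n k (G \<pi>)" for \<pi>
  define J where "J v = {j. v + 2 * j \<le> n}" for v
  have finJ: "finite (J v)" for v by (rule finite_subset[of _ "{..n}"]) (auto simp: J_def)
  define BB where "BB = (\<Union>v\<le>n. big_comps n k v)"
  have finBB: "finite BB" by (simp add: BB_def finite_big_comps)
  define S where "S T = {F. F \<subseteq> A \<and> card F \<in> J (card T)}" for T :: "pset"
  have finS: "finite (S T)" for T by (rule finite_subset[of _ "Pow A"]) (auto simp: S_def finA)
  define w where "w T F = r ^ card (edges n k T) * \<rho> ^ card F" for T and F :: "pset set"
  have w0: "0 \<le> w T F" for T F using r \<rho> by (simp add: w_def)
  define \<Phi> where "\<Phi> T F = (fact (n - (card T + 2 * card F)) :: nat)" for T :: "pset" and F :: "pset set"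
  have finI: "finite (I \<pi>)" if "\<pi> \<in> P" for \<pi>
    using finite_edges[OF pG(2)[OF that]] by (rule finite_subset[rotated]) (auto simp: I_def isolated_def)
  define Q where "Q = (SIGMA \<pi>:P. Pow (I \<pi>))"
  have finQ: "finite Q" unfolding Q_def using finP finI by (intro finite_SigmaI) auto
  define D where "D = (SIGMA T:BB. S T)"
  have finD: "finite D" unfolding D_def using finBB finS by (intro finite_SigmaI) auto
  define h where "h = (\<lambda>(\<pi>, F). (U \<pi>, F :: pset set))"
  have Q_props: "card (U \<pi> \<union> \<Union>F) = card (U \<pi>) + 2 * card F" "U \<pi> \<union> \<Union>F \<subseteq> G \<pi>" "F \<subseteq> edges n k (G \<pi>)"
    if "(\<pi>, F) \<in> Q" for \<pi> F
  proof -
    have *: "\<pi> \<in> P" "F \<subseteq> isolated n k (G \<pi>)" using that by (auto simp: Q_def I_def)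
    note ** = card_core_isolated[OF pG(2)[OF *(1)] *(2)]
    show "card (U \<pi> \<union> \<Union>F) = card (U \<pi>) + 2 * card F" using **(1) by (simp add: U_def)
    show "U \<pi> \<union> \<Union>F \<subseteq> G \<pi>" using **(2) core_subset unfolding U_def by blast
    show "F \<subseteq> edges n k (G \<pi>)" by (rule **(3))
  qed
  have hD: "h ` Q \<subseteq> D"
  proof (rule image_subsetI)
    fix x assume x: "x \<in> Q"
    obtain \<pi> F where xe: "x = (\<pi>, F)" by (cases x)
    have q: "(\<pi>, F) \<in> Q" using x xe by simp
    then have \<pi>: "\<pi> \<in> P" by (simp add: Q_def)
    have pp: "pperm n (U \<pi> \<union> \<Union>F)" by (rule pperm_subset[OF pG(1)[OF \<pi>] Q_props(2)[OF q]])
    have le: "card (U \<pi>) + 2 * card F \<le> n" using pperm_card_le[OF pp] Q_props(1)[OF q] by simp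
    have "U \<pi> \<in> BB" using core_big[OF pG(1)[OF \<pi>], of k] le unfolding BB_def U_def by fastforce
    moreover have "F \<subseteq> A"
    proof -
      have "G \<pi> \<subseteq> pts n" using pG(1)[OF \<pi>] by (simp add: pperm_def)
      then show ?thesis using Q_props(3)[OF q] edges_mono unfolding A_def by blast
    qed
    ultimately show "h x \<in> D" using le by (simp add: xe h_def D_def S_def J_def)
  qed
  have fib: "card {q \<in> Q. h q = d} \<le> (case d of (T, F) \<Rightarrow> \<Phi> T F)" for d
  proof -
    obtain T F where d: "d = (T, F)" by (cases d)
    show ?thesis
    proof (cases "{q \<in> Q. h q = d} = {}")
      case True
      then show ?thesis unfolding True by (simp add: d)
    next
      case False
      then obtain x where x: "x \<in> Q" "h x = (T, F)" unfolding d by blast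
      obtain \<sigma> F' where xe: "x = (\<sigma>, F')" by (cases x)
      have q: "(\<sigma>, F) \<in> Q" "U \<sigma> = T" using x by (simp_all add: xe h_def)
      then have \<sigma>: "\<sigma> \<in> P" by (simp add: Q_def)
      have pp: "pperm n (T \<union> \<Union>F)" using pperm_subset[OF pG(1)[OF \<sigma>] Q_props(2)[OF q(1)]] q(2) by simp
      have cd: "card (T \<union> \<Union>F) = card T + 2 * card F" using Q_props(1)[OF q(1)] q(2) by simp
      have "card {q \<in> Q. h q = d} \<le> card (extensions n (T \<union> \<Union>F))"
      proof (rule card_inj_on_le[of fst])
        show "inj_on fst {q \<in> Q. h q = d}" by (auto simp: inj_on_def h_def d)
        show "fst ` {q \<in> Q. h q = d} \<subseteq> extensions n (T \<union> \<Union>F)"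
        proof (rule image_subsetI)
          fix x assume x: "x \<in> {q \<in> Q. h q = d}"
          then have e: "x = (fst x, F)" "U (fst x) = T" by (auto simp: h_def d split: prod.splits)
          then have q: "(fst x, F) \<in> Q" using x by (metis (no_types, lifting) mem_Collect_eq)
          have "T \<union> \<Union>F \<subseteq> G (fst x)" using Q_props(2)[OF q] e(2) by simp
          moreover have "fst x \<in> P" using q by (simp add: Q_def)
          ultimately show "fst x \<in> extensions n (T \<union> \<Union>F)"
            by (simp add: G_def P_def)
        qed
        show "finite (extensions n (T \<union> \<Union>F))"
          by (rule finite_subset[OF _ finP]) (auto simp: P_def)
      qed
      also have "\<dots> \<le> \<Phi> T F" using card_permutations_extending[OF pp] cd by (simp add: \<Phi>_def)
      finally show ?thesis by (simp add: d)
    qed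
  qed
  have "(\<Sum>\<pi>\<in>P. r ^ card (edges n k (G \<pi>))) = (\<Sum>\<pi>\<in>P. \<Sum>F\<in>Pow (I \<pi>). w (U \<pi>) F)"
  proof (rule sum.cong[OF refl])
    fix \<pi> assume \<pi>: "\<pi> \<in> P"
    have IE: "I \<pi> \<subseteq> edges n k (G \<pi>)" by (auto simp: I_def isolated_def)
    have finE: "finite (edges n k (G \<pi>))" by (rule finite_edges[OF pG(2)[OF \<pi>]])
    have "edges n k (U \<pi>) = edges n k (G \<pi>) - I \<pi>" by (simp add: U_def I_def edges_core)
    then have "card (edges n k (U \<pi>)) + card (I \<pi>) = card (edges n k (G \<pi>))"
      using IE finE finI[OF \<pi>] by (simp add: card_Diff_subset card_mono)
    then have "r ^ card (edges n k (G \<pi>)) = r ^ card (edges n k (U \<pi>)) * r ^ card (I \<pi>)"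
      by (metis power_add)
    also have "r ^ card (I \<pi>) = (\<Sum>F\<in>Pow (I \<pi>). \<rho> ^ card F)"
      using sum_Pow_power[OF finI[OF \<pi>], of \<rho>] by (simp add: \<rho>_def)
    finally show "r ^ card (edges n k (G \<pi>)) = (\<Sum>F\<in>Pow (I \<pi>). w (U \<pi>) F)"
      by (simp add: w_def sum_distrib_left)
  qed
  also have "\<dots> = (\<Sum>q\<in>Q. case h q of (T, F) \<Rightarrow> w T F)"
    unfolding Q_def by (subst sum.Sigma) (use finP finI in \<open>auto simp: h_def intro!: sum.cong\<close>)
  also have "\<dots> = (\<Sum>d\<in>D. \<Sum>q\<in>{q \<in> Q. h q = d}. case h q of (T, F) \<Rightarrow> w T F)"
    by (rule sum.group[symmetric, OF finQ finD hD])
  also have "\<dots> \<le> (\<Sum>d\<in>D. case d of (T, F) \<Rightarrow> real (\<Phi> T F) * w T F)"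
  proof (rule sum_mono)
    fix d :: "pset \<times> pset set"
    obtain T F where d: "d = (T, F)" by (cases d)
    have "(\<Sum>q\<in>{q \<in> Q. h q = d}. case h q of (T, F) \<Rightarrow> w T F) = (\<Sum>q\<in>{q \<in> Q. h q = d}. w T F)"
      by (rule sum.cong) (auto simp: d)
    also have "\<dots> = real (card {q \<in> Q. h q = d}) * w T F" by simp
    also have "\<dots> \<le> real (\<Phi> T F) * w T F"
      by (rule mult_right_mono[OF of_nat_mono w0]) (use fib[of d] d in simp)
    finally show "(\<Sum>q\<in>{q \<in> Q. h q = d}. case h q of (T, F) \<Rightarrow> w T F) \<le> (case d of (T, F) \<Rightarrow> real (\<Phi> T F) * w T F)"
      by (simp add: d)
  qed
  also have "\<dots> = (\<Sum>T\<in>BB. \<Sum>F\<in>S T. real (\<Phi> T F) * w T F)"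
    unfolding D_def using finBB finS by (subst sum.Sigma) auto
  also have "\<dots> = (\<Sum>v\<le>n. \<Sum>T\<in>{T \<in> BB. card T = v}. \<Sum>F\<in>S T. real (\<Phi> T F) * w T F)"
    by (rule sum.group[symmetric]) (use finBB in \<open>auto simp: BB_def big_comps_def\<close>)
  also have "\<dots> \<le> (\<Sum>v\<le>n. (\<Sum>T\<in>big_comps n k v. r ^ card (edges n k T)) *
        (\<Sum>j\<in>J v. c v j))"
  proof (rule sum_mono)
    fix v assume v: "v \<in> {..n}"
    have eq: "{T \<in> BB. card T = v} = big_comps n k v" using v by (auto simp: BB_def big_comps_def)
    show "(\<Sum>T\<in>{T \<in> BB. card T = v}. \<Sum>F\<in>S T. real (\<Phi> T F) * w T F) \<le> (\<Sum>T\<in>big_comps n k v. r ^ card (edges n k T)) *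
        (\<Sum>j\<in>J v. c v j)"
      unfolding eq sum_distrib_right
    proof (rule sum_mono)
      fix T assume T: "T \<in> big_comps n k v"
      then have cT: "card T = v" by (simp add: big_comps_def)
      have "(\<Sum>F\<in>S T. real (\<Phi> T F) * w T F)
          = r ^ card (edges n k T) * (\<Sum>F\<in>S T. \<rho> ^ card F * fact (n - (v + 2 * card F)))"
        by (simp add: w_def \<Phi>_def cT sum_distrib_left mult_ac)
      also have "\<dots> \<le> r ^ card (edges n k T) * (\<Sum>j\<in>J v. c v j)"
      proof (rule mult_left_mono)
        have "real (card A) \<le> real (2 * k^2 * n^2)" unfolding A_def by (rule of_nat_mono[OF card_edges_pts[OF n]])
        then show "(\<Sum>F\<in>S T. \<rho> ^ card F * fact (n - (v + 2 * card F))) \<le> (\<Sum>j\<in>J v. c v j)"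
          unfolding S_def cT c_def by (intro sum_subsets_by_card finA finJ) (use \<rho> in auto)
      qed (use r in simp)
      finally show "(\<Sum>F\<in>S T. real (\<Phi> T F) * w T F) \<le> r ^ card (edges n k T) * (\<Sum>j\<in>J v. c v j)" .
    qed
  qed
  finally show ?thesis by (simp add: P_def G_def J_def \<rho>_def c_def)
qed

section \<open>Recursion over components\<close>

lemma comp_of_self: "t \<in> T \<Longrightarrow> t \<in> comp_of n k T t"
  by (simp add: comp_of_def reach_refl)

lemma comp_of_subset: "comp_of n k T t \<subseteq> T"
  unfolding comp_of_def by blast

lemma comp_of_step:
  assumes "p \<in> comp_of n k T t" "q \<in> T" "padj n k p q"
  shows "q \<in> comp_of n k T t"
proof -
  have p: "p \<in> T" "(t, p) \<in> reach (padj n k) T" using assms(1) by (simp_all add: comp_of_def)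
  have "(t, q) \<in> reach (padj n k) T"
    by (rule reach_trans[OF p(2)], rule reach_step) (use p(1) assms(2,3) in simp_all)
  then show ?thesis using assms(2) by (simp add: comp_of_def)
qed

lemma conn_comp_of:
  assumes t: "t \<in> T"
  shows "conn (padj n k) (comp_of n k T t)"
proof -
  let ?C = "comp_of n k T t"
  have tC: "t \<in> ?C" by (rule comp_of_self[OF t])
  have *: "x \<in> ?C \<and> (t, x) \<in> reach (padj n k) ?C" if x: "(t, x) \<in> reach (padj n k) T" for x
    using x
  proof (induction rule: reach_induct)
    case base
    show ?case using tC by (simp add: reach_refl)
  next
    case (step b c)
    then have c: "c \<in> ?C" using comp_of_step by blast
    have "(b, c) \<in> reach (padj n k) ?C" using step c by (intro reach_step) simp_all
    then have "(t, c) \<in> reach (padj n k) ?C" using step.IH reach_trans by (metis (no_types))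
    then show ?case using c by simp
  qed
  have **: "(t, x) \<in> reach (padj n k) ?C" if "x \<in> ?C" for x
    using that * by (simp add: comp_of_def)
  have "(p, q) \<in> reach (padj n k) ?C" if "p \<in> ?C" "q \<in> ?C" for p q
    by (rule reach_trans[OF reach_sym[OF padj_sym **[OF that(1)]] **[OF that(2)]])
  then show ?thesis using tC unfolding conn_def by blast
qed

text \<open>A path from a point outside a component never enters it, so removing the component
  leaves the other ones with at least their old size.\<close>

lemma comp_of_remove:
  assumes t': "t' \<in> T - comp_of n k T t"
  shows "comp_of n k T t' \<subseteq> comp_of n k (T - comp_of n k T t) t'"
proof
  let ?C = "comp_of n k T t"
  fix x assume "x \<in> comp_of n k T t'"
  then have x: "(t', x) \<in> reach (padj n k) T" by (simp add: comp_of_def)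
  have "x \<in> T - ?C \<and> (t', x) \<in> reach (padj n k) (T - ?C)"
    using x
  proof (induction rule: reach_induct)
    case base
    show ?case using t' by (simp add: reach_refl)
  next
    case (step b c)
    have "c \<notin> ?C"
    proof
      assume "c \<in> ?C"
      from comp_of_step[OF this step.hyps(2) padj_sym[OF step.hyps(4)]] show False using step.IH by simp
    qed
    then have c: "c \<in> T - ?C" using step by simp
    have "(b, c) \<in> reach (padj n k) (T - ?C)" using step c by (intro reach_step) simp_all
    then have "(t', c) \<in> reach (padj n k) (T - ?C)" using step.IH reach_trans by (metis (no_types))
    then show ?case using c by simp
  qed
  then show "x \<in> comp_of n k (T - ?C) t'" by (simp add: comp_of_def)
qed

lemma edges_split_comp:
  assumes "finite T"
  shows "card (edges n k T) \<le> card (edges n k (comp_of n k T t)) + card (edges n k (T - comp_of n k T t))"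
proof -
  let ?C = "comp_of n k T t"
  have "edges n k T \<subseteq> edges n k ?C \<union> edges n k (T - ?C)"
  proof
    fix e assume "e \<in> edges n k T"
    then obtain p q where e: "e = {p, q}" "p \<in> T" "q \<in> T" "padj n k p q" unfolding edges_def by blast
    have "p \<in> ?C \<longleftrightarrow> q \<in> ?C" using comp_of_step[OF _ e(3,4)] comp_of_step[OF _ e(2) padj_sym[OF e(4)]] by blast
    then show "e \<in> edges n k ?C \<union> edges n k (T - ?C)" using e unfolding edges_def by blast
  qed
  moreover have "finite (edges n k ?C \<union> edges n k (T - ?C))"
    using finite_subset[OF comp_of_subset assms] assms by (simp add: finite_edges)
  ultimately have "card (edges n k T) \<le> card (edges n k ?C \<union> edges n k (T - ?C))" by (rule card_mono[rotated])
  also have "\<dots> \<le> card (edges n k ?C) + card (edges n k (T - ?C))" by (rule card_Un_le)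
  finally show ?thesis .
qed

definition wsum :: "nat \<Rightarrow> nat \<Rightarrow> real \<Rightarrow> pset set \<Rightarrow> real" where
  "wsum n k r X = (\<Sum>T\<in>X. r ^ card (edges n k T))"

text \<open>Mark a point and split off its component \<open>C\<close>: the left side counts sets
  with a marked point, and on the right \<open>C\<close> has \<open>u\<close> possible marks.
  Forgetting that \<open>C\<close> and the rest have to fit together leaves an inequality. This is
  the derivative form of the exponential formula.\<close>

lemma big_comps_recursion:
  assumes r: "r \<ge> 1"
  shows "real v * wsum n k r (big_comps n k v)
    \<le> (\<Sum>u=3..v. real u * wsum n k r (animals n k u) * wsum n k r (big_comps n k (v - u)))"
proof -
  define f where "f T = r ^ card (edges n k T)" for T
  define I where "I = (SIGMA T:big_comps n k v. T)"
  define D where "D = (SIGMA u:{3..v}. SIGMA C:animals n k u. C \<times> big_comps n k (v - u))"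
  define h where "h = (\<lambda>(T, t). (card (comp_of n k T t), comp_of n k T t, t, T - comp_of n k T t))"
  have f0: "0 \<le> f T" for T using r by (simp add: f_def)
  have fin: "finite T" if "T \<in> big_comps n k u \<or> T \<in> animals n k u" for T u
    using that pperm_finite by (auto simp: big_comps_def animals_def)
  have finD: "finite D" unfolding D_def
    using fin by (intro finite_SigmaI finite_cartesian_product finite_big_comps finite_animals) auto
  have "real v * wsum n k r (big_comps n k v) = (\<Sum>T\<in>big_comps n k v. \<Sum>t\<in>T. f T)"
    by (simp add: wsum_def sum_distrib_left f_def big_comps_def)
  also have "\<dots> = (\<Sum>(T, t)\<in>I. f T)"
    unfolding I_def using fin by (subst sum.Sigma) (auto simp: finite_big_comps)
  also have "\<dots> \<le> (\<Sum>(T, t)\<in>I. case h (T, t) of (u, C, s, T') \<Rightarrow> f C * f T')"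
  proof (rule sum_mono)
    fix x assume x: "x \<in> I"
    obtain T t where xe: "x = (T, t)" by (cases x)
    have "T \<in> big_comps n k v" using x by (simp add: xe I_def)
    then have finT: "finite T" using fin by blast
    have "f T \<le> f (comp_of n k T t) * f (T - comp_of n k T t)"
      unfolding f_def power_add[symmetric]
      by (rule power_increasing[OF edges_split_comp[OF finT] r])
    then show "(case x of (T, t) \<Rightarrow> f T) \<le> (case x of (T, t) \<Rightarrow> case h (T, t) of (u, C, s, T') \<Rightarrow> f C * f T')"
      by (simp add: xe h_def)
  qed
  also have "\<dots> = (\<Sum>x\<in>I. case h x of (u, C, s, T') \<Rightarrow> f C * f T')"
    by (rule sum.cong) auto
  also have "\<dots> = (\<Sum>y\<in>h ` I. case y of (u, C, s, T') \<Rightarrow> f C * f T')"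
  proof (rule sum.reindex[symmetric, unfolded o_def])
    show "inj_on h I"
    proof (rule inj_onI)
      fix x y assume "h x = h y"
      obtain T t S s where e: "x = (T, t)" "y = (S, s)" by (cases x, cases y)
      have "comp_of n k T t = comp_of n k S s" "t = s" "T - comp_of n k T t = S - comp_of n k S s"
        using \<open>h x = h y\<close> unfolding e h_def prod.case prod.inject by blast+
      then have "T = S" using comp_of_subset[of n k T t] comp_of_subset[of n k S s] by blast
      then show "x = y" using e \<open>t = s\<close> by simp
    qed
  qed
  also have "\<dots> \<le> (\<Sum>y\<in>D. case y of (u, C, s, T') \<Rightarrow> f C * f T')"
  proof (rule sum_mono2[OF finD])
    show "h ` I \<subseteq> D"
    proof (rule image_subsetI)
      fix x assume x: "x \<in> I"
      obtain T t where xe: "x = (T, t)" by (cases x)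
      have T: "T \<in> big_comps n k v" and t: "t \<in> T" using x by (simp_all add: xe I_def)
      have pp: "pperm n T" and cT: "card T = v" and c3: "\<And>s. s \<in> T \<Longrightarrow> card (comp_of n k T s) \<ge> 3"
        using T by (auto simp: big_comps_def)
      let ?C = "comp_of n k T t"
      have finT: "finite T" by (rule pperm_finite[OF pp])
      have le: "card ?C \<le> v" using card_mono[OF finT comp_of_subset] cT by blast
      have "?C \<in> animals n k (card ?C)"
        using pperm_subset[OF pp comp_of_subset] conn_comp_of[OF t] by (simp add: animals_def)
      moreover have "T - ?C \<in> big_comps n k (v - card ?C)"
      proof -
        have "card (T - ?C) = v - card ?C"
          using card_Diff_subset[OF finite_subset[OF comp_of_subset finT] comp_of_subset, of n k t] cT by simp
        moreover have "pperm n (T - ?C)" by (rule pperm_subset[OF pp]) blast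
        moreover have "card (comp_of n k (T - ?C) s) \<ge> 3" if s: "s \<in> T - ?C" for s
        proof -
          have "finite (comp_of n k (T - ?C) s)"
            by (rule finite_subset[OF comp_of_subset]) (use finT in simp)
          from card_mono[OF this comp_of_remove[OF s]] show ?thesis using c3[of s] s by simp
        qed
        ultimately show ?thesis by (simp add: big_comps_def)
      qed
      ultimately show "h x \<in> D"
        using le c3[OF t] comp_of_self[OF t] by (simp add: xe h_def D_def)
    qed
    show "0 \<le> (case y of (u, C, s, T') \<Rightarrow> f C * f T')" for y :: "nat \<times> pset \<times> (int \<times> int) \<times> pset"
      using f0 by (simp split: prod.splits)
  qed
  also have "\<dots> = (\<Sum>u=3..v. \<Sum>C\<in>animals n k u. \<Sum>s\<in>C. \<Sum>T'\<in>big_comps n k (v - u). f C * f T')"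
  proof -
    have finC: "finite C" if "C \<in> animals n k u" for C u using fin that by blast
    have finS: "finite (SIGMA C:animals n k u. C \<times> big_comps n k (v - u))" for u
      by (intro finite_SigmaI finite_cartesian_product finite_big_comps finite_animals finC)
    have 1: "(\<Sum>C\<in>animals n k u. \<Sum>(s, T')\<in>C \<times> big_comps n k (v - u). f C * f T')
      = (\<Sum>(C, s, T')\<in>(SIGMA C:animals n k u. C \<times> big_comps n k (v - u)). f C * f T')" for u
      by (rule sum.Sigma) (use finC in \<open>simp_all add: finite_animals finite_big_comps\<close>)
    have 2: "(\<Sum>u=3..v. \<Sum>(C, s, T')\<in>(SIGMA C:animals n k u. C \<times> big_comps n k (v - u)). f C * f T')
      = (\<Sum>(u, C, s, T')\<in>D. f C * f T')"
      unfolding D_def by (rule sum.Sigma) (use finS in simp_all)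
    show ?thesis unfolding 2[symmetric] 1[symmetric] sum.cartesian_product ..
  qed
  also have "\<dots> = (\<Sum>u=3..v. real u * wsum n k r (animals n k u) * wsum n k r (big_comps n k (v - u)))"
  proof (rule sum.cong[OF refl])
    fix u
    have "(\<Sum>C\<in>animals n k u. \<Sum>s\<in>C. \<Sum>T'\<in>big_comps n k (v - u). f C * f T')
      = (\<Sum>C\<in>animals n k u. real u * f C * wsum n k r (big_comps n k (v - u)))"
      by (rule sum.cong[OF refl]) (simp add: animals_def wsum_def f_def sum_distrib_left mult.assoc)
    also have "\<dots> = real u * (\<Sum>C\<in>animals n k u. f C) * wsum n k r (big_comps n k (v - u))"
      by (simp only: sum_distrib_left sum_distrib_right)
    also have "(\<Sum>C\<in>animals n k u. f C) = wsum n k r (animals n k u)" by (simp add: wsum_def f_def)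
    finally show "(\<Sum>C\<in>animals n k u. \<Sum>s\<in>C. \<Sum>T'\<in>big_comps n k (v - u). f C * f T')
      = real u * wsum n k r (animals n k u) * wsum n k r (big_comps n k (v - u))" .
  qed
  finally show ?thesis .
qed

lemma big_comps_0: "wsum n k r (big_comps n k 0) = 1"
proof -
  have "big_comps n k 0 = {{}}"
    using pperm_finite by (auto simp: big_comps_def pperm_def)
  then show ?thesis by (simp add: wsum_def edges_def)
qed

text \<open>The factor \<open>v\<close> of the recursion absorbs the number of summands, and
  \<open>\<eta> \<le> 1\<close> allows the bound \<open>X ^ (v - u)\<close> for the remaining part,
  so exactly one factor \<open>\<eta>\<close> survives.\<close>

lemma big_comps_weight:
  assumes r: "r \<ge> 1" and \<eta>: "0 \<le> \<eta>" "\<eta> \<le> 1" and X: "0 \<le> X"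
    and A: "\<And>u. 3 \<le> u \<Longrightarrow> u \<le> n \<Longrightarrow> real u * wsum n k r (animals n k u) \<le> \<eta> * X ^ u"
  shows "1 \<le> v \<Longrightarrow> v \<le> n \<Longrightarrow> wsum n k r (big_comps n k v) \<le> \<eta> * X ^ v"
proof (induction v rule: less_induct)
  case (less v)
  have w0: "0 \<le> wsum n k r S" for S using r by (simp add: wsum_def sum_nonneg)
  have B: "wsum n k r (big_comps n k (v - u)) \<le> X ^ (v - u)" if "u \<in> {3..v}" for u
  proof (cases "v - u = 0")
    case True
    then show ?thesis unfolding True big_comps_0 by simp
  next
    case False
    then have "wsum n k r (big_comps n k (v - u)) \<le> \<eta> * X ^ (v - u)"
      using less.IH[of "v - u"] less.prems that by simp
    also have "\<dots> \<le> 1 * X ^ (v - u)" by (rule mult_right_mono) (use \<eta> X in auto)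
    finally show ?thesis by simp
  qed
  have "real v * wsum n k r (big_comps n k v)
    \<le> (\<Sum>u=3..v. real u * wsum n k r (animals n k u) * wsum n k r (big_comps n k (v - u)))"
    by (rule big_comps_recursion[OF r])
  also have "\<dots> \<le> (\<Sum>u=3..v. \<eta> * X ^ v)"
  proof (rule sum_mono)
    fix u assume u: "u \<in> {3..v}"
    have "real u * wsum n k r (animals n k u) * wsum n k r (big_comps n k (v - u)) \<le> (\<eta> * X ^ u) * X ^ (v - u)"
      by (rule mult_mono[OF A B[OF u]]) (use u less.prems \<eta> X w0 in auto)
    also have "\<dots> = \<eta> * X ^ v" using u by (simp add: mult.assoc flip: power_add)
    finally show "real u * wsum n k r (animals n k u) * wsum n k r (big_comps n k (v - u)) \<le> \<eta> * X ^ v" .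
  qed
  also have "\<dots> = real (Suc v - 3) * (\<eta> * X ^ v)" by simp
  also have "\<dots> \<le> real v * (\<eta> * X ^ v)" by (rule mult_right_mono) (use \<eta> X in auto)
  finally show ?case using less.prems by simp
qed

section \<open>Weights of connected partial permutations\<close>

lemma wsum_mono: "1 \<le> r \<Longrightarrow> r \<le> s \<Longrightarrow> wsum n k r X \<le> wsum n k s X"
  unfolding wsum_def by (intro sum_mono power_mono) auto

text \<open>A loss of edges proportional to the bad points becomes a weight
  \<open>\<rho> powr (-1/20)\<close> per bad point. This is the \<open>w\<close> of
  \<open>animals_weight\<close>, and it is small once \<open>\<rho>\<close> is large. The constant
  \<open>c\<close> differs for small and large sets.\<close>

lemma animal_wsum_le:
  fixes \<rho> c :: real
  assumes \<rho>: "\<rho> \<ge> 1"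
    and e: "\<And>T. T \<in> animals n k u \<Longrightarrow>
      real (card (edges n k T)) \<le> real (k * u) + c + (-1/20) * real (card (bads n k T))"
  shows "wsum n k \<rho> (animals n k u)
    \<le> (\<rho> ^ k) ^ u * \<rho> powr c * (\<Sum>T\<in>animals n k u. (\<rho> powr (-1/20)) ^ card (bads n k T))"
  unfolding wsum_def sum_distrib_left
proof (rule sum_mono)
  fix T assume T: "T \<in> animals n k u"
  let ?b = "card (bads n k T)"
  have "\<rho> ^ card (edges n k T) = \<rho> powr real (card (edges n k T))" using \<rho> by (simp add: powr_realpow)
  also have "\<dots> \<le> \<rho> powr (real (k * u) + c + (-1/20) * real ?b)" using e[OF T] \<rho> by (rule powr_mono)
  also have "\<dots> = \<rho> powr real (k * u) * \<rho> powr c * (\<rho> powr (-1/20)) powr real ?b"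
    unfolding powr_add powr_powr by simp
  also have "\<dots> = (\<rho> ^ k) ^ u * \<rho> powr c * (\<rho> powr (-1/20)) ^ ?b"
    using \<rho> by (simp add: powr_realpow power_mult del: of_nat_mult)
  finally show "\<rho> ^ card (edges n k T) \<le> (\<rho> ^ k) ^ u * \<rho> powr c * (\<rho> powr (-1/20)) ^ ?b" .
qed

text \<open>A fraction \<open>1/20\<close> of the missing edges pays for the bad points, the rest beats the \<open>n\<^sup>2\<close>
  translates; this is the place where \<open>k \<ge> 4\<close> is needed.\<close>

lemma animal_edges_small:
  assumes k: "k \<ge> 4" and u: "3 \<le> u" "k * u < n" and T: "T \<in> animals n k u"
  shows "real (card (edges n k T)) \<le> real (k * u) + real k * (-17/8) + (-1/20) * real (card (bads n k T))"
proof -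
  have pp: "pperm n T" and cT: "card T = u" using T by (auto simp: animals_def)
  have "card (edges n k T) + card (bads n k T) \<le> k * u + 1" using card_edges_bads[OF pp, of k] by (simp add: cT)
  then have 1: "real (card (edges n k T)) + real (card (bads n k T)) \<le> real (k * u) + 1" by linarith
  have "card (edges n k T) + (3 * k - 3) \<le> k * u" using card_edges_gap[OF pp, of k] k u by (simp add: cT)
  then have "real (card (edges n k T) + (3 * k - 3)) \<le> real (k * u)" by (rule of_nat_mono)
  then have "real (card (edges n k T)) + (3 * real k - 3) \<le> real (k * u)" using k by (simp add: of_nat_diff)
  moreover have "real k \<ge> 4" using k by simp
  \<comment> \<open>One twentieth of the first inequality plus nineteen twentieths of the second
    saves \<open>2.85 k - 2.9\<close>, which is at least \<open>17 k / 8\<close> exactly when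
    \<open>k \<ge> 4\<close>. As \<open>17/8 > 2\<close>, this beats \<open>n^2\<close>; for
    \<open>k = 3\<close> the whole saving \<open>3 k - 3\<close> would only equal
    \<open>2 k\<close>.\<close>
  ultimately show ?thesis using 1 by argo
qed

text \<open>A set with \<open>k u \<ge> n\<close> may go round the whole cycle, so only the bad
  points are sure to miss edges. Its size compensates for this, because \<open>q ^ u\<close> is
  exponentially small in \<open>n\<close>.\<close>

lemma animal_edges_large:
  assumes T: "T \<in> animals n k u"
  shows "real (card (edges n k T)) \<le> real (k * u) + 1 + (-1/20) * real (card (bads n k T))"
proof -
  have pp: "pperm n T" and cT: "card T = u" using T by (auto simp: animals_def)
  have "card (edges n k T) + card (bads n k T) \<le> k * u + 1" using card_edges_bads[OF pp, of k] by (simp add: cT)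
  then show ?thesis by linarith
qed

lemma bounded_mult_power:
  fixes Y :: real assumes "0 \<le> Y" "Y < 1"
  shows "\<exists>c>0. \<forall>l. real l * Y ^ l \<le> c"
proof -
  obtain c where c: "c > 0" "\<And>n. (\<Sum>l\<le>n. real l * Y ^ l) \<le> c"
    using bounded_sum_mult_power[OF assms] by blast
  have "real l * Y ^ l \<le> c" for l
  proof -
    have "real l * Y ^ l \<le> (\<Sum>l\<le>l. real l * Y ^ l)"
      by (rule member_le_sum) (use assms in auto)
    then show ?thesis using c(2)[of l] by simp
  qed
  then show ?thesis using c(1) by blast
qed

text \<open>The three factors \<open>q\<close> per point have separate uses: one pays for the number
  of shapes in \<open>animals_weight\<close>, one absorbs the factor \<open>u\<close> or, if
  \<open>k u \<ge> n\<close>, everything polynomial in \<open>n\<close>, and one stays in the base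
  \<open>q n / e\<close> as geometric decay for the later sum over sizes.\<close>

lemma animal_weights_vanish:
  assumes k: "k \<ge> 4" and q: "0 < q" "q < (1::real)"
  shows "\<exists>\<eta>. \<eta> \<longlonglongrightarrow> 0 \<and> (\<forall>n. 0 \<le> \<eta> n) \<and> (\<forall>\<^sub>F n in sequentially. \<forall>r u.
      1 \<le> r \<longrightarrow> r ^ k \<le> q ^ 3 * real n / exp 1 \<longrightarrow> 3 \<le> u \<longrightarrow> u \<le> n \<longrightarrow>
      real u * wsum n k r (animals n k u) \<le> \<eta> n * (q * real n / exp 1) ^ u)"
proof -
  obtain c where c: "c > 0" "\<And>l. real l * q ^ l \<le> c" using bounded_mult_power[of q] q by auto
  obtain w0 where w0: "w0 > 0" "\<And>w n u. 0 \<le> w \<Longrightarrow> w \<le> w0 \<Longrightarrow> n > 3 * k \<Longrightarrow>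
     (\<Sum>T\<in>animals n k u. w ^ card (bads n k T)) * q ^ u \<le> real n ^ 2"
    using animals_weight[of k q] k q by force
  define R where "R n = q ^ 3 * real n / exp 1" for n :: nat
  define \<rho> where "\<rho> n = R n powr (1 / real k)" for n
  \<comment> \<open>The first summand serves \<open>k u < n\<close>. The second serves
    \<open>k u \<ge> n\<close>, where \<open>n^4\<close> comes from the factors \<open>u\<close> and
    \<open>\<rho>\<close>, at most \<open>n\<close> each, and from the \<open>n^2\<close>
    translates.\<close>
  define \<eta> where "\<eta> n = c * (real n ^ 2 * R n powr (-17/8)) + real n ^ 4 * q powr (real n / real k)" for n
  define a where "a = q ^ 3 / exp 1"
  have a: "a > 0" using q by (simp add: a_def)
  have Ra: "R n = a * real n" for n by (simp add: R_def a_def)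
  have kpos: "real k > 0" using k by simp
  have lq: "ln q < 0" using q by simp
  have l1: "(\<lambda>n. real n ^ 2 * (a * real n) powr (-17/8)) \<longlonglongrightarrow> 0" using a by real_asymp
  have l2: "(\<lambda>n. real n ^ 4 * exp (ln q / real k * real n)) \<longlonglongrightarrow> 0"
  proof -
    define b where "b = - (ln q / real k)"
    have b: "b > 0" using lq kpos by (simp add: b_def divide_neg_pos)
    have "(\<lambda>n. real n ^ 4 * exp (- b * real n)) \<longlonglongrightarrow> 0" using b by real_asymp
    then show ?thesis by (simp add: b_def)
  qed
  have "\<eta> \<longlonglongrightarrow> c * 0 + 0"
    unfolding \<eta>_def Ra powr_def[of q]
    by (intro tendsto_add tendsto_mult tendsto_const l1) (use l2 q in \<open>simp add: mult.commute\<close>)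
  then have lim: "\<eta> \<longlonglongrightarrow> 0" by simp
  have \<eta>0: "0 \<le> \<eta> n" for n using c q by (simp add: \<eta>_def)
  have w_lim: "(\<lambda>n. \<rho> n powr (-1/20)) \<longlonglongrightarrow> 0"
  proof -
    have "(\<lambda>n. ((a * real n) powr (1 / real k)) powr (-1/20)) \<longlonglongrightarrow> 0"
      using a kpos by real_asymp
    then show ?thesis by (simp add: \<rho>_def Ra)
  qed
  have ev1: "\<forall>\<^sub>F n in sequentially. \<rho> n powr (-1/20) < w0" using w_lim w0(1) by (rule order_tendstoD)
  have ev2: "\<forall>\<^sub>F n in sequentially. 1 \<le> a * real n" using a by real_asymp
  have ev3: "\<forall>\<^sub>F n in sequentially. n > 3 * k" by (rule eventually_gt_at_top)
  have "\<forall>\<^sub>F n in sequentially. \<forall>r u.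
      1 \<le> r \<longrightarrow> r ^ k \<le> q ^ 3 * real n / exp 1 \<longrightarrow> 3 \<le> u \<longrightarrow> u \<le> n \<longrightarrow>
      real u * wsum n k r (animals n k u) \<le> \<eta> n * (q * real n / exp 1) ^ u"
    using ev1 ev2 ev3
  proof (eventually_elim, intro allI impI)
    fix n :: nat and r :: real and u :: nat
    assume e1: "\<rho> n powr (-1/20) < w0" and e2: "1 \<le> a * real n" and n: "n > 3 * k"
      and r: "1 \<le> r" "r ^ k \<le> q ^ 3 * real n / exp 1" and u: "3 \<le> u" "u \<le> n"
    have R1: "R n \<ge> 1" using e2 by (simp add: Ra)
    have \<rho>1: "\<rho> n \<ge> 1" using R1 by (simp add: \<rho>_def ge_one_powr_ge_zero)
    have \<rho>k: "\<rho> n ^ k = R n"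
      using R1 kpos k by (simp add: \<rho>_def powr_powr flip: powr_realpow')
    have \<rho>c: "\<rho> n powr (real k * (-17/8)) = R n powr (-17/8)"
    proof -
      have "R n = \<rho> n powr real k" using \<rho>1 \<rho>k by (simp add: powr_realpow)
      then show ?thesis by (simp add: powr_powr)
    qed
    \<comment> \<open>The given \<open>r\<close> may be as small as one, where its power
      \<open>-1/20\<close> is not small. So the weights are taken at the largest admissible value
      \<open>\<rho> n\<close>, which tends to infinity.\<close>
    have r\<rho>: "r \<le> \<rho> n"
    proof (rule power_le_imp_le_base[of _ "k - 1"])
      show "r ^ Suc (k - 1) \<le> \<rho> n ^ Suc (k - 1)" using r \<rho>k k by (simp add: R_def)
    qed (use \<rho>1 in simp)
    define S where "S = (\<Sum>T\<in>animals n k u. (\<rho> n powr (-1/20)) ^ card (bads n k T))"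
    have S0: "0 \<le> S" unfolding S_def by (intro sum_nonneg) auto
    have Sb: "S * q ^ u \<le> real n ^ 2" unfolding S_def by (rule w0(2)) (use e1 n in auto)
    define Z where "Z = q * real n / exp 1"
    have Z0: "0 \<le> Z" using q by (simp add: Z_def)
    have RZ: "R n ^ u = q ^ u * q ^ u * Z ^ u"
      by (simp add: R_def Z_def power3_eq_cube flip: power_mult_distrib) (simp add: mult_ac)
    have m: "wsum n k r (animals n k u) \<le> wsum n k (\<rho> n) (animals n k u)" by (rule wsum_mono[OF r(1) r\<rho>])
    have "real u * wsum n k r (animals n k u) \<le> \<eta> n * Z ^ u"
    proof (cases "k * u < n")
      case True
      have "real u * wsum n k r (animals n k u) \<le> real u * (R n ^ u * R n powr (-17/8) * S)"
        using order_trans[OF m animal_wsum_le[OF \<rho>1 animal_edges_small[OF k u(1) True]]]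
        unfolding \<rho>k \<rho>c S_def[symmetric] by (rule mult_left_mono[OF _ of_nat_0_le_iff])
      also have "\<dots> = (real u * q ^ u) * (S * q ^ u) * (R n powr (-17/8) * Z ^ u)"
        by (simp add: RZ mult_ac)
      also have "\<dots> \<le> c * real n ^ 2 * (R n powr (-17/8) * Z ^ u)"
        by (intro mult_right_mono mult_mono c(2) Sb) (use c S0 q Z0 in auto)
      also have "\<dots> = (c * (real n ^ 2 * R n powr (-17/8))) * Z ^ u" by simp
      also have "\<dots> \<le> \<eta> n * Z ^ u"
        by (rule mult_right_mono) (use Z0 q in \<open>auto simp: \<eta>_def\<close>)
      finally show ?thesis .
    next
      case False
      have \<rho>n: "\<rho> n \<le> real n"
      proof -
        have "\<rho> n \<le> \<rho> n ^ k" by (rule self_le_power) (use \<rho>1 k in auto)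
        also have "\<dots> = q ^ 3 / exp 1 * real n" by (simp add: \<rho>k R_def)
        also have "q ^ 3 / exp 1 \<le> 1"
        proof -
          have "q ^ 3 \<le> 1" using q by (simp add: power_le_one)
          moreover have "(1::real) \<le> exp 1" by simp
          ultimately have "q ^ 3 \<le> exp 1" by linarith
          then show ?thesis by simp
        qed
        then have "q ^ 3 / exp 1 * real n \<le> 1 * real n" by (rule mult_right_mono) simp
        finally show ?thesis by simp
      qed
      have qu: "q ^ u \<le> q powr (real n / real k)"
      proof -
        have "real n \<le> real (k * u)" using False by (intro of_nat_mono) simp
        then have "real n / real k \<le> real u" using kpos by (simp add: field_simps)
        then have "q powr real u \<le> q powr (real n / real k)"
          using q by (intro powr_mono') auto
        then show ?thesis using q by (simp add: powr_realpow)
      qed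
      have "real u * wsum n k r (animals n k u) \<le> real u * (R n ^ u * \<rho> n * S)"
        using order_trans[OF m animal_wsum_le[OF \<rho>1 animal_edges_large]] \<rho>1
        by (intro mult_left_mono) (simp_all add: \<rho>k S_def)
      also have "\<dots> = (real u * \<rho> n * (S * q ^ u)) * q ^ u * Z ^ u"
        by (simp add: RZ mult_ac)
      also have "\<dots> \<le> (real n * real n * real n ^ 2) * q powr (real n / real k) * Z ^ u"
        by (intro mult_right_mono mult_mono Sb \<rho>n qu) (use u \<rho>1 S0 q Z0 in auto)
      also have "\<dots> = (real n ^ 4 * q powr (real n / real k)) * Z ^ u" by (simp add: power4_eq_xxxx power2_eq_square)
      also have "\<dots> \<le> \<eta> n * Z ^ u"
        by (rule mult_right_mono) (use Z0 c in \<open>auto simp: \<eta>_def\<close>)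
      finally show ?thesis .
    qed
    then show "real u * wsum n k r (animals n k u) \<le> \<eta> n * (q * real n / exp 1) ^ u" by (simp add: Z_def)
  qed
  then show ?thesis using lim \<eta>0 by blast
qed

section \<open>Asymptotics of the overlap moment\<close>

text \<open>The origin of \<open>e\<close> in \<open>p_star\<close>: \<open>(n - v)! / n!\<close> is
  at most \<open>(e / n)^v\<close>, and this is sharp up to polynomial factors for
  \<open>v = n\<close>. The induction rests on \<open>(1 + 1/n)^w \<le> e\<close> for
  \<open>w \<le> n\<close>.\<close>

lemma power_fact_le: "v \<le> n \<Longrightarrow> real n ^ v * fact (n - v) \<le> exp 1 ^ v * fact n"
proof (induction n arbitrary: v)
  case (Suc n)
  show ?case
  proof (cases v)
    case (Suc w)
    then have w: "w \<le> n" using Suc.prems by simp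
    have "real (Suc n) ^ w \<le> real n ^ w * exp 1"
    proof (cases "n = 0")
      case False
      have "real (Suc n) ^ w = real n ^ w * (1 + 1 / real n) ^ w"
        using False by (simp add: field_simps flip: power_mult_distrib)
      also have "(1 + 1 / real n) ^ w \<le> exp (1 / real n) ^ w"
        by (rule power_mono) auto
      also have "\<dots> = exp (real w / real n)" by (simp flip: exp_of_nat_mult)
      also have "\<dots> \<le> exp 1" using w False by simp
      finally show ?thesis by (simp add: mult_left_mono)
    qed (use w in simp)
    then have "real (Suc n) ^ w * fact (n - w) \<le> real n ^ w * exp 1 * fact (n - w)"
      by (rule mult_right_mono) simp
    also have "\<dots> = exp 1 * (real n ^ w * fact (n - w))" by simp
    also have "\<dots> \<le> exp 1 * (exp 1 ^ w * fact n)" by (rule mult_left_mono[OF Suc.IH[OF w]]) simp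
    finally have "real (Suc n) * (real (Suc n) ^ w * fact (n - w)) \<le> real (Suc n) * (exp 1 * (exp 1 ^ w * fact n))"
      by (rule mult_left_mono) simp
    then show ?thesis using Suc by (simp add: mult_ac)
  qed simp
qed simp

lemma fact_add_ge: "fact m * real m ^ l \<le> fact (m + l)"
proof (induction l)
  case (Suc l)
  have "fact m * real m ^ Suc l = (fact m * real m ^ l) * real m" by simp
  also have "\<dots> \<le> fact (m + l) * real (m + Suc l)" by (rule mult_mono[OF Suc]) auto
  finally show ?case by (simp add: mult_ac)
qed simp

lemma exp_le_one_minus:
  fixes x :: real assumes "0 \<le> x" "x \<le> 1/2"
  shows "exp (- 2 * x) \<le> 1 - x"
proof -
  have "x * x \<le> x * (1/2)" using assms by (intro mult_left_mono) auto
  then have "- 2 * x \<le> - x - 2 * x\<^sup>2" using assms by (simp add: power2_eq_square)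
  also have "\<dots> \<le> ln (1 - x)" by (rule ln_one_minus_pos_lower_bound) (use assms in auto)
  finally have "exp (- 2 * x) \<le> exp (ln (1 - x))" by simp
  then show ?thesis using assms by simp
qed

text \<open>Pairs of points of isolated edges lose only \<open>1 + o(1)\<close>, while a crude factor \<open>e\<close> per point
  is affordable in large components.\<close>

lemma fact_ratio_bound:
  assumes V: "v + 2 * j \<le> n" and n: "n > 0"
  shows "real n ^ (2 * j) * (real n / exp 1) ^ v * fact (n - (v + 2 * j))
    \<le> fact n * exp (4 * real j * real (v + 2 * j) / real n)"
proof (cases "2 * (v + 2 * j) \<le> n")
  case True
  define V where "V = v + 2 * j"
  define x where "x = real V / real n"
  have V2: "2 * V \<le> n" using True by (simp add: V_def)
  have "real (2 * V) \<le> real n" using V2 by (rule of_nat_mono)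
  then have x: "0 \<le> x" "x \<le> 1/2" using n by (auto simp: x_def field_simps)
  have "real n * exp (- 2 * x) \<le> real n * (1 - x)"
    by (intro mult_left_mono exp_le_one_minus x) simp
  also have "\<dots> = real (n - V)" using V2 n by (simp add: x_def field_simps of_nat_diff)
  finally have 1: "real n * exp (- 2 * x) \<le> real (n - V)" .
  have "(real n * exp (- 2 * x)) ^ (2 * j) * fact (n - V) \<le> real (n - V) ^ (2 * j) * fact (n - V)"
    by (intro mult_right_mono power_mono 1) auto
  also have "\<dots> \<le> fact (n - V + 2 * j)" using fact_add_ge[of "n - V" "2 * j"] by (simp add: mult.commute)
  also have "n - V + 2 * j = n - v" using V by (simp add: V_def)
  finally have 2: "real n ^ (2 * j) * exp (- 2 * x) ^ (2 * j) * fact (n - V) \<le> fact (n - v)"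
    by (simp add: power_mult_distrib)
  have e: "exp (- 2 * x) ^ (2 * j) * exp (4 * real j * x) = 1"
    by (simp flip: exp_of_nat_mult exp_add) 
  have "real n ^ (2 * j) * fact (n - V) = (real n ^ (2 * j) * exp (- 2 * x) ^ (2 * j) * fact (n - V)) * exp (4 * real j * x)"
    using e by (simp add: mult_ac)
  also have "\<dots> \<le> fact (n - v) * exp (4 * real j * x)" by (rule mult_right_mono[OF 2]) simp
  finally have "(real n / exp 1) ^ v * (real n ^ (2 * j) * fact (n - V)) \<le> (real n / exp 1) ^ v * (fact (n - v) * exp (4 * real j * x))"
    by (rule mult_left_mono) simp
  also have "\<dots> = (real n ^ v * fact (n - v)) / exp 1 ^ v * exp (4 * real j * x)" by (simp add: power_divide)
  also have "\<dots> \<le> fact n * exp (4 * real j * x)"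
    using power_fact_le[of v n] V by (intro mult_right_mono) (auto simp: field_simps)
  finally show ?thesis by (simp add: V_def x_def mult_ac)
next
  case False
  define V where "V = v + 2 * j"
  \<comment> \<open>More than half of the values are prescribed, so the error exponent
    \<open>4 j V / n\<close> is at least \<open>2 j\<close> and covers a crude factor
    \<open>e\<close> for each of the \<open>2 j\<close> points.\<close>
  have "real n \<le> real (2 * V)" using False by (intro of_nat_mono) (simp add: V_def)
  then have "2 * real j * real n \<le> 2 * real j * real (2 * V)" by (intro mult_left_mono) auto
  then have 1: "2 * real j \<le> 4 * real j * real V / real n" using n by (simp add: field_simps)
  have "real n ^ (2 * j) * (real n / exp 1) ^ v * fact (n - V) = (real n ^ V * fact (n - V)) / exp 1 ^ v"
    by (simp add: V_def power_add power_divide mult_ac)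
  also have "\<dots> \<le> (exp 1 ^ V * fact n) / exp 1 ^ v"
    by (rule divide_right_mono[OF power_fact_le]) (use V in \<open>auto simp: V_def\<close>)
  also have "\<dots> = fact n * exp (2 * real j)"
    by (simp add: V_def power_add flip: exp_of_nat_mult)
  also have "\<dots> \<le> fact n * exp (4 * real j * real V / real n)" using 1 by simp
  finally show ?thesis by (simp add: V_def)
qed

lemma fact_ge_power: "real j ^ j \<le> exp 1 ^ j * fact j"
  using power_fact_le[of j j] by simp

lemma sum_exp_tail_le:
  fixes x :: real
  assumes x: "0 \<le> x"
  shows "(\<Sum>j\<in>{j. j \<le> n \<and> x < real j}. exp (- real j)) \<le> 3 * exp (- x / 2)"
proof -
  have h: "exp (-1/2 :: real) \<le> 2/3"
  proof -
    have "1 + 1/2 \<le> exp (1/2 :: real)" by (rule exp_ge_add_one_self)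
    then have "inverse (exp (1/2 :: real)) \<le> inverse (3/2)" by (intro le_imp_inverse_le) auto
    then show ?thesis by (simp flip: exp_minus)
  qed
  have "(\<Sum>j\<in>{j. j \<le> n \<and> x < real j}. exp (- real j)) \<le> (\<Sum>j\<in>{j. j \<le> n \<and> x < real j}. exp (- x / 2) * exp (-1/2) ^ j)"
  proof (rule sum_mono)
    fix j assume "j \<in> {j. j \<le> n \<and> x < real j}"
    then have "- real j \<le> - x / 2 + real j * (-1/2)" by auto
    then show "exp (- real j) \<le> exp (- x / 2) * exp (-1/2) ^ j"
      by (simp flip: exp_of_nat_mult exp_add)
  qed
  also have "\<dots> \<le> (\<Sum>j<Suc n. exp (- x / 2) * exp (-1/2) ^ j)"
    by (rule sum_mono2) auto
  also have "\<dots> = exp (- x / 2) * (\<Sum>j<Suc n. exp (-1/2) ^ j)" by (simp only: sum_distrib_left)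
  also have "\<dots> \<le> exp (- x / 2) * 3"
  proof (rule mult_left_mono)
    have "(\<Sum>j<Suc n. exp (-1/2 :: real) ^ j) \<le> (\<Sum>j<Suc n. (2/3) ^ j)"
      by (intro sum_mono power_mono h) auto
    also have "\<dots> = (1 - (2/3) ^ Suc n) / (1 - 2/3)" by (subst sum_gp_strict) auto
    also have "\<dots> \<le> (3::real)" by simp
    finally show "(\<Sum>j<Suc n. exp (-1/2 :: real) ^ j) \<le> 3" .
  qed simp
  finally show ?thesis by simp
qed

lemma sum_power_fact_le_exp:
  fixes a :: real assumes "0 \<le> a" "finite J"
  shows "(\<Sum>j\<in>J. a ^ j / fact j) \<le> exp a"
proof -
  have "(\<Sum>j\<in>J. a ^ j / fact j) \<le> (\<Sum>j. a ^ j / fact j)"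
    by (rule sum_le_suminf)
       (use assms summable_exp_generic[of a] in \<open>auto simp: field_simps\<close>)
  also have "\<dots> = exp a" by (simp add: exp_def field_simps)
  finally show ?thesis .
qed

lemma sum_geometric_perturbed:
  fixes s \<eta> :: real assumes s: "0 \<le> s" "s < 1" and \<eta>: "0 \<le> \<eta>"
  shows "(\<Sum>v\<le>n. (if v = 0 then 1 else \<eta>) * s ^ v) \<le> 1 + \<eta> / (1 - s)"
proof -
  have "(\<Sum>v\<le>n. (if v = 0 then 1 else \<eta>) * s ^ v) \<le> (\<Sum>v\<le>n. (if v = 0 then 1 else 0) + \<eta> * s ^ v)"
    by (rule sum_mono) (use s \<eta> in auto)
  also have "\<dots> = 1 + \<eta> * (\<Sum>v\<le>n. s ^ v)"
    by (simp add: sum.distrib sum_distrib_left sum.delta)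
  also have "(\<Sum>v\<le>n. s ^ v) \<le> 1 / (1 - s)"
  proof -
    have "(\<Sum>v\<le>n. s ^ v) = (1 - s ^ Suc n) / (1 - s)"
      using s by (simp add: sum_gp0)
    also have "\<dots> \<le> 1 / (1 - s)" using s by (intro divide_right_mono) auto
    finally show ?thesis .
  qed
  finally show ?thesis using \<eta> by (simp add: mult_left_mono)
qed

text \<open>The sum over \<open>j\<close> is cut at \<open>J\<close>. Below the cut the error
  exponential splits into at most \<open>exp (8 J^2 / n)\<close> and a factor
  \<open>exp (4 J / n)\<close> per unit of \<open>v\<close>, absorbed by enlarging \<open>q\<close>
  to \<open>s\<close>. Above the cut it is at most \<open>exp (4 j)\<close>, and the factorial beats
  it.\<close>

lemma double_sum_bound:
  fixes a q \<eta> J s :: real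
  assumes n: "n > 0" and a: "0 \<le> a" "a * exp 6 \<le> J" and q: "0 < q" and s: "0 < s" "s < 1"
    and qs: "q * exp (4 * J / real n) \<le> s" and \<eta>: "0 \<le> \<eta>"
  shows "(\<Sum>v\<le>n. \<Sum>j\<in>{j. v + 2 * j \<le> n}. (if v = 0 then 1 else \<eta>) * q ^ v * (a ^ j / fact j) * exp (4 * real j * real (v + 2 * j) / real n))
    \<le> (1 + \<eta> / (1 - s)) * (exp (8 * J^2 / real n) + 3 * exp (- J / 2)) * exp a"
proof -
  let ?e = "\<lambda>v j. exp (4 * real j * real (v + 2 * j) / real n)" and ?f = "exp (4 * J / real n)" and ?c = "\<lambda>v. if v = 0 then 1 else \<eta>"
  have J0: "0 \<le> J" using a by (smt (verit) exp_ge_zero mult_nonneg_nonneg)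
  have "1 \<le> ?f" using J0 by simp
  then have "q * 1 \<le> q * ?f" using q by (intro mult_left_mono) auto
  then have qs0: "q \<le> s" using qs by linarith
  define E where "E = exp (8 * J^2 / real n)"
  define t where "t j = E * (a ^ j / fact j) + (if J < real j then exp (- real j) else 0)" for j
  have trm: "q ^ v * (a ^ j / fact j) * ?e v j \<le> s ^ v * t j"
    if vj: "v + 2 * j \<le> n" for v j
  proof (cases "J < real j")
    case False
    have "?e v j = exp (4 * real j / real n) ^ v * exp (8 * (real j)^2 / real n)"
      by (simp add: power2_eq_square field_simps add_divide_distrib flip: exp_of_nat_mult exp_add)
    also have "\<dots> \<le> ?f ^ v * E"
      unfolding E_def
    proof (intro mult_mono power_mono)
      show "exp (4 * real j / real n) \<le> ?f" using False n by (simp add: divide_right_mono)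
      have "(real j)^2 \<le> J^2" using False by (intro power_mono) auto
      then show "exp (8 * (real j)^2 / real n) \<le> exp (8 * J^2 / real n)" by (simp add: divide_right_mono)
    qed auto
    finally have "q ^ v * (a ^ j / fact j) * ?e v j
      \<le> q ^ v * (a ^ j / fact j) * (?f ^ v * E)"
      using q a by (intro mult_left_mono) auto
    also have "\<dots> = (q * ?f) ^ v * (E * (a ^ j / fact j))"
      by (simp add: power_mult_distrib)
    also have "\<dots> \<le> s ^ v * (E * (a ^ j / fact j))"
      using q a qs by (intro mult_right_mono power_mono) (auto simp: E_def)
    finally show ?thesis using False by (simp add: t_def)
  next
    case True
    then have j: "real j > 0" using J0 by linarith
    have "real (v + 2 * j) \<le> real n" using vj by (rule of_nat_mono)
    then have "4 * real j * real (v + 2 * j) \<le> 4 * real j * real n" by (intro mult_left_mono) auto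
    then have "4 * real j * real (v + 2 * j) / real n \<le> 4 * real j"
      using n by (simp only: pos_divide_le_eq of_nat_0_less_iff)
    then have "?e v j \<le> exp 4 ^ j"
      by (simp flip: exp_of_nat_mult)
    then have "q ^ v * (a ^ j / fact j) * ?e v j \<le> q ^ v * (a ^ j / fact j) * exp 4 ^ j"
      using q a by (intro mult_left_mono) auto
    also have "\<dots> = q ^ v * ((a * exp 4) ^ j / fact j)" by (simp add: power_mult_distrib)
    also have "\<dots> \<le> q ^ v * exp (- real j)"
    proof (rule mult_left_mono)
      \<comment> \<open>Of \<open>exp 6\<close>, the part \<open>exp 4\<close> is the error per unit
        of \<open>j\<close>, one \<open>e\<close> is lost in \<open>j^j \<le> e^j j!\<close>, and
        one \<open>e\<close> remains as decay.\<close>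
      have "a * exp 6 \<le> real j" using a True by linarith
      moreover have "exp (6::real) = exp 4 * exp 2" by (simp flip: exp_add)
      ultimately have "a * exp 4 * exp 2 \<le> real j" by (simp add: mult.assoc)
      then have "(a * exp 4 * exp 2) ^ j \<le> real j ^ j" using a by (intro power_mono) auto
      also have "\<dots> \<le> exp 1 ^ j * fact j" by (rule fact_ge_power)
      finally have "(a * exp 4) ^ j * exp 2 ^ j \<le> exp 1 ^ j * fact j" by (simp add: power_mult_distrib)
      moreover have "exp (2::real) = exp 1 * exp 1" by (simp flip: exp_add)
      ultimately have "(a * exp 4) ^ j * exp 1 ^ j * exp 1 ^ j \<le> fact j * exp 1 ^ j"
        by (simp add: power_mult_distrib mult_ac)
      then have "(a * exp 4) ^ j * exp 1 ^ j \<le> fact j" by (rule mult_right_le_imp_le) simp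
      then have "(a * exp 4) ^ j / fact j \<le> 1 / exp 1 ^ j" by (simp add: field_simps)
      then show "(a * exp 4) ^ j / fact j \<le> exp (- real j)"
        by (simp add: exp_minus inverse_eq_divide flip: exp_of_nat_mult)
    qed (use q in simp)
    also have "\<dots> \<le> s ^ v * t j"
      using q a qs0 by (intro mult_mono power_mono) (auto simp: t_def True E_def)
    finally show ?thesis .
  qed
  have t0: "0 \<le> t j" for j using a by (simp add: t_def E_def)
  have tsum: "(\<Sum>j\<le>n. t j) \<le> (E + 3 * exp (- J / 2)) * exp a"
  proof -
    have "(\<Sum>j\<le>n. t j) = E * (\<Sum>j\<le>n. a ^ j / fact j) + (\<Sum>j\<in>{j. j \<le> n \<and> J < real j}. exp (- real j))"
    proof -
      have "(\<Sum>j\<le>n. if J < real j then exp (- real j) else 0) = (\<Sum>j\<in>{j. j \<le> n \<and> J < real j}. exp (- real j))"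
        by (subst sum.inter_filter[symmetric]) (auto intro: sum.cong)
      then show ?thesis by (simp add: t_def sum.distrib sum_distrib_left)
    qed
    also have "\<dots> \<le> E * exp a + 3 * exp (- J / 2)"
      by (intro add_mono mult_left_mono sum_power_fact_le_exp sum_exp_tail_le) (use a J0 in \<open>auto simp: E_def\<close>)
    also have "3 * exp (- J / 2) \<le> 3 * exp (- J / 2) * exp a" using a by simp
    finally show ?thesis by (simp add: algebra_simps)
  qed
  have "(\<Sum>v\<le>n. \<Sum>j\<in>{j. v + 2 * j \<le> n}. ?c v * q ^ v * (a ^ j / fact j) * ?e v j)
    \<le> (\<Sum>v\<le>n. ?c v * s ^ v * (\<Sum>j\<le>n. t j))"
  proof (rule sum_mono)
    fix v
    have "(\<Sum>j\<in>{j. v + 2 * j \<le> n}. ?c v * q ^ v * (a ^ j / fact j) * ?e v j)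
      \<le> (\<Sum>j\<in>{j. v + 2 * j \<le> n}. ?c v * (s ^ v * t j))"
      unfolding mult.assoc[of "?c _"]
      by (intro sum_mono mult_left_mono trm) (use \<eta> in auto)
    also have "\<dots> \<le> (\<Sum>j\<le>n. ?c v * (s ^ v * t j))"
      by (rule sum_mono2) (use \<eta> s t0 in auto)
    finally show "(\<Sum>j\<in>{j. v + 2 * j \<le> n}. ?c v * q ^ v * (a ^ j / fact j) * ?e v j)
      \<le> ?c v * s ^ v * (\<Sum>j\<le>n. t j)"
      by (simp add: sum_distrib_left mult.assoc)
  qed
  also have "\<dots> = (\<Sum>v\<le>n. ?c v * s ^ v) * (\<Sum>j\<le>n. t j)" by (simp only: sum_distrib_right)
  also have "\<dots> \<le> (1 + \<eta> / (1 - s)) * ((E + 3 * exp (- J / 2)) * exp a)"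
  proof (intro mult_mono sum_geometric_perturbed tsum)
    show "0 \<le> 1 + \<eta> / (1 - s)" using \<eta> s by simp
    show "0 \<le> (\<Sum>j\<le>n. t j)" by (intro sum_nonneg t0)
  qed (use s \<eta> in auto)
  finally show ?thesis by (simp add: E_def mult_ac)
qed

lemma permutation_moment:
  assumes k: "k \<ge> 4" and q: "0 < q" "q < (1::real)"
  shows "\<exists>\<Theta>. \<Theta> \<longlonglongrightarrow> 1 \<and> (\<forall>\<^sub>F n in sequentially. \<forall>r.
      1 \<le> r \<longrightarrow> r ^ k \<le> q ^ 3 * real n / exp 1 \<longrightarrow>
      (\<Sum>\<pi>\<in>perms n. r ^ card (edges n k (graph_of n \<pi>)))
        \<le> fact n * \<Theta> n * exp (2 * real k ^ 2 * (r - 1)))"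
proof -
  obtain \<eta> where \<eta>: "\<eta> \<longlonglongrightarrow> 0" "\<And>n. 0 \<le> \<eta> n"
    "\<forall>\<^sub>F n in sequentially. \<forall>r u. 1 \<le> r \<longrightarrow> r ^ k \<le> q ^ 3 * real n / exp 1 \<longrightarrow> 3 \<le> u \<longrightarrow> u \<le> n \<longrightarrow>
      real u * wsum n k r (animals n k u) \<le> \<eta> n * (q * real n / exp 1) ^ u"
    using animal_weights_vanish[OF k q] by blast
  define K where "K = 2 * real k ^ 2 * exp 6"
  have K: "K > 0" using k by (simp add: K_def)
  \<comment> \<open>Since \<open>r^k \<le> n\<close>, this dominates \<open>a * exp 6\<close> for
    \<open>a = 2 k^2 (r - 1)\<close>. At the same time \<open>(J n)^2 / n\<close> has to vanish,
    which it does for \<open>k > 2\<close>.\<close>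
  define J where "J n = K * real n powr (1 / real k)" for n :: nat
  define s where "s = sqrt q"
  have s: "0 < s" "s < 1" "q < s" using q by (auto simp: s_def real_less_rsqrt power2_eq_square)
  define \<Theta> where "\<Theta> n = (1 + \<eta> n / (1 - s)) * (exp (8 * (J n)^2 / real n) + 3 * exp (- J n / 2))" for n
  have kk: "real k \<ge> 4" using k by simp
  define d where "d = 1 / real k"
  have d: "0 < d" "d \<le> 1/4" using kk by (auto simp: d_def field_simps)
  then have d2: "1 - 2 * d > 0" "1 - d > 0" by linarith+
  have J2: "(\<lambda>n. 8 * (J n)^2 / real n) \<longlonglongrightarrow> 0"
    unfolding J_def d_def[symmetric] using d d2 K by real_asymp
  have J1: "(\<lambda>n. 4 * J n / real n) \<longlonglongrightarrow> 0"
    unfolding J_def d_def[symmetric] using d d2 K by real_asymp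
  have Jinf: "(\<lambda>n. exp (- J n / 2)) \<longlonglongrightarrow> 0"
    unfolding J_def d_def[symmetric] using d K by real_asymp
  have "\<Theta> \<longlonglongrightarrow> (1 + 0 / (1 - s)) * (exp 0 + 3 * 0)"
    unfolding \<Theta>_def by (intro tendsto_intros \<eta>(1) J2 Jinf) (use s in auto)
  then have lim: "\<Theta> \<longlonglongrightarrow> 1" by simp
  have "(\<lambda>n. q * exp (4 * J n / real n)) \<longlonglongrightarrow> q * exp 0" by (intro tendsto_intros J1)
  then have ev1: "\<forall>\<^sub>F n in sequentially. q * exp (4 * J n / real n) < s"
    by (rule order_tendstoD) (use s in simp)
  have ev2: "\<forall>\<^sub>F n in sequentially. \<eta> n < 1" by (rule order_tendstoD[OF \<eta>(1)]) simp
  have ev3: "\<forall>\<^sub>F n in sequentially. n > 3 * k" by (rule eventually_gt_at_top)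
  have "\<forall>\<^sub>F n in sequentially. \<forall>r. 1 \<le> r \<longrightarrow> r ^ k \<le> q ^ 3 * real n / exp 1 \<longrightarrow>
      (\<Sum>\<pi>\<in>perms n. r ^ card (edges n k (graph_of n \<pi>)))
        \<le> fact n * \<Theta> n * exp (2 * real k ^ 2 * (r - 1))"
    using ev1 ev2 ev3 \<eta>(3)
  proof (eventually_elim, intro allI impI)
    fix n :: nat and r :: real
    assume e1: "q * exp (4 * J n / real n) < s" and e2: "\<eta> n < 1" and n: "n > 3 * k"
      and A: "\<forall>r u. 1 \<le> r \<longrightarrow> r ^ k \<le> q ^ 3 * real n / exp 1 \<longrightarrow> 3 \<le> u \<longrightarrow> u \<le> n \<longrightarrow>
        real u * wsum n k r (animals n k u) \<le> \<eta> n * (q * real n / exp 1) ^ u"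
      and r: "1 \<le> r" "r ^ k \<le> q ^ 3 * real n / exp 1"
    have n0: "n > 0" using n by simp
    define a where "a = 2 * real k ^ 2 * (r - 1)"
    define X where "X = q * real n / exp 1"
    have X0: "0 \<le> X" using q by (simp add: X_def)
    have a0: "0 \<le> a" using r by (simp add: a_def)
    have aJ: "a * exp 6 \<le> J n"
    proof -
      have "q ^ 3 * real n / exp 1 \<le> real n"
      proof -
        have "q ^ 3 * real n \<le> 1 * real n" by (rule mult_right_mono) (use q in \<open>auto simp: power_le_one\<close>)
        also have "\<dots> \<le> exp 1 * real n" by (intro mult_right_mono) auto
        finally show ?thesis by (simp add: field_simps)
      qed
      then have rn: "r ^ k \<le> real n" using r(2) by linarith
      have "r = (r ^ k) powr (1 / real k)"
        using r(1) k by (simp add: powr_powr flip: powr_realpow)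
      also have "\<dots> \<le> real n powr (1 / real k)" using rn r(1) by (intro powr_mono2) auto
      finally have "r - 1 \<le> real n powr (1 / real k)" by simp
      then have "a \<le> 2 * real k ^ 2 * real n powr (1 / real k)"
        unfolding a_def by (intro mult_left_mono) auto
      then have "a * exp 6 \<le> 2 * real k ^ 2 * real n powr (1 / real k) * exp 6" by (rule mult_right_mono) simp
      then show ?thesis by (simp add: J_def K_def mult_ac)
    qed
    have B: "wsum n k r (big_comps n k v) \<le> (if v = 0 then 1 else \<eta> n) * X ^ v" if v: "v \<le> n" for v
    proof (cases "v = 0")
      case False
      then show ?thesis
        using big_comps_weight[OF r(1) \<eta>(2) _ X0, of n n k v] e2 A r v by (simp add: X_def)
    qed (simp add: big_comps_0)
    let ?e = "\<lambda>v j. exp (4 * real j * real (v + 2 * j) / real n)" and ?c = "\<lambda>v. if v = 0 then 1 else \<eta> n"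
      and ?w = "\<lambda>v j. (2 * real k ^ 2 * real n ^ 2) ^ j / fact j * ((r - 1) ^ j * fact (n - (v + 2 * j)))"
      and ?J = "\<lambda>v. {j. v + 2 * j \<le> n}"
    have "(\<Sum>\<pi>\<in>perms n. r ^ card (edges n k (graph_of n \<pi>)))
      \<le> (\<Sum>v\<le>n. wsum n k r (big_comps n k v) *
        (\<Sum>j\<in>?J v. ?w v j))"
      using sum_permutations_le[OF n r(1)] by (simp add: wsum_def)
    also have "\<dots> \<le> (\<Sum>v\<le>n. \<Sum>j\<in>?J v. fact n * (?c v * q ^ v * (a ^ j / fact j) * ?e v j))"
    proof (rule sum_mono)
      fix v assume v: "v \<in> {..n}"
      define c where "c = (if v = 0 then 1 else \<eta> n)"
      have c0: "0 \<le> c" using \<eta>(2) by (simp add: c_def)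
      have "wsum n k r (big_comps n k v) * (\<Sum>j\<in>?J v. ?w v j)
        \<le> (c * X ^ v) * (\<Sum>j\<in>?J v. ?w v j)"
        using B[of v] v r by (intro mult_right_mono sum_nonneg) (auto simp: c_def)
      also have "\<dots> = (\<Sum>j\<in>?J v. (c * q ^ v * (a ^ j / fact j)) * (real n ^ (2 * j) * (real n / exp 1) ^ v * fact (n - (v + 2 * j))))"
        unfolding sum_distrib_left
        by (rule sum.cong[OF refl])
           (simp add: X_def a_def power_mult_distrib power_divide mult_ac flip: power_mult)
      also have "\<dots> \<le> (\<Sum>j\<in>?J v. (c * q ^ v * (a ^ j / fact j)) * (fact n * ?e v j))"
        by (intro sum_mono mult_left_mono fact_ratio_bound) (use c0 q a0 n0 in auto)
      finally show "wsum n k r (big_comps n k v) * (\<Sum>j\<in>?J v. ?w v j)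
        \<le> (\<Sum>j\<in>?J v. fact n * (?c v * q ^ v * (a ^ j / fact j) * ?e v j))"
        by (simp only: c_def mult_ac)
    qed
    also have "\<dots> = fact n * (\<Sum>v\<le>n. \<Sum>j\<in>?J v. ?c v * q ^ v * (a ^ j / fact j) * ?e v j)"
      by (simp only: sum_distrib_left)
    also have "\<dots> \<le> fact n * ((1 + \<eta> n / (1 - s)) * (exp (8 * (J n)^2 / real n) + 3 * exp (- J n / 2)) * exp a)"
      by (intro mult_left_mono double_sum_bound n0 a0 aJ q s \<eta>(2)) (use e1 in auto)
    finally show "(\<Sum>\<pi>\<in>perms n. r ^ card (edges n k (graph_of n \<pi>)))
        \<le> fact n * \<Theta> n * exp (2 * real k ^ 2 * (r - 1))"
      by (simp add: \<Theta>_def a_def mult.assoc)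
  qed
  then show ?thesis using lim by blast
qed

section \<open>Second moment for uniform subsets\<close>

text \<open>The \<open>g\<close> of the overview: the probability that \<open>a\<close> given
  elements of an \<open>N\<close>-set belong to a uniform \<open>M\<close>-subset. Real arguments
  avoid truncated subtraction in the estimates.\<close>

definition falling_ratio :: "real \<Rightarrow> real \<Rightarrow> nat \<Rightarrow> real" where
  "falling_ratio M N a = (\<Prod>i<a. (M - real i) / (N - real i))"

lemma card_supersets:
  assumes P: "finite P" and A: "A \<subseteq> P" "card A \<le> M"
  shows "card {E. E \<subseteq> P \<and> card E = M \<and> A \<subseteq> E} = (card P - card A) choose (M - card A)"
proof -
  have finA: "finite A" by (rule finite_subset[OF A(1) P])
  have "card {E. E \<subseteq> P \<and> card E = M \<and> A \<subseteq> E} = card {F. F \<subseteq> P - A \<and> card F = M - card A}"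
  proof (rule bij_betw_same_card[of "\<lambda>E. E - A"], rule bij_betw_byWitness[where f' = "\<lambda>F. F \<union> A"])
    show "\<forall>E\<in>{E. E \<subseteq> P \<and> card E = M \<and> A \<subseteq> E}. E - A \<union> A = E" by blast
    show "\<forall>F\<in>{F. F \<subseteq> P - A \<and> card F = M - card A}. F \<union> A - A = F" by blast
    show "(\<lambda>E. E - A) ` {E. E \<subseteq> P \<and> card E = M \<and> A \<subseteq> E} \<subseteq> {F. F \<subseteq> P - A \<and> card F = M - card A}"
      using finA by (auto simp: card_Diff_subset)
    show "(\<lambda>F. F \<union> A) ` {F. F \<subseteq> P - A \<and> card F = M - card A} \<subseteq> {E. E \<subseteq> P \<and> card E = M \<and> A \<subseteq> E}"
    proof (rule image_subsetI)
      fix F assume "F \<in> {F. F \<subseteq> P - A \<and> card F = M - card A}"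
      then have F: "F \<subseteq> P - A" "card F = M - card A" by simp_all
      have "finite F" by (rule finite_subset[OF F(1)]) (use P in simp)
      then have "card (F \<union> A) = card F + card A" using F finA by (intro card_Un_disjoint) auto
      then show "F \<union> A \<in> {E. E \<subseteq> P \<and> card E = M \<and> A \<subseteq> E}" using F A by auto
    qed
  qed
  also have "\<dots> = card (P - A) choose (M - card A)" by (rule n_subsets) (use P in simp)
  also have "card (P - A) = card P - card A" by (rule card_Diff_subset[OF finA A(1)])
  finally show ?thesis .
qed

lemma binomial_falling_ratio:
  assumes "a \<le> M" "M \<le> N"
  shows "real ((N - a) choose (M - a)) = real (N choose M) * falling_ratio (real M) (real N) a"
  using assms(1)
proof (induction a)
  case (Suc a)
  have le: "Suc a \<le> M" "M \<le> N" using Suc.prems assms(2) by auto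
  have S: "Suc (M - Suc a) = M - a" "Suc (N - Suc a) = N - a" using le by auto
  have "Suc (M - Suc a) * (Suc (N - Suc a) choose Suc (M - Suc a)) = Suc (N - Suc a) * ((N - Suc a) choose (M - Suc a))"
    by (rule Suc_times_binomial)
  then have "(M - a) * ((N - a) choose (M - a)) = (N - a) * ((N - Suc a) choose (M - Suc a))"
    unfolding S .
  then have "real (M - a) * real ((N - a) choose (M - a)) = real (N - a) * real ((N - Suc a) choose (M - Suc a))"
    unfolding of_nat_mult[symmetric] by (rule arg_cong)
  moreover have "real (N - a) \<noteq> 0" using le by simp
  moreover have "z = c / b * x" if "c * x = b * z" "b \<noteq> 0" for b c x z :: real
    using that by (simp add: field_simps)
  ultimately have "real ((N - Suc a) choose (M - Suc a)) = real (M - a) / real (N - a) * real ((N - a) choose (M - a))"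
    by blast
  also have "real ((N - a) choose (M - a)) = real (N choose M) * falling_ratio (real M) (real N) a"
    by (rule Suc.IH) (use le in simp)
  also have "real (M - a) / real (N - a) = (real M - real a) / (real N - real a)"
    using le by (simp only: of_nat_diff)
  also have "(real M - real a) / (real N - real a) * (real (N choose M) * falling_ratio (real M) (real N) a)
      = real (N choose M) * falling_ratio (real M) (real N) (Suc a)"
    by (simp add: falling_ratio_def)
  finally show ?case .
qed (simp add: falling_ratio_def)

text \<open>Cauchy-Schwarz for the number \<open>X\<close> of contained sets \<open>h i\<close>,
  restricted to those \<open>E\<close> with \<open>X E\<close> positive. Expectations are written as
  sums over all \<open>M\<close>-subsets.\<close>

lemma second_moment_count:
  fixes h :: "'i \<Rightarrow> 'e set"
  assumes fin: "finite P" "finite I" and M: "M \<le> card P" "2 * m \<le> M"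
    and h: "\<And>i. i \<in> I \<Longrightarrow> h i \<subseteq> P" "\<And>i. i \<in> I \<Longrightarrow> card (h i) = m"
    and pos: "0 < (\<Sum>i\<in>I. \<Sum>j\<in>I. falling_ratio (real M) (real (card P)) (2 * m - card (h i \<inter> h j)))"
  shows "(real (card I) * falling_ratio (real M) (real (card P)) m)^2
      / (\<Sum>i\<in>I. \<Sum>j\<in>I. falling_ratio (real M) (real (card P)) (2 * m - card (h i \<inter> h j)))
    \<le> real (card {E. E \<subseteq> P \<and> card E = M \<and> (\<exists>i\<in>I. h i \<subseteq> E)}) / real (card P choose M)"
proof -
  define g where "g = falling_ratio (real M) (real (card P))"
  define C where "C = real (card P choose M)"
  define \<Omega> where "\<Omega> = {E. E \<subseteq> P \<and> card E = M}"
  define \<Omega>1 where "\<Omega>1 = {E \<in> \<Omega>. \<exists>i\<in>I. h i \<subseteq> E}"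
  define X where "X E = real (card {i\<in>I. h i \<subseteq> E})" for E
  have C: "C > 0" using M(1) by (simp add: C_def)
  have fin\<Omega>: "finite \<Omega>" by (rule finite_subset[of _ "Pow P"]) (use fin in \<open>auto simp: \<Omega>_def\<close>)
  have fin\<Omega>1: "finite \<Omega>1" using fin\<Omega> by (simp add: \<Omega>1_def)
  have sup: "real (card {E \<in> \<Omega>. A \<subseteq> E}) = C * g (card A)" if "A \<subseteq> P" "card A \<le> M" for A
    using card_supersets[OF fin(1) that] binomial_falling_ratio[OF that(2) M(1)]
    by (simp add: \<Omega>_def C_def g_def conj_assoc)
  have Xi: "X E = (\<Sum>i\<in>I. if h i \<subseteq> E then 1 else 0)" for E
    using fin(2) by (simp add: X_def sum.If_cases Int_def)
  have ind: "(\<Sum>E\<in>\<Omega>. if A \<subseteq> E then 1 else 0) = real (card {E \<in> \<Omega>. A \<subseteq> E})" for A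
    using fin\<Omega> by (simp add: sum.If_cases Int_def)
  have S1: "(\<Sum>E\<in>\<Omega>. X E) = real (card I) * (C * g m)"
  proof -
    have "(\<Sum>E\<in>\<Omega>. X E) = (\<Sum>i\<in>I. \<Sum>E\<in>\<Omega>. if h i \<subseteq> E then 1 else 0)"
      unfolding Xi by (rule sum.swap)
    also have "\<dots> = (\<Sum>i\<in>I. C * g m)"
      by (rule sum.cong[OF refl]) (use ind sup h M(2) in simp)
    finally show ?thesis by simp
  qed
  have S2: "(\<Sum>E\<in>\<Omega>. (X E)^2) = C * (\<Sum>i\<in>I. \<Sum>j\<in>I. g (2 * m - card (h i \<inter> h j)))"
  proof -
    have "(\<Sum>E\<in>\<Omega>. (X E)^2) = (\<Sum>E\<in>\<Omega>. \<Sum>i\<in>I. \<Sum>j\<in>I. if h i \<union> h j \<subseteq> E then 1 else 0)"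
      unfolding Xi power2_eq_square sum_product by (intro sum.cong refl) auto
    also have "\<dots> = (\<Sum>i\<in>I. \<Sum>E\<in>\<Omega>. \<Sum>j\<in>I. if h i \<union> h j \<subseteq> E then 1 else 0)" by (rule sum.swap)
    also have "\<dots> = (\<Sum>i\<in>I. \<Sum>j\<in>I. \<Sum>E\<in>\<Omega>. if h i \<union> h j \<subseteq> E then 1 else 0)"
      by (rule sum.cong[OF refl], rule sum.swap)
    also have "\<dots> = (\<Sum>i\<in>I. \<Sum>j\<in>I. C * g (2 * m - card (h i \<inter> h j)))"
    proof (intro sum.cong refl)
      fix i j assume ij: "i \<in> I" "j \<in> I"
      have f: "finite (h i)" "finite (h j)"
        by (rule finite_subset[OF h(1)[OF ij(1)] fin(1)], rule finite_subset[OF h(1)[OF ij(2)] fin(1)])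
      have "card (h i) + card (h j) = card (h i \<union> h j) + card (h i \<inter> h j)" by (rule card_Un_Int[OF f])
      then have c: "card (h i \<union> h j) = 2 * m - card (h i \<inter> h j)" using h(2) ij by simp
      have "real (card {E \<in> \<Omega>. h i \<union> h j \<subseteq> E}) = C * g (card (h i \<union> h j))"
        by (rule sup) (use h(1) ij c M(2) in auto)
      then show "(\<Sum>E\<in>\<Omega>. if h i \<union> h j \<subseteq> E then 1 else 0) = C * g (2 * m - card (h i \<inter> h j))"
        unfolding ind c .
    qed
    finally show ?thesis by (simp add: sum_distrib_left)
  qed
  have "(\<Sum>E\<in>\<Omega>. X E) = (\<Sum>E\<in>\<Omega>1. X E * 1)"
    unfolding mult_1_right
  proof (rule sum.mono_neutral_right[OF fin\<Omega>])
    show "\<forall>E\<in>\<Omega> - \<Omega>1. X E = 0"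
    proof
      fix E assume "E \<in> \<Omega> - \<Omega>1"
      then have "{i\<in>I. h i \<subseteq> E} = {}" by (auto simp: \<Omega>1_def)
      then show "X E = 0" by (simp only: X_def card.empty of_nat_0)
    qed
  qed (auto simp: \<Omega>1_def)
  then have "(\<Sum>E\<in>\<Omega>. X E)^2 = (\<Sum>E\<in>\<Omega>1. X E * 1)^2" by simp
  also have "\<dots> \<le> (\<Sum>E\<in>\<Omega>1. (X E)^2) * (\<Sum>E\<in>\<Omega>1. 1^2)" by (rule Cauchy_Schwarz_ineq_sum)
  also have "\<dots> \<le> (\<Sum>E\<in>\<Omega>. (X E)^2) * real (card \<Omega>1)"
    by (simp, intro mult_right_mono sum_mono2 fin\<Omega>) (auto simp: \<Omega>1_def)
  finally have "(real (card I) * (C * g m))^2 \<le> (C * (\<Sum>i\<in>I. \<Sum>j\<in>I. g (2 * m - card (h i \<inter> h j)))) * real (card \<Omega>1)"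
    unfolding S1 S2 .
  then have "C * (C * (real (card I) * g m)^2) \<le> C * ((\<Sum>i\<in>I. \<Sum>j\<in>I. g (2 * m - card (h i \<inter> h j))) * real (card \<Omega>1))"
    by (simp add: power_mult_distrib power2_eq_square mult_ac)
  then have "C * (real (card I) * g m)^2 \<le> (\<Sum>i\<in>I. \<Sum>j\<in>I. g (2 * m - card (h i \<inter> h j))) * real (card \<Omega>1)"
    using C by simp
  then have "(real (card I) * g m)^2 / (\<Sum>i\<in>I. \<Sum>j\<in>I. g (2 * m - card (h i \<inter> h j))) \<le> real (card \<Omega>1) / C"
    using C pos by (simp add: g_def field_simps)
  moreover have "\<Omega>1 = {E. E \<subseteq> P \<and> card E = M \<and> (\<exists>i\<in>I. h i \<subseteq> E)}" by (auto simp: \<Omega>1_def \<Omega>_def)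
  ultimately show ?thesis by (simp add: g_def C_def)
qed

lemma falling_ratio_add: "falling_ratio M N (a + b) = falling_ratio M N a * (\<Prod>i<b. (M - real (a + i)) / (N - real (a + i)))"
  by (induction b) (simp_all add: falling_ratio_def)

lemma falling_ratio_pos: "M \<le> N \<Longrightarrow> real a \<le> M \<Longrightarrow> 0 < falling_ratio M N a"
  unfolding falling_ratio_def by (rule prod_pos) auto

text \<open>Since \<open>(M - x) / (N - x)\<close> decreases in \<open>x\<close>, each of the
  \<open>s\<close> omitted factors, all of index below \<open>2 m\<close>, is at least
  \<open>(M - 2 m) / (N - 2 m)\<close>.\<close>

lemma falling_ratio_drop:
  assumes M: "M \<le> N" "2 * real m < M"
  shows "s \<le> 2 * m \<Longrightarrow> falling_ratio M N (2 * m - s) \<le> falling_ratio M N (2 * m) * ((N - 2 * real m) / (M - 2 * real m)) ^ s"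
proof (induction s)
  case (Suc s)
  define r where "r = (N - 2 * real m) / (M - 2 * real m)"
  define a where "a = 2 * m - Suc s"
  have a: "Suc a = 2 * m - s" "a < 2 * m" using Suc.prems by (auto simp: a_def)
  have ar: "real a < 2 * real m" using a(2) by linarith
  have "1 \<le> (M - real a) / (N - real a) * r"
  proof -
    have "(N - real a) * (M - 2 * real m) \<le> (M - real a) * (N - 2 * real m)"
    proof -
      have "0 \<le> (N - M) * (2 * real m - real a)" using M ar by (intro mult_nonneg_nonneg) auto
      then show ?thesis by (simp add: algebra_simps)
    qed
    then show ?thesis using M ar by (simp add: r_def divide_simps)
  qed
  then have "falling_ratio M N a * 1 \<le> falling_ratio M N a * ((M - real a) / (N - real a) * r)"
    by (rule mult_left_mono) (use falling_ratio_pos[of M N a] M ar in simp)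
  also have "\<dots> = falling_ratio M N (Suc a) * r" by (simp add: falling_ratio_def)
  also have "\<dots> \<le> (falling_ratio M N (2 * m) * r ^ s) * r"
    unfolding a(1) by (rule mult_right_mono) (use Suc M in \<open>auto simp: r_def\<close>)
  finally show ?case by (simp add: a_def r_def mult_ac)
qed simp

text \<open>The factor of index \<open>m + i\<close> is compared with that of index
  \<open>i\<close>: their quotient is \<open>(1 - x) / (1 - y)\<close> with
  \<open>x = m / (M - i)\<close> and \<open>y = m / (N - i)\<close>, which is at most
  \<open>exp (- x + y + 2 y^2)\<close>, and \<open>d\<close> bounds these exponents for all
  \<open>i\<close>.\<close>

lemma falling_ratio_double:
  assumes M: "M \<le> N" "2 * real m < M" and N: "3 * real m \<le> N"
  shows "falling_ratio M N (2 * m) \<le> (falling_ratio M N m)^2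
    * exp (- ((real m)^2) / M + (real m)^2 / (N - real m) + 2 * real m ^ 3 / (N - real m)^2)"
proof -
  define d where "d = - real m / M + real m / (N - real m) + 2 * (real m / (N - real m))^2"
  have split: "falling_ratio M N (2 * m) = falling_ratio M N m * (\<Prod>i<m. (M - real (m + i)) / (N - real (m + i)))"
    using falling_ratio_add[of M N m m] by (simp add: mult_2)
  have "(\<Prod>i<m. (M - real (m + i)) / (N - real (m + i))) \<le> (\<Prod>i<m. (M - real i) / (N - real i) * exp d)"
  proof (rule prod_mono, intro conjI)
    fix i assume "i \<in> {..<m}"
    then have i: "real i \<le> real m" by simp
    have pos: "0 < M - real m - real i" "0 < N - real m - real i" "0 < M - real i" "0 < N - real i" "0 < N - real m" "0 < M"
      using i M by auto
    show "0 \<le> (M - real (m + i)) / (N - real (m + i))" using pos by simp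
    define x where "x = real m / (M - real i)"
    define y where "y = real m / (N - real i)"
    have y: "0 \<le> y" "y \<le> 1/2" using pos i N by (auto simp: y_def divide_simps)
    have "- y - 2 * y\<^sup>2 \<le> ln (1 - y)" by (rule ln_one_minus_pos_lower_bound[OF y])
    then have "exp (- y - 2 * y\<^sup>2) \<le> exp (ln (1 - y))" by (rule exp_le_cancel_iff[THEN iffD2])
    then have ey: "exp (- y - 2 * y\<^sup>2) \<le> 1 - y" using y by simp
    have ex: "1 - x \<le> exp (- x)" using exp_ge_add_one_self[of "- x"] by simp
    have "- x + y + 2 * y\<^sup>2 \<le> d"
    proof -
      have "real m / M \<le> x" unfolding x_def using pos by (intro divide_left_mono) auto
      moreover have yy: "y \<le> real m / (N - real m)" unfolding y_def using pos i by (intro divide_left_mono) auto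
      moreover have "y\<^sup>2 \<le> (real m / (N - real m))\<^sup>2" using y yy by (intro power_mono) auto
      ultimately show ?thesis by (simp add: d_def)
    qed
    then have "exp (- x) \<le> exp d * exp (- y - 2 * y\<^sup>2)" by (simp flip: exp_add)
    also have "\<dots> \<le> exp d * (1 - y)" by (rule mult_left_mono[OF ey]) simp
    finally have xy: "1 - x \<le> exp d * (1 - y)" using ex by linarith
    have "M - real (m + i) = (M - real i) * (1 - x)" using pos by (simp add: x_def field_simps)
    also have "\<dots> \<le> (M - real i) * (exp d * (1 - y))" using pos by (intro mult_left_mono xy) simp
    finally have "M - real (m + i) \<le> (M - real i) * (exp d * (1 - y))" .
    then have "(M - real (m + i)) / (N - real (m + i)) \<le> (M - real i) * (exp d * (1 - y)) / (N - real (m + i))"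
      using pos by (intro divide_right_mono) auto
    also have "\<dots> = (M - real i) / (N - real i) * exp d"
    proof -
      have e: "N - real (m + i) = (N - real i) * (1 - y)" using pos by (simp add: y_def field_simps)
      show ?thesis unfolding e using y by simp
    qed
    finally show "(M - real (m + i)) / (N - real (m + i)) \<le> (M - real i) / (N - real i) * exp d" .
  qed
  also have "\<dots> = falling_ratio M N m * exp (real m * d)"
    by (simp only: falling_ratio_def prod.distrib prod_constant card_lessThan exp_of_nat_mult)
  also have "real m * d = - ((real m)^2) / M + (real m)^2 / (N - real m) + 2 * real m ^ 3 / (N - real m)^2"
    by (simp add: d_def power2_eq_square power3_eq_cube algebra_simps power_divide)
  finally show ?thesis
    unfolding split power2_eq_square[of "falling_ratio M N m"] mult.assoc
    by (rule mult_left_mono) (use falling_ratio_pos[of M N m] M in simp)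
qed

section \<open>Copies of the power of the cycle\<close>

definition cycle_power :: "nat \<Rightarrow> nat \<Rightarrow> int set set" where
  "cycle_power n k = {{x, y} | x y. x \<in> verts n \<and> y \<in> verts n \<and> cadj n k x y}"

text \<open>The shift leads back to the vertices \<open>1..n\<close>. A copy is counted once per
  automorphism of \<open>H\<close>, a constant factor that cancels in the second moment
  quotient.\<close>

definition copy_edges :: "nat \<Rightarrow> nat \<Rightarrow> (int \<Rightarrow> int) \<Rightarrow> nat set set" where
  "copy_edges n k \<pi> = (`) (\<lambda>x. nat (\<pi> x) + 1) ` cycle_power n k"

text \<open>Going \<open>i\<close> steps ahead from every vertex, an edge could be reached from both
  ends only if \<open>n\<close> divided some \<open>i + j \<le> 2 k\<close>.\<close>

lemma card_cycle_power:
  assumes n: "n > 2 * k"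
  shows "card (cycle_power n k) = k * n"
proof -
  define f where "f = (\<lambda>(x, i). {x, (x + i) mod int n})"
  have dvd0: "a = b" if "int n dvd a - b" "\<bar>a - b\<bar> < int n" for a b
    using that zdvd_imp_le[of "int n" "\<bar>a - b\<bar>"] by fastforce
  have "inj_on f (verts n \<times> {1..int k})"
  proof (rule inj_onI)
    fix p q assume p: "p \<in> verts n \<times> {1..int k}" and q: "q \<in> verts n \<times> {1..int k}" and eq: "f p = f q"
    obtain x i y j where e: "p = (x, i)" "q = (y, j)" by (cases p, cases q)
    have b: "0 \<le> x" "x < int n" "0 \<le> y" "y < int n" "1 \<le> i" "i \<le> int k" "1 \<le> j" "j \<le> int k"
      using p q by (auto simp: e verts_def)
    have "{x, (x + i) mod int n} = {y, (y + j) mod int n}" using eq by (simp add: e f_def)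
    then consider "x = y" "(x + i) mod int n = (y + j) mod int n" | "x = (y + j) mod int n" "(x + i) mod int n = y"
      by (auto simp: doubleton_eq_iff)
    then show "p = q"
    proof cases
      case 1
      then have "int n dvd (x + i) - (x + j)" by (simp add: mod_eq_dvd_iff)
      then have "int n dvd i - j" by simp
      moreover have "\<bar>i - j\<bar> < int n" using b n by auto
      ultimately have "i = j" by (rule dvd0)
      then show ?thesis using 1 e by simp
    next
      case 2
      have "x mod int n = (y + j) mod int n" "(x + i) mod int n = y mod int n" using 2 b by simp_all
      then have "int n dvd x - (y + j)" "int n dvd (x + i) - y" by (simp_all add: mod_eq_dvd_iff)
      then have "int n dvd ((x + i) - y) - (x - (y + j))" using dvd_diff by blast
      then have "int n dvd i + j" by (simp add: algebra_simps)
      then have "int n \<le> i + j" using b by (intro zdvd_imp_le) auto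
      then show ?thesis using b n by auto
    qed
  qed
  moreover have "f ` (verts n \<times> {1..int k}) = cycle_power n k"
  proof
    show "f ` (verts n \<times> {1..int k}) \<subseteq> cycle_power n k"
    proof (rule image_subsetI)
      fix p assume p: "p \<in> verts n \<times> {1..int k}"
      obtain x i where e: "p = (x, i)" by (cases p)
      have b: "0 \<le> x" "x < int n" "1 \<le> i" "i \<le> int k" using p by (auto simp: e verts_def)
      have "((x + i) mod int n - x) mod int n = i" using b n by (simp add: mod_simps)
      moreover from this have "x \<noteq> (x + i) mod int n" using b by auto
      ultimately have "cadj n k x ((x + i) mod int n)" using b by (simp add: cadj_def)
      moreover have "x \<in> verts n" "(x + i) mod int n \<in> verts n" using b by (auto simp: verts_def)
      ultimately show "f p \<in> cycle_power n k" unfolding cycle_power_def f_def e prod.case by blast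
    qed
    have *: "{x, y} \<in> f ` (verts n \<times> {1..int k})"
      if "x \<in> verts n" "y \<in> verts n" "x \<noteq> y" "(y - x) mod int n \<le> int k" for x y
    proof (rule rev_image_eqI[of "(x, (y - x) mod int n)"])
      have b: "0 \<le> x" "x < int n" "0 \<le> y" "y < int n" using that by (auto simp: verts_def)
      have e: "(x + (y - x) mod int n) mod int n = y" using b by (simp add: mod_simps)
      have "(y - x) mod int n \<noteq> 0" using e b that(3) by auto
      moreover have "0 \<le> (y - x) mod int n" using b by simp
      ultimately show "(x, (y - x) mod int n) \<in> verts n \<times> {1..int k}" using that by auto
      show "{x, y} = f (x, (y - x) mod int n)" by (simp add: f_def e)
    qed
    show "cycle_power n k \<subseteq> f ` (verts n \<times> {1..int k})"
    proof
      fix e assume "e \<in> cycle_power n k"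
      then obtain x y where e: "e = {x, y}" "x \<in> verts n" "y \<in> verts n" "cadj n k x y" unfolding cycle_power_def by blast
      from e(4) have "x \<noteq> y" and "(y - x) mod int n \<le> int k \<or> (x - y) mod int n \<le> int k"
        by (auto simp: cadj_def)
      then show "e \<in> f ` (verts n \<times> {1..int k})"
        using *[OF e(2,3)] *[OF e(3,2)] e(1) by (auto simp: insert_commute)
    qed
  qed
  ultimately have "card (cycle_power n k) = card (verts n \<times> {1..int k})" by (metis card_image)
  then show ?thesis by (simp add: card_cartesian_product verts_def)
qed

lemma inj_on_relabel:
  assumes "\<pi> permutes verts n"
  shows "inj_on (\<lambda>x. nat (\<pi> x) + 1) (verts n)" and "x \<in> verts n \<Longrightarrow> nat (\<pi> x) + 1 \<in> {1..n}"
proof -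
  have r: "0 \<le> \<pi> x \<and> \<pi> x < int n" if "x \<in> verts n" for x
    using permutes_in_image[OF assms, of x] that by (simp add: verts_def)
  show "inj_on (\<lambda>x. nat (\<pi> x) + 1) (verts n)"
  proof (rule inj_onI)
    fix x y assume xy: "x \<in> verts n" "y \<in> verts n" "nat (\<pi> x) + 1 = nat (\<pi> y) + 1"
    then have "nat (\<pi> x) = nat (\<pi> y)" by simp
    then have "\<pi> x = \<pi> y"
      using r[OF xy(1)] r[OF xy(2)] eq_nat_nat_iff[of "\<pi> x" "\<pi> y"] by blast
    then show "x = y" using permutes_inj[OF assms] by (simp add: inj_eq)
  qed
  show "nat (\<pi> x) + 1 \<in> {1..n}" if "x \<in> verts n" using r[OF that] by auto
qed

lemma card_copy_edges:
  assumes "\<pi> permutes verts n" "n > 2 * k"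
  shows "card (copy_edges n k \<pi>) = k * n" and "copy_edges n k \<pi> \<subseteq> pairs_of {1..n}"
proof -
  have sub: "cycle_power n k \<subseteq> Pow (verts n)" by (auto simp: cycle_power_def)
  have "inj_on ((`) (\<lambda>x. nat (\<pi> x) + 1)) (cycle_power n k)"
    by (rule inj_on_subset[OF inj_on_image_Pow[OF inj_on_relabel(1)[OF assms(1)]] sub])
  then show "card (copy_edges n k \<pi>) = k * n"
    unfolding copy_edges_def by (simp add: card_image card_cycle_power[OF assms(2)])
  show "copy_edges n k \<pi> \<subseteq> pairs_of {1..n}"
  proof
    fix e assume "e \<in> copy_edges n k \<pi>"
    then obtain x y where xy: "x \<in> verts n" "y \<in> verts n" "x \<noteq> y" "e = {nat (\<pi> x) + 1, nat (\<pi> y) + 1}"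
      unfolding copy_edges_def cycle_power_def cadj_def by auto
    have "nat (\<pi> x) + 1 \<noteq> nat (\<pi> y) + 1"
      using inj_onD[OF inj_on_relabel(1)[OF assms(1)], of x y] xy by auto
    then show "e \<in> pairs_of {1..n}"
      using inj_on_relabel(2)[OF assms(1)] xy by (auto simp: pairs_of_def)
  qed
qed

lemma contains_copy_if:
  assumes \<pi>: "\<pi> permutes verts n" and n: "n > 2 * k" and E: "copy_edges n k \<pi> \<subseteq> E"
  shows "contains_copy ({1..n}, E) (ham_cycle_power n k)"
proof -
  define g where "g = (\<lambda>x. nat (\<pi> x) + 1)"
  define f where "f v = g (int v - 1)" for v
  have sh: "int v - 1 \<in> verts n" if "v \<in> {1..n}" for v using that by (auto simp: verts_def)
  have inj: "inj_on f {1..n}"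
  proof (rule inj_onI)
    fix v w assume vw: "v \<in> {1..n}" "w \<in> {1..n}" "f v = f w"
    then have "int v - 1 = int w - 1"
      using inj_onD[OF inj_on_relabel(1)[OF \<pi>] _ sh[OF vw(1)] sh[OF vw(2)]] by (simp add: f_def g_def)
    then show "v = w" by simp
  qed
  have sub: "f ` {1..n} \<subseteq> {1..n}"
    using inj_on_relabel(2)[OF \<pi> sh] by (auto simp: f_def g_def)
  have "f ` e \<in> E" if eH: "e \<in> snd (ham_cycle_power n k)" for e
  proof -
    obtain v w i where e: "e = {v, w}" "v \<in> {1..n}" "w \<in> {1..n}" "v \<noteq> w" "i \<in> {1..k}" "[w = v + i] (mod n)"
      using eH unfolding ham_cycle_power_def snd_conv by blast
    have "[int w = int (v + i)] (mod int n)" using e(6) by (simp only: cong_int_iff)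
    then have "int w mod int n = (int v + int i) mod int n" by (simp add: cong_def)
    then have "(int w - int v) mod int n = (int v + int i - int v) mod int n"
      by (rule mod_diff_cong) simp
    then have "((int w - 1) - (int v - 1)) mod int n = int i mod int n" by simp
    also have "\<dots> = int i" using e(5) n by auto
    finally have "((int w - 1) - (int v - 1)) mod int n \<le> int k" using e(5) by simp
    then have "cadj n k (int v - 1) (int w - 1)" using e(4) by (simp add: cadj_def)
    then have "{int v - 1, int w - 1} \<in> cycle_power n k" using sh[OF e(2)] sh[OF e(3)] unfolding cycle_power_def by blast
    then have "g ` {int v - 1, int w - 1} \<in> copy_edges n k \<pi>" unfolding copy_edges_def g_def by (rule imageI)
    moreover have "g ` {int v - 1, int w - 1} = f ` e" by (simp add: e f_def)
    ultimately show ?thesis using E by auto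
  qed
  then show ?thesis using inj sub unfolding contains_copy_def by (intro exI[of _ f]) (auto simp: ham_cycle_power_def)
qed

text \<open>A common edge is the image of some edge under \<open>\<pi>\<close> and of some edge
  under \<open>\<sigma>\<close>; then \<open>inv \<sigma> \<circ> \<pi>\<close> maps the first to
  the second, which gives an edge on the graph of this permutation.\<close>

lemma card_common_edges:
  assumes \<pi>: "\<pi> permutes verts n" and \<sigma>: "\<sigma> permutes verts n"
  shows "card (copy_edges n k \<pi> \<inter> copy_edges n k \<sigma>) \<le> card (edges n k (graph_of n (inv \<sigma> \<circ> \<pi>)))"
proof -
  define \<tau> where "\<tau> = inv \<sigma> \<circ> \<pi>"
  define g where "g = (\<lambda>x. nat (\<pi> x) + 1)"
  have fin: "finite (edges n k (graph_of n \<tau>))" by (rule finite_edges) (simp add: graph_of_def)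
  have "copy_edges n k \<pi> \<inter> copy_edges n k \<sigma> \<subseteq> (\<lambda>e. (g \<circ> fst) ` e) ` edges n k (graph_of n \<tau>)"
  proof
    fix e assume e: "e \<in> copy_edges n k \<pi> \<inter> copy_edges n k \<sigma>"
    obtain x y where xy: "x \<in> verts n" "y \<in> verts n" "cadj n k x y" "e = {g x, g y}"
      using e unfolding copy_edges_def cycle_power_def g_def by auto
    obtain u v where uv: "u \<in> verts n" "v \<in> verts n" "cadj n k u v" "e = {nat (\<sigma> u) + 1, nat (\<sigma> v) + 1}"
      using e unfolding copy_edges_def cycle_power_def by auto
    have nn: "0 \<le> \<pi> a" "0 \<le> \<sigma> a" if "a \<in> verts n" for a
      using permutes_in_image[OF \<pi>, of a] permutes_in_image[OF \<sigma>, of a] that by (auto simp: verts_def)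
    have pull: "\<tau> a = b" if "a \<in> verts n" "b \<in> verts n" "g a = nat (\<sigma> b) + 1" for a b
    proof -
      have "\<pi> a = \<sigma> b" using that nn[OF that(1)] nn[OF that(2)] by (simp add: g_def)
      then show ?thesis using permutes_inverses(2)[OF \<sigma>] by (simp add: \<tau>_def)
    qed
    have "{g x, g y} = {nat (\<sigma> u) + 1, nat (\<sigma> v) + 1}" using xy(4) uv(4) by simp
    then consider "g x = nat (\<sigma> u) + 1" "g y = nat (\<sigma> v) + 1" | "g x = nat (\<sigma> v) + 1" "g y = nat (\<sigma> u) + 1"
      by (auto simp: doubleton_eq_iff)
    then have "cadj n k (\<tau> x) (\<tau> y)"
    proof cases
      case 1
      then show ?thesis using pull[OF xy(1) uv(1)] pull[OF xy(2) uv(2)] uv(3) by simp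
    next
      case 2
      then show ?thesis using pull[OF xy(1) uv(2)] pull[OF xy(2) uv(1)] cadj_sym[OF uv(3)] by simp
    qed
    then have "padj n k (x, \<tau> x) (y, \<tau> y)" using xy(3) by (simp add: padj_def)
    moreover have "(x, \<tau> x) \<in> graph_of n \<tau>" "(y, \<tau> y) \<in> graph_of n \<tau>" using xy by (auto simp: graph_of_def)
    ultimately have "{(x, \<tau> x), (y, \<tau> y)} \<in> edges n k (graph_of n \<tau>)" unfolding edges_def by blast
    then show "e \<in> (\<lambda>e. (g \<circ> fst) ` e) ` edges n k (graph_of n \<tau>)"
      by (rule rev_image_eqI) (simp add: xy(4))
  qed
  then have "card (copy_edges n k \<pi> \<inter> copy_edges n k \<sigma>) \<le> card ((\<lambda>e. (g \<circ> fst) ` e) ` edges n k (graph_of n \<tau>))"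
    by (rule card_mono[rotated]) (use fin in simp)
  also have "\<dots> \<le> card (edges n k (graph_of n \<tau>))" by (rule card_image_le[OF fin])
  finally show ?thesis by (simp add: \<tau>_def)
qed

section \<open>Containment probability in the uniform random graph\<close>

lemma finite_pairs_of: "finite V \<Longrightarrow> finite (pairs_of V)"
  by (rule finite_subset[of _ "Pow V"]) (auto simp: pairs_of_def)

lemma card_pairs_of: "finite V \<Longrightarrow> card (pairs_of V) = card V choose 2"
  by (simp add: pairs_of_def n_subsets)

lemma prob_G_uniform:
  assumes M: "M \<le> n choose 2"
  shows "measure_pmf.prob (G_uniform n M) {G. A G}
    = real (card {E. E \<subseteq> pairs_of {1..n} \<and> card E = M \<and> A ({1..n}, E)}) / real ((n choose 2) choose M)"
proof -
  define \<Omega> where "\<Omega> = {E. E \<subseteq> pairs_of {1..n} \<and> card E = M}"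
  define S where "S = Pair {1..n} ` \<Omega>"
  have inj: "inj_on (Pair {1..n}) X" for X :: "nat set set set" by (simp add: inj_on_def)
  have S: "{({1..n}, E) | E. E \<subseteq> pairs_of {1..n} \<and> card E = M} = S" by (auto simp: S_def \<Omega>_def)
  have c\<Omega>: "card \<Omega> = (n choose 2) choose M"
    by (simp add: \<Omega>_def n_subsets finite_pairs_of card_pairs_of)
  have fin: "finite \<Omega>" by (rule finite_subset[of _ "Pow (pairs_of {1..n})"]) (auto simp: \<Omega>_def finite_pairs_of)
  have cS: "card S = (n choose 2) choose M" unfolding S_def by (rule trans[OF card_image[OF inj] c\<Omega>])
  \<comment> \<open>This excludes the empty set, on which \<open>pmf_of_set\<close> is
    unspecified.\<close>
  then have "card S > 0" using M by simp
  then have ne: "S \<noteq> {}" "finite S" using fin by (auto simp: S_def)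
  have "S \<inter> {G. A G} = Pair {1..n} ` {E \<in> \<Omega>. A ({1..n}, E)}" by (auto simp: S_def)
  then have "card (S \<inter> {G. A G}) = card {E \<in> \<Omega>. A ({1..n}, E)}" by (simp only: card_image[OF inj])
  then show ?thesis
    unfolding G_uniform_def S measure_pmf_of_set[OF ne] cS by (simp add: \<Omega>_def conj_assoc)
qed

lemma prob_lower_bound:
  fixes \<Theta> :: real
  assumes n: "n > 3 * k" and M: "M \<le> n choose 2" "2 * (k * n) < M" and N: "3 * (k * n) \<le> n choose 2"
    and r: "r = (real (n choose 2) - 2 * real (k * n)) / (real M - 2 * real (k * n))"
    and mom: "(\<Sum>\<pi>\<in>perms n. r ^ card (edges n k (graph_of n \<pi>))) \<le> fact n * \<Theta>"
  shows "measure_pmf.prob (G_uniform n M) {G. contains_copy G (ham_cycle_power n k)}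
    \<ge> 1 / (\<Theta> * (falling_ratio M (n choose 2) (2 * (k * n)) / (falling_ratio M (n choose 2) (k * n))^2))"
proof -
  let ?B = "{E. E \<subseteq> pairs_of {1..n} \<and> card E = M \<and> contains_copy ({1..n}, E) (ham_cycle_power n k)}"
  define P where "P = perms n"
  define m where "m = k * n"
  define g where "g = falling_ratio (real M) (real (n choose 2))"
  define h where "h = copy_edges n k"
  let ?A = "{E. E \<subseteq> pairs_of {1..n} \<and> card E = M \<and> (\<exists>\<pi>\<in>P. h \<pi> \<subseteq> E)}"
  have n2: "n > 2 * k" using n by simp
  have finP: "finite P" unfolding P_def by (rule finite_permutations) simp
  have cP: "card P = fact n" unfolding P_def by (rule card_permutations) (auto simp: verts_def)
  have MN: "real M \<le> real (n choose 2)" using M by simp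
  have mM: "2 * real m < real M"
  proof -
    have "real (2 * (k * n)) < real M" using M(2) by (rule of_nat_less_iff[THEN iffD2])
    then show ?thesis by (simp add: m_def)
  qed
  have r1: "r \<ge> 1" using MN mM by (simp add: r m_def)
  have gpos: "0 < g a" if "a \<le> 2 * m" for a
  proof -
    have "real a \<le> 2 * real m" using of_nat_mono[OF that] by simp
    then show ?thesis unfolding g_def by (intro falling_ratio_pos MN) (use mM in simp)
  qed
  have gnn: "0 \<le> g (2 * m - c)" for c by (rule less_imp_le, rule gpos) simp
  define S where "S = (\<Sum>\<pi>\<in>P. \<Sum>\<sigma>\<in>P. g (2 * m - card (h \<pi> \<inter> h \<sigma>)))"
  have id: "id \<in> P" by (simp add: P_def permutes_id)
  have S0: "S > 0"
  proof -
    have "0 < g (2 * m - card (h id \<inter> h id))" by (rule gpos) simp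
    also have "\<dots> \<le> (\<Sum>\<sigma>\<in>P. g (2 * m - card (h id \<inter> h \<sigma>)))"
      by (rule member_le_sum[OF id _ finP]) (rule gnn)
    also have "\<dots> \<le> S" unfolding S_def
      by (rule member_le_sum[OF id _ finP]) (intro sum_nonneg gnn)
    finally show ?thesis .
  qed
  have S_le: "S \<le> fact n * (g (2 * m) * (fact n * \<Theta>))"
  proof -
    have "S = (\<Sum>\<sigma>\<in>P. \<Sum>\<pi>\<in>P. g (2 * m - card (h \<pi> \<inter> h \<sigma>)))" unfolding S_def by (rule sum.swap)
    also have "\<dots> \<le> (\<Sum>\<sigma>\<in>P. g (2 * m) * (fact n * \<Theta>))"
    proof (rule sum_mono)
      fix \<sigma> assume "\<sigma> \<in> P"
      then have \<sigma>: "\<sigma> permutes verts n" by (simp add: P_def)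
      have "(\<Sum>\<pi>\<in>P. g (2 * m - card (h \<pi> \<inter> h \<sigma>))) \<le> (\<Sum>\<pi>\<in>P. g (2 * m) * r ^ card (edges n k (graph_of n (inv \<sigma> \<circ> \<pi>))))"
      proof (rule sum_mono)
        fix \<pi> assume "\<pi> \<in> P"
        then have \<pi>: "\<pi> permutes verts n" by (simp add: P_def)
        have "card (h \<pi> \<inter> h \<sigma>) \<le> card (h \<pi>)"
          by (rule card_mono) (auto simp: h_def intro: finite_subset[OF card_copy_edges(2)[OF \<pi> n2]] finite_pairs_of)
        then have "card (h \<pi> \<inter> h \<sigma>) \<le> 2 * m" using card_copy_edges(1)[OF \<pi> n2] by (simp add: h_def m_def)
        then have "g (2 * m - card (h \<pi> \<inter> h \<sigma>)) \<le> g (2 * m) * r ^ card (h \<pi> \<inter> h \<sigma>)"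
          unfolding g_def r using falling_ratio_drop[OF MN mM] by (simp add: m_def)
        also have "\<dots> \<le> g (2 * m) * r ^ card (edges n k (graph_of n (inv \<sigma> \<circ> \<pi>)))"
          unfolding h_def
          by (intro mult_left_mono power_increasing card_common_edges \<pi> \<sigma> r1) (use gpos[of "2 * m"] in simp)
        finally show "g (2 * m - card (h \<pi> \<inter> h \<sigma>)) \<le> g (2 * m) * r ^ card (edges n k (graph_of n (inv \<sigma> \<circ> \<pi>)))" .
      qed
      also have "\<dots> = g (2 * m) * (\<Sum>\<pi>\<in>P. r ^ card (edges n k (graph_of n (inv \<sigma> \<circ> \<pi>))))"
        by (simp only: sum_distrib_left)
      \<comment> \<open>Composition with \<open>inv \<sigma>\<close> permutes the index set, so the
        sum over pairs is controlled by \<open>n!\<close> times the moment of a single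
        permutation.\<close>
      also have "(\<Sum>\<pi>\<in>P. r ^ card (edges n k (graph_of n (inv \<sigma> \<circ> \<pi>)))) = (\<Sum>\<tau>\<in>P. r ^ card (edges n k (graph_of n \<tau>)))"
        unfolding P_def by (rule setum_permutations_compose_left[OF permutes_inv[OF \<sigma>], symmetric])
      also have "g (2 * m) * \<dots> \<le> g (2 * m) * (fact n * \<Theta>)"
        using mom gpos[of "2 * m"] by (intro mult_left_mono) (auto simp: P_def)
      finally show "(\<Sum>\<pi>\<in>P. g (2 * m - card (h \<pi> \<inter> h \<sigma>))) \<le> g (2 * m) * (fact n * \<Theta>)" .
    qed
    also have "\<dots> = fact n * (g (2 * m) * (fact n * \<Theta>))" by (simp add: cP)
    finally show ?thesis .
  qed
  have "1 / (\<Theta> * (g (2 * m) / (g m)^2)) = (fact n * g m)^2 / (fact n * (g (2 * m) * (fact n * \<Theta>)))"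
    by (simp add: power2_eq_square)
  also have "\<dots> \<le> (fact n * g m)^2 / S"
    by (rule divide_left_mono[OF S_le]) (use S0 S_le in \<open>auto intro!: mult_pos_pos\<close>)
  also have "\<dots> = (real (card P) * g m)^2 / S" by (simp add: cP)
  also have "\<dots> \<le> real (card ?A) / real ((n choose 2) choose M)"
    using second_moment_count[OF finite_pairs_of[of "{1..n}"] finP, of M m h] M card_copy_edges[OF _ n2] S0
    by (simp add: card_pairs_of P_def h_def m_def S_def g_def)
  also have "\<dots> \<le> measure_pmf.prob (G_uniform n M) {G. contains_copy G (ham_cycle_power n k)}"
    unfolding prob_G_uniform[OF M(1)]
  proof (intro divide_right_mono of_nat_mono card_mono)
    show "?A
      \<subseteq> ?B"
      using contains_copy_if[OF _ n2] by (auto simp: P_def h_def)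
    show "finite ?B"
      by (rule finite_subset[of _ "Pow (pairs_of {1..n})"]) (auto simp: finite_pairs_of)
  qed simp
  finally show ?thesis by (simp add: g_def m_def)
qed

section \<open>Cancellation of the exponents and passage to the limit\<close>

lemma real_choose_two: "real (n choose 2) = real n * (real n - 1) / 2"
proof (cases n)
  case (Suc m)
  have "even (n * (n - 1))" by (cases "even n") auto
  then have "real (n * (n - 1) div 2) = real (n * (n - 1)) / 2" by (simp add: real_of_nat_div)
  then show ?thesis by (simp add: choose_two Suc algebra_simps)
qed simp

text \<open>For \<open>m = k n\<close> the quotient \<open>m^2 / N\<close> slightly exceeds
  \<open>2 k^2\<close>. After replacing \<open>2 k^2\<close> by it, the main terms
  \<open>m^2 / M\<close> and \<open>m^2 / N\<close> cancel against those of
  \<open>falling_ratio_double\<close>, and only errors of cubic order in \<open>m\<close> over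
  quadratic order remain. In the theorem \<open>L\<close> is \<open>p_star\<close> times
  \<open>N\<close>.\<close>

lemma exponent_bound:
  fixes m M N L k n :: real
  assumes M: "0 < L" "L \<le> M - 2 * m" "M \<le> N" "0 < m" "2 * m < N"
    and k: "2 * k^2 \<le> m^2 / N"
  shows "(- (m^2) / M + m^2 / (N - m) + 2 * m ^ 3 / (N - m)^2) + 2 * k^2 * ((N - 2 * m) / (M - 2 * m) - 1)
    \<le> m ^ 3 / (N * (N - m)) + 2 * m ^ 3 / (N - m)^2 + 2 * m ^ 3 / L^2"
proof -
  have pos: "0 < M - 2 * m" "0 < M" "0 < N" "0 < N - m" using M by linarith+
  have "2 * k^2 * ((N - 2 * m) / (M - 2 * m) - 1) = 2 * k^2 * ((N - M) / (M - 2 * m))"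
    using pos by (simp add: field_simps)
  also have "\<dots> \<le> m^2 / N * ((N - M) / (M - 2 * m))"
    by (rule mult_right_mono[OF k]) (use pos M in simp)
  also have "\<dots> = m^2 / M - m^2 / N + (m^2 / M - m^2 / N) * (2 * m / (M - 2 * m))"
  proof -
    have "(N - M) / (M - 2 * m) = (N / M - 1) * (1 + 2 * m / (M - 2 * m))"
      using pos by (simp add: field_simps)
    then have "m^2 / N * ((N - M) / (M - 2 * m)) = (m^2 / N * (N / M - 1)) * (1 + 2 * m / (M - 2 * m))"
      by simp
    also have "m^2 / N * (N / M - 1) = m^2 / M - m^2 / N" using pos by (simp add: field_simps)
    finally show ?thesis by (simp add: distrib_left)
  qed
  also have "(m^2 / M - m^2 / N) * (2 * m / (M - 2 * m)) \<le> 2 * m ^ 3 / L^2"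
  proof -
    have LM: "L \<le> M" using M by linarith
    have "(m^2 / M - m^2 / N) * (2 * m / (M - 2 * m)) \<le> m^2 / M * (2 * m / (M - 2 * m))"
      using pos M by (intro mult_right_mono) auto
    also have "\<dots> \<le> m^2 / L * (2 * m / L)"
      using pos M LM by (intro mult_mono divide_left_mono) auto
    finally show ?thesis by (simp add: power2_eq_square power3_eq_cube mult_ac)
  qed
  finally have 1: "2 * k^2 * ((N - 2 * m) / (M - 2 * m) - 1) \<le> m^2 / M - m^2 / N + 2 * m ^ 3 / L^2" by simp
  have "m^2 / (N - m) - m^2 / N = m ^ 3 / (N * (N - m))"
    using pos by (simp add: divide_simps) (simp add: algebra_simps power2_eq_square power3_eq_cube)
  moreover have "- (m^2) / M = - (m^2 / M)" by simp
  ultimately show ?thesis using 1 by linarith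
qed

theorem theorem2p1:
  fixes k :: nat and \<epsilon> :: real and p :: "nat \<Rightarrow> real" and M :: "nat \<Rightarrow> nat"
  assumes "k \<ge> 4" and "\<epsilon> > 0"
    and "\<forall>\<^sub>F n in sequentially. (1 + \<epsilon>) * p_star k n \<le> p n \<and> p n \<le> 1"
    and "\<And>n. M n = nat \<lfloor>p n * real (n choose 2)\<rfloor> \<or> M n = nat \<lceil>p n * real (n choose 2)\<rceil>"
  shows "(\<lambda>n. measure_pmf.prob (G_uniform n (M n)) {G. contains_copy G (ham_cycle_power n k)})
           \<longlonglongrightarrow> 1"
proof -
  define N where "N n = real (n choose 2)" for n
  define m where "m n = real (k * n)" for n
  define L where "L n = p_star k n * N n" for n
  \<comment> \<open>Half of \<open>\<epsilon>\<close> is given up for rounding and for the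
    \<open>2 m\<close> in the denominator of \<open>r\<close>, see \<open>ev1\<close>; the other
    half makes \<open>r\<close> at most \<open>1 / ((1 + \<epsilon>/2) p_star)\<close>. The exponent
    \<open>1/3\<close> fits the \<open>q ^ 3\<close> of \<open>permutation_moment\<close>.\<close>
  define q where "q = (1 + \<epsilon> / 2) powr (- real k / 3)"
  have k: "real k \<ge> 4" using assms(1) by simp
  have q: "0 < q" "q < 1" using assms(2) k by (auto simp: q_def powr_less_one)
  have q3: "q ^ 3 = inverse ((1 + \<epsilon> / 2) ^ k)"
  proof -
    have "q ^ 3 = q powr 3" using q(1) by simp
    also have "\<dots> = (1 + \<epsilon> / 2) powr (- real k)" unfolding q_def powr_powr by simp
    also have "\<dots> = inverse ((1 + \<epsilon> / 2) ^ k)" using assms(2) by (simp add: powr_minus powr_realpow)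
    finally show ?thesis .
  qed
  obtain \<Theta> where \<Theta>: "\<Theta> \<longlonglongrightarrow> 1" "\<forall>\<^sub>F n in sequentially. \<forall>r.
      1 \<le> r \<longrightarrow> r ^ k \<le> q ^ 3 * real n / exp 1 \<longrightarrow>
      (\<Sum>\<pi>\<in>perms n. r ^ card (edges n k (graph_of n \<pi>)))
        \<le> fact n * \<Theta> n * exp (2 * real k ^ 2 * (r - 1))"
    using permutation_moment[OF assms(1) q] by blast
  define err where "err n = m n ^ 3 / (N n * (N n - m n)) + 2 * m n ^ 3 / (N n - m n)^2 + 2 * m n ^ 3 / (L n)^2" for n
  define s where "s = 1 / real k"
  have s: "0 < s" "s \<le> 1 / 4" using k by (auto simp: s_def field_simps)
  have Nn: "N n = real n * (real n - 1) / 2" for n by (simp add: N_def real_choose_two)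
  have mn: "m n = real k * real n" for n by (simp add: m_def)
  have ps: "p_star k n = (exp 1 / real n) powr s" for n by (simp add: p_star_def s_def)
  have k0: "real k > 0" using k by simp
  have l1: "(\<lambda>n. m n ^ 3 / (N n * (N n - m n))) \<longlonglongrightarrow> 0"
    unfolding Nn mn using k0 by real_asymp
  have l2: "(\<lambda>n. 2 * m n ^ 3 / (N n - m n)^2) \<longlonglongrightarrow> 0"
    unfolding Nn mn using k0 by real_asymp
  \<comment> \<open>The dominating error, of order \<open>n powr (2 / k - 1)\<close>.\<close>
  have l3: "(\<lambda>n. 2 * m n ^ 3 / (L n)^2) \<longlonglongrightarrow> 0"
  proof -
    have "1 - 2 * s > 0" using s by linarith
    then show ?thesis unfolding L_def Nn mn ps using k0 s by real_asymp
  qed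
  have "err \<longlonglongrightarrow> 0 + 0 + 0" unfolding err_def by (intro tendsto_add l1 l2 l3)
  then have "(\<lambda>n. 1 / (\<Theta> n * exp (err n))) \<longlonglongrightarrow> 1 / (1 * exp (0 + 0 + 0))"
    by (intro tendsto_intros \<Theta>(1)) auto
  then have lim: "(\<lambda>n. 1 / (\<Theta> n * exp (err n))) \<longlonglongrightarrow> 1" by simp
  have ev1: "\<forall>\<^sub>F n in sequentially. 1 + 2 * m n \<le> \<epsilon> / 2 * L n"
  proof -
    have "1 - s > 0" using s by linarith
    then show ?thesis unfolding L_def Nn mn ps using k0 s assms(2) by real_asymp
  qed
  have ev2: "\<forall>\<^sub>F n in sequentially. 3 * m n \<le> N n" unfolding Nn mn using k0 by real_asymp
  have ev3: "\<forall>\<^sub>F n in sequentially. n > 3 * k" by (rule eventually_gt_at_top)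
  have ev4: "\<forall>\<^sub>F n in sequentially. \<Theta> n > 0" by (rule order_tendstoD(1)[OF \<Theta>(1)]) simp
  have lower: "\<forall>\<^sub>F n in sequentially. 1 / (\<Theta> n * exp (err n))
      \<le> measure_pmf.prob (G_uniform n (M n)) {G. contains_copy G (ham_cycle_power n k)}"
    using ev1 ev2 ev3 ev4 assms(3) \<Theta>(2)
  proof eventually_elim
    case (elim n)
    have n0: "real n > 0" using elim(3) by simp
    have n1: "real n - 1 > 0" using elim(3) assms(1) by simp
    have N0: "N n > 0" using n0 n1 by (simp add: Nn)
    have p0: "p_star k n > 0" using n0 by (simp add: ps)
    have L0: "L n > 0" using N0 p0 by (simp add: L_def)
    have m0: "m n > 0" using n0 k0 by (simp add: mn)
    have Mle: "M n \<le> n choose 2"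
    proof -
      have "p n * N n \<le> N n" using elim(5) N0 by simp
      then have "\<lfloor>p n * N n\<rfloor> \<le> int (n choose 2)" "\<lceil>p n * N n\<rceil> \<le> int (n choose 2)"
        by (auto simp: N_def floor_le_iff ceiling_le_iff)
      then show ?thesis using assms(4)[of n] by (auto simp: N_def nat_le_iff)
    qed
    have Mge: "p n * N n - 1 \<le> real (M n)"
      using assms(4)[of n] unfolding N_def[symmetric] by (auto; linarith)
    have "(1 + \<epsilon>) * L n \<le> p n * N n"
      using elim(5) N0 mult_right_mono[of "(1 + \<epsilon>) * p_star k n" "p n" "N n"] by (simp add: L_def mult_ac)
    then have Mlow: "(1 + \<epsilon> / 2) * L n \<le> real (M n) - 2 * m n"
      using Mge elim(1) by (simp add: algebra_simps)
    have "L n \<le> (1 + \<epsilon> / 2) * L n" using L0 assms(2) by simp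
    then have LM: "L n \<le> real (M n) - 2 * m n" using Mlow by linarith
    have MN: "real (M n) \<le> N n" using Mle by (simp add: N_def)
    have M2: "2 * (k * n) < M n"
    proof -
      have "real (2 * (k * n)) < real (M n)" using LM L0 by (simp add: m_def)
      then show ?thesis by (rule of_nat_less_iff[THEN iffD1])
    qed
    define r where "r = (N n - 2 * m n) / (real (M n) - 2 * m n)"
    have r1: "1 \<le> r" using LM L0 MN by (simp add: r_def)
    have "r \<le> N n / ((1 + \<epsilon> / 2) * L n)"
      unfolding r_def using Mlow L0 m0 N0 assms(2) elim(2) by (intro frac_le) auto
    also have "\<dots> = inverse (1 + \<epsilon> / 2) * inverse (p_star k n)"
    proof -
      have "a / (b * (c * a)) = inverse b * inverse c" if "a > 0" for a b c :: real
        using that by (simp add: divide_inverse mult_ac)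
      from this[OF N0] show ?thesis by (simp only: L_def)
    qed
    finally have "r ^ k \<le> (inverse (1 + \<epsilon> / 2) * inverse (p_star k n)) ^ k"
      using r1 by (intro power_mono) auto
    also have "\<dots> = q ^ 3 * inverse (p_star k n ^ k)"
      by (simp add: q3 power_mult_distrib power_inverse)
    also have "p_star k n ^ k = exp 1 / real n"
      using n0 k0 by (simp add: p_star_def powr_powr flip: powr_realpow)
    finally have rk: "r ^ k \<le> q ^ 3 * real n / exp 1" by simp
    have mom: "(\<Sum>\<pi>\<in>perms n. r ^ card (edges n k (graph_of n \<pi>)))
        \<le> fact n * (\<Theta> n * exp (2 * real k ^ 2 * (r - 1)))"
      using elim(6) r1 rk by (simp add: mult.assoc)
    let ?d = "- ((m n)^2) / real (M n) + (m n)^2 / (N n - m n) + 2 * m n ^ 3 / (N n - m n)^2"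
    define F where "F = falling_ratio (real (M n)) (N n)"
    have fr: "F (2 * (k * n)) \<le> (F (k * n))^2 * exp (?d)"
      unfolding F_def m_def by (rule falling_ratio_double) (use MN LM L0 elim(2) in \<open>auto simp: m_def\<close>)
    have Fpos: "0 < F (k * n)" "0 < F (2 * (k * n))"
      unfolding F_def using M2 by (auto intro!: falling_ratio_pos MN simp flip: of_nat_mult)
    have "2 * (real k)^2 \<le> (m n)^2 / N n"
      using n0 n1 by (simp add: Nn mn field_simps power2_eq_square)
    then have ex: "(?d) + 2 * (real k)^2 * (r - 1) \<le> err n"
      unfolding r_def err_def by (intro exponent_bound L0 LM MN m0) (use elim(2) m0 in auto)
    have "F (2 * (k * n)) / (F (k * n))^2 \<le> exp (?d)"
      using fr Fpos by (simp add: pos_divide_le_eq mult.commute)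
    then have "exp (2 * real k ^ 2 * (r - 1)) * (F (2 * (k * n)) / (F (k * n))^2)
      \<le> exp (2 * real k ^ 2 * (r - 1)) * exp (?d)"
      by (rule mult_left_mono) simp
    also have "\<dots> \<le> exp (err n)" unfolding exp_add[symmetric] using ex by (simp add: add.commute)
    finally have fin: "exp (2 * real k ^ 2 * (r - 1)) * (F (2 * (k * n)) / (F (k * n))^2) \<le> exp (err n)" .
    have "1 / (\<Theta> n * exp (err n)) \<le> 1 / (\<Theta> n * (exp (2 * real k ^ 2 * (r - 1)) * (F (2 * (k * n)) / (F (k * n))^2)))"
      by (intro divide_left_mono mult_left_mono[OF fin]) (use elim(4) Fpos in \<open>auto intro!: mult_pos_pos divide_pos_pos\<close>)
    also have "\<dots> = 1 / ((\<Theta> n * exp (2 * real k ^ 2 * (r - 1))) * (F (2 * (k * n)) / (F (k * n))^2))"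
      by (simp only: mult.assoc)
    also have "\<dots> \<le> measure_pmf.prob (G_uniform n (M n)) {G. contains_copy G (ham_cycle_power n k)}"
      unfolding F_def N_def
    proof (rule prob_lower_bound[OF elim(3) Mle M2])
      have "real (3 * (k * n)) \<le> real (n choose 2)" using elim(2) by (simp add: m_def N_def)
      then show "3 * (k * n) \<le> n choose 2" by (rule of_nat_le_iff[THEN iffD1])
      show "r = (real (n choose 2) - 2 * real (k * n)) / (real (M n) - 2 * real (k * n))"
        by (simp add: r_def m_def N_def)
    qed (rule mom)
    finally show ?case .
  qed
  show ?thesis
    by (rule tendsto_sandwich[OF lower _ lim tendsto_const]) (auto intro: always_eventually)
qed

end
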